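(* Let $R:V^{\otimes2}\to V^{\otimes2}$ be a skew-invertible involutive symmetry, $\hbar\neq0$, and let $\mathcal{W}(\mathcal{N})$ be the braided Weyl algebra with generating matrices $N$ and $D$. Put $\tilde D=\hbar^{-1}I+D$. Then for every $p\ge2$ the following identity holds in $\mathrm{End}(V)^{\otimes p}\otimes\mathcal{W}(\mathcal{N})$: $$\tilde D_1N_{\overline 2}\cdots N_{\overline p}=N_{\overline 2}\cdots N_{\overline p}\tilde D_1+\sum_{s=1}^{p-1}\hbar^s\sum_{2\le k_1<\dots<k_s\le p}\left(N_{\overline2}\cdots N_{\overline p}\right)^{(k_1\dots k_s)}\tilde D_1\,\mathcal{R}_{(1k_1\dots k_s)},$$ and consequently the action of the matrix $D$ on monomials is given by $$D_1\triangleright N_{\overline 2}\cdots N_{\overline p}=\sum_{s=1}^{p-1}\hbar^{s-1}\sum_{2\le k_1<\dots<k_s\le p}\left(N_{\overline2}\cdots N_{\overline p}\right)^{(k_1\dots k_s)}\mathcal{R}_{(1k_1\dots k_s)}.$$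
   Context: $V$ is a finite-dimensional vector space over $\mathbb{K}=\mathbb{R}$ or $\mathbb{C}$. An involutive symmetry is an operator $R$ on $V^{\otimes2}$ with $R_{12}R_{23}R_{12}=R_{23}R_{12}R_{23}$ ($R_{12}=R\otimes I$, $R_{23}=I\otimes R$) and $R^2=I$. It is skew-invertible if there is $\Psi\in\mathrm{End}(V^{\otimes2})$ with $\mathrm{Tr}_{(2)}R_{12}\Psi_{23}=P_{13}=\mathrm{Tr}_{(2)}\Psi_{12}R_{23}$, $P$ being the flip. The braided Weyl algebra $\mathcal{W}(\mathcal{N})$ is the unital associative algebra generated by the entries of two $\dim V\times\dim V$ matrices $N=\|n_i^j\|$, $D=\|d_i^j\|$ subject to $$RN_1RN_1-N_1RN_1R=\hbar(RN_1-N_1R),$$ $$R^{-1}D_1R^{-1}D_1=D_1R^{-1}D_1R^{-1},$$ $$D_1RN_1R-RN_1R^{-1}D_1=R+\hbar D_1R,$$ where $N_1=N\otimes I$, $D_1=D\otimes I$. $\mathcal{N}$ and $\mathcal{D}$ denote the subalgebras generated by the entries of $N$ and of $D$ respectively. For $n\in\mathcal N$, the element $d_i^j\triangleright n\in\mathcal{N}$ is obtained by using the third relation to write $d_i^j\,n$ as a sum of terms with elements of $\mathcal{N}$ on the left and elements of $\mathcal{D}$ on the right, and then applying to the $\mathcal{D}$-factors the character $\varepsilon$ with $\varepsilon(1)=1$, $\varepsilon(d_i^j)=0$ (this is known to be well defined). For a matrix with entries in $\mathcal N$, the action is applied entrywise. Notation. $R_k$ denotes $R$ acting in the $k$-th and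 $(k+1)$-st factors of $V^{\otimes p}$; subscript $1$ in $N_1,D_1,\tilde D_1$ means the matrix placed in the first factor. $N_{\overline k}=R_{k-1}\cdots R_1N_1R_1^{-1}\cdots R_{k-1}^{-1}$. For $1\le k<p$, $\mathcal{R}_{kp}=\mathcal{R}_{pk}=R_{p-1}R_{p-2}\cdots R_{k+1}R_kR_{k+1}\cdots R_{p-2}R_{p-1}$. For $2\le k_1<\dots<k_s\le p$, $\mathcal{R}_{(1k_1\dots k_s)}=\mathcal{R}_{1k_1}\mathcal{R}_{k_1k_2}\cdots\mathcal{R}_{k_{s-1}k_s}$, and $\left(N_{\overline2}\cdots N_{\overline p}\right)^{(k_1\dots k_s)}$ is the product $N_{\overline2}\cdots N_{\overline p}$ with the factors $N_{\overline{k_1}},\dots,N_{\overline{k_s}}$ omitted (an empty product being the identity). *)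

theory Defs
  imports
    "HOL-Analysis.Analysis"
    "HOL-Algebra.QuotRing"
    "HOL-Algebra.Generated_Rings"
    "HOL-Library.Poly_Mapping"
begin

section \<open>Symmetries\<close>

text \<open>
  We take \<open>V = K\<^sup>n\<close> with its standard basis, which is needed anyway to speak about the generating
  matrices. An operator on the tensor square of \<open>V\<close> is a matrix indexed by \<open>'n \<times> 'n\<close>
  (first index: row). The ground field is of class \<open>real_normed_field\<close> in the theorem: by
  Gelfand--Mazur such fields are, up to isomorphism, exactly the real and the complex numbers.
\<close>

definition on12 :: "'k::field ^ ('n::finite \<times> 'n) ^ ('n \<times> 'n)
    \<Rightarrow> 'k ^ ('n \<times> 'n \<times> 'n) ^ ('n \<times> 'n \<times> 'n)" where
  "on12 A = (\<chi> a b. if snd (snd a) = snd (snd b)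
     then A $ (fst a, fst (snd a)) $ (fst b, fst (snd b)) else 0)"

definition on23 :: "'k::field ^ ('n::finite \<times> 'n) ^ ('n \<times> 'n)
    \<Rightarrow> 'k ^ ('n \<times> 'n \<times> 'n) ^ ('n \<times> 'n \<times> 'n)" where
  "on23 A = (\<chi> a b. if fst a = fst b then A $ snd a $ snd b else 0)"

definition involutive_symmetry :: "'k::field ^ ('n::finite \<times> 'n) ^ ('n \<times> 'n) \<Rightarrow> bool" where
  "involutive_symmetry R \<longleftrightarrow>
     on12 R ** on23 R ** on12 R = on23 R ** on12 R ** on23 R \<and> R ** R = mat 1"

text \<open>Partial trace over the second factor; the result acts on factors 1 and 3.\<close>

definition Tr2 :: "'k::field ^ ('n::finite \<times> 'n \<times> 'n) ^ ('n \<times> 'n \<times> 'n)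
    \<Rightarrow> 'k ^ ('n \<times> 'n) ^ ('n \<times> 'n)" where
  "Tr2 A = (\<chi> a b. \<Sum>j\<in>UNIV. A $ (fst a, j, snd a) $ (fst b, j, snd b))"

definition flip_mat :: "'k::field ^ ('n::finite \<times> 'n) ^ ('n \<times> 'n)" where
  "flip_mat = (\<chi> a b. if fst a = snd b \<and> snd a = fst b then 1 else 0)"

definition skew_invertible :: "'k::field ^ ('n::finite \<times> 'n) ^ ('n \<times> 'n) \<Rightarrow> bool" where
  "skew_invertible R \<longleftrightarrow>
     (\<exists>\<Psi>. Tr2 (on12 R ** on23 \<Psi>) = flip_mat \<and> flip_mat = Tr2 (on12 \<Psi> ** on23 R))"

section \<open>Type class rings as ring records\<close>

definition type_ring :: "'a::ring_1 ring" where
  "type_ring = \<lparr>carrier = UNIV, monoid.mult = (*), one = 1, ring.zero = 0, add = (+)\<rparr>"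

section \<open>Matrices on tensor powers with entries in an algebra\<close>

text \<open>
  A \<open>K\<close>-algebra is given by a ring record \<open>S\<close> together with its structure map \<open>\<iota> :: 'k \<Rightarrow> 's\<close>.
  The ring \<open>End_tensor S p\<close> is the tensor product of \<open>End(V)\<^sup>\<otimes>\<^sup>p\<close> and \<open>S\<close>: square matrices over
  \<open>S\<close> whose rows and columns are indexed by words of length \<open>p\<close> over \<open>'n\<close>.
\<close>

definition multi_index :: "nat \<Rightarrow> 'n::finite list set" where
  "multi_index p = {I. length I = p}"

definition End_tensor :: "('s, 'm) ring_scheme \<Rightarrow> nat \<Rightarrow> ('n::finite list \<times> 'n list \<Rightarrow> 's) ring" where
  "End_tensor S p =
    \<lparr>carrier = (multi_index p \<times> multi_index p) \<rightarrow>\<^sub>E carrier S,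
     monoid.mult = (\<lambda>A B. \<lambda>(I, J) \<in> multi_index p \<times> multi_index p.
        \<Oplus>\<^bsub>S\<^esub>L\<in>multi_index p. A (I, L) \<otimes>\<^bsub>S\<^esub> B (L, J)),
     one = (\<lambda>(I, J) \<in> multi_index p \<times> multi_index p. if I = J then \<one>\<^bsub>S\<^esub> else \<zero>\<^bsub>S\<^esub>),
     ring.zero = (\<lambda>_ \<in> multi_index p \<times> multi_index p. \<zero>\<^bsub>S\<^esub>),
     add = (\<lambda>A B. \<lambda>IJ \<in> multi_index p \<times> multi_index p. A IJ \<oplus>\<^bsub>S\<^esub> B IJ)\<rparr>"

definition scale_mat :: "('s, 'm) ring_scheme \<Rightarrow> ('k \<Rightarrow> 's) \<Rightarrow> nat \<Rightarrow> 'k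
    \<Rightarrow> ('n::finite list \<times> 'n list \<Rightarrow> 's) \<Rightarrow> ('n list \<times> 'n list \<Rightarrow> 's)" where
  "scale_mat S \<iota> p c A = (\<lambda>IJ \<in> multi_index p \<times> multi_index p. \<iota> c \<otimes>\<^bsub>S\<^esub> A IJ)"

text \<open>\<open>X\<^sub>1 = X \<otimes> I \<otimes> \<dots> \<otimes> I\<close> for a matrix \<open>X\<close> with entries in \<open>S\<close>.\<close>

definition in_first :: "('s, 'm) ring_scheme \<Rightarrow> nat \<Rightarrow> ('n::finite \<Rightarrow> 'n \<Rightarrow> 's)
    \<Rightarrow> ('n list \<times> 'n list \<Rightarrow> 's)" where
  "in_first S p X = (\<lambda>(I, J) \<in> multi_index p \<times> multi_index p.
     if tl I = tl J then X (hd I) (hd J) else \<zero>\<^bsub>S\<^esub>)"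

text \<open>\<open>A\<^sub>k\<close>: the operator \<open>A\<close> in the factors \<open>k\<close> and \<open>k + 1\<close>, counted from 1 (so these are the
  list positions \<open>k - 1\<close> and \<open>k\<close>).\<close>

definition in_factors :: "('s, 'm) ring_scheme \<Rightarrow> ('k::field \<Rightarrow> 's) \<Rightarrow> nat
    \<Rightarrow> 'k ^ ('n::finite \<times> 'n) ^ ('n \<times> 'n) \<Rightarrow> nat \<Rightarrow> ('n list \<times> 'n list \<Rightarrow> 's)" where
  "in_factors S \<iota> p A k = (\<lambda>(I, J) \<in> multi_index p \<times> multi_index p.
     if \<forall>m<p. m \<noteq> k - 1 \<and> m \<noteq> k \<longrightarrow> I ! m = J ! m
     then \<iota> (A $ (I ! (k - 1), I ! k) $ (J ! (k - 1), J ! k)) else \<zero>\<^bsub>S\<^esub>)"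

definition list_prod :: "('a, 'm) monoid_scheme \<Rightarrow> 'a list \<Rightarrow> 'a" where
  "list_prod M xs = foldr (\<lambda>x y. x \<otimes>\<^bsub>M\<^esub> y) xs \<one>\<^bsub>M\<^esub>"

text \<open>\<open>R\<^sub>k\<^sub>-\<^sub>1 \<dots> R\<^sub>1 X\<^sub>1 R\<^sub>1\<^sup>-\<^sup>1 \<dots> R\<^sub>k\<^sub>-\<^sub>1\<^sup>-\<^sup>1\<close>\<close>

definition bar :: "('s, 'm) ring_scheme \<Rightarrow> ('k::field \<Rightarrow> 's) \<Rightarrow> nat
    \<Rightarrow> 'k ^ ('n::finite \<times> 'n) ^ ('n \<times> 'n) \<Rightarrow> ('n \<Rightarrow> 'n \<Rightarrow> 's) \<Rightarrow> nat
    \<Rightarrow> ('n list \<times> 'n list \<Rightarrow> 's)" where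
  "bar S \<iota> p R X k = list_prod (End_tensor S p)
     (map (in_factors S \<iota> p R) (rev [1..<k]) @ [in_first S p X]
      @ map (in_factors S \<iota> p (matrix_inv R)) [1..<k])"

text \<open>\<open>R\<^sub>l\<^sub>-\<^sub>1 \<dots> R\<^sub>k\<^sub>+\<^sub>1 R\<^sub>k R\<^sub>k\<^sub>+\<^sub>1 \<dots> R\<^sub>l\<^sub>-\<^sub>1\<close>, used for \<open>1 \<le> k < l \<le> p\<close>\<close>

definition R_pair :: "('s, 'm) ring_scheme \<Rightarrow> ('k::field \<Rightarrow> 's) \<Rightarrow> nat
    \<Rightarrow> 'k ^ ('n::finite \<times> 'n) ^ ('n \<times> 'n) \<Rightarrow> nat \<Rightarrow> nat \<Rightarrow> ('n list \<times> 'n list \<Rightarrow> 's)" where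
  "R_pair S \<iota> p R k l = list_prod (End_tensor S p)
     (map (in_factors S \<iota> p R) (rev [k..<l] @ [Suc k..<l]))"

text \<open>The product of \<open>R_pair\<close> over the consecutive pairs of \<open>1, k\<^sub>1, \<dots>, k\<^sub>s\<close>.\<close>

definition R_cycle :: "('s, 'm) ring_scheme \<Rightarrow> ('k::field \<Rightarrow> 's) \<Rightarrow> nat
    \<Rightarrow> 'k ^ ('n::finite \<times> 'n) ^ ('n \<times> 'n) \<Rightarrow> nat list \<Rightarrow> ('n list \<times> 'n list \<Rightarrow> 's)" where
  "R_cycle S \<iota> p R ks = list_prod (End_tensor S p)
     (map (\<lambda>(k, l). R_pair S \<iota> p R k l) (zip (1 # ks) ks))"

text \<open>The product of the \<open>bar\<close>s with indices \<open>2, \<dots>, p\<close>, those listed in \<open>ks\<close> being omitted.\<close>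

definition bar_prod :: "('s, 'm) ring_scheme \<Rightarrow> ('k::field \<Rightarrow> 's) \<Rightarrow> nat
    \<Rightarrow> 'k ^ ('n::finite \<times> 'n) ^ ('n \<times> 'n) \<Rightarrow> ('n \<Rightarrow> 'n \<Rightarrow> 's) \<Rightarrow> nat list
    \<Rightarrow> ('n list \<times> 'n list \<Rightarrow> 's)" where
  "bar_prod S \<iota> p R X ks = list_prod (End_tensor S p)
     (map (bar S \<iota> p R X) (filter (\<lambda>k. k \<notin> set ks) [2..<Suc p]))"

definition index_chains :: "nat \<Rightarrow> nat \<Rightarrow> nat list set" where
  "index_chains p s = {ks. length ks = s \<and> sorted_wrt (<) ks \<and> set ks \<subseteq> {2..p}}"

section \<open>The braided Weyl algebra\<close>

text \<open>
  The free algebra on a set of generators consists of the finitely supported functions on words;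
  the convolution product of \<^typ>\<open>'a \<Rightarrow>\<^sub>0 'b\<close> requires the free monoid to be written additively.
\<close>

instantiation list :: (type) monoid_add
begin

definition zero_list :: "'a list" where "zero_list = []"

definition plus_list :: "'a list \<Rightarrow> 'a list \<Rightarrow> 'a list" where "plus_list xs ys = xs @ ys"

instance by standard (simp_all add: zero_list_def plus_list_def)

end

datatype 'n gen = Gen_N 'n 'n | Gen_D 'n 'n

type_synonym ('n, 'k) free = "'n gen list \<Rightarrow>\<^sub>0 'k"

abbreviation free_algebra :: "('n, 'k::field) free ring" where
  "free_algebra \<equiv> type_ring"

definition free_scalar :: "'k::field \<Rightarrow> ('n, 'k) free" where
  "free_scalar c = Poly_Mapping.single [] c"

definition free_gen :: "'n gen \<Rightarrow> ('n, 'k::field) free" where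
  "free_gen g = Poly_Mapping.single [g] 1"

definition weyl_relations ::
    "'k::field ^ ('n::finite \<times> 'n) ^ ('n \<times> 'n) \<Rightarrow> 'k \<Rightarrow> ('n, 'k) free set" where
  "weyl_relations R h =
    (let M = End_tensor free_algebra 2;
         r = in_factors free_algebra free_scalar 2 R 1;
         r' = in_factors free_algebra free_scalar 2 (matrix_inv R) 1;
         N = in_first free_algebra 2 (\<lambda>i j. free_gen (Gen_N i j));
         D = in_first free_algebra 2 (\<lambda>i j. free_gen (Gen_D i j));
         sc = scale_mat free_algebra free_scalar 2 h;
         rel1 = (r \<otimes>\<^bsub>M\<^esub> N \<otimes>\<^bsub>M\<^esub> r \<otimes>\<^bsub>M\<^esub> N \<ominus>\<^bsub>M\<^esub> N \<otimes>\<^bsub>M\<^esub> r \<otimes>\<^bsub>M\<^esub> N \<otimes>\<^bsub>M\<^esub> r)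
                \<ominus>\<^bsub>M\<^esub> sc (r \<otimes>\<^bsub>M\<^esub> N \<ominus>\<^bsub>M\<^esub> N \<otimes>\<^bsub>M\<^esub> r);
         rel2 = r' \<otimes>\<^bsub>M\<^esub> D \<otimes>\<^bsub>M\<^esub> r' \<otimes>\<^bsub>M\<^esub> D \<ominus>\<^bsub>M\<^esub> D \<otimes>\<^bsub>M\<^esub> r' \<otimes>\<^bsub>M\<^esub> D \<otimes>\<^bsub>M\<^esub> r';
         rel3 = (D \<otimes>\<^bsub>M\<^esub> r \<otimes>\<^bsub>M\<^esub> N \<otimes>\<^bsub>M\<^esub> r \<ominus>\<^bsub>M\<^esub> r \<otimes>\<^bsub>M\<^esub> N \<otimes>\<^bsub>M\<^esub> r' \<otimes>\<^bsub>M\<^esub> D)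
                \<ominus>\<^bsub>M\<^esub> (r \<oplus>\<^bsub>M\<^esub> sc (D \<otimes>\<^bsub>M\<^esub> r))
     in \<Union>rel\<in>{rel1, rel2, rel3}. rel ` (multi_index 2 \<times> multi_index 2))"

definition weyl_ideal ::
    "'k::field ^ ('n::finite \<times> 'n) ^ ('n \<times> 'n) \<Rightarrow> 'k \<Rightarrow> ('n, 'k) free set" where
  "weyl_ideal R h = Idl\<^bsub>free_algebra\<^esub> (weyl_relations R h)"

definition weyl_algebra ::
    "'k::field ^ ('n::finite \<times> 'n) ^ ('n \<times> 'n) \<Rightarrow> 'k \<Rightarrow> ('n, 'k) free set ring" where
  "weyl_algebra R h = free_algebra Quot (weyl_ideal R h)"

definition weyl_scalar ::
    "'k::field ^ ('n::finite \<times> 'n) ^ ('n \<times> 'n) \<Rightarrow> 'k \<Rightarrow> 'k \<Rightarrow> ('n, 'k) free set" where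
  "weyl_scalar R h c = weyl_ideal R h +>\<^bsub>free_algebra\<^esub> free_scalar c"

definition weyl_N ::
    "'k::field ^ ('n::finite \<times> 'n) ^ ('n \<times> 'n) \<Rightarrow> 'k \<Rightarrow> 'n \<Rightarrow> 'n \<Rightarrow> ('n, 'k) free set" where
  "weyl_N R h i j = weyl_ideal R h +>\<^bsub>free_algebra\<^esub> free_gen (Gen_N i j)"

definition weyl_D ::
    "'k::field ^ ('n::finite \<times> 'n) ^ ('n \<times> 'n) \<Rightarrow> 'k \<Rightarrow> 'n \<Rightarrow> 'n \<Rightarrow> ('n, 'k) free set" where
  "weyl_D R h i j = weyl_ideal R h +>\<^bsub>free_algebra\<^esub> free_gen (Gen_D i j)"

definition weyl_D_shifted ::
    "'k::field ^ ('n::finite \<times> 'n) ^ ('n \<times> 'n) \<Rightarrow> 'k \<Rightarrow> 'n \<Rightarrow> 'n \<Rightarrow> ('n, 'k) free set" where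
  "weyl_D_shifted R h i j =
     weyl_scalar R h (if i = j then inverse h else 0) \<oplus>\<^bsub>weyl_algebra R h\<^esub> weyl_D R h i j"

section \<open>The action of the derivatives\<close>

text \<open>
  For a skew-invertible involutive symmetry the objects selected by \<open>THE\<close> in \<open>counit\<close> and
  \<open>act\<close> exist and are unique (for \<open>act\<close>: if its first argument is in the subalgebra of \<open>D\<close>
  and its second in that of \<open>N\<close>); this is not built into the definitions.
\<close>

definition subalg_N ::
    "'k::field ^ ('n::finite \<times> 'n) ^ ('n \<times> 'n) \<Rightarrow> 'k \<Rightarrow> ('n, 'k) free set set" where
  "subalg_N R h = generate_ring (weyl_algebra R h)
     (range (weyl_scalar R h) \<union> {weyl_N R h i j | i j. True})"

definition subalg_D ::
    "'k::field ^ ('n::finite \<times> 'n) ^ ('n \<times> 'n) \<Rightarrow> 'k \<Rightarrow> ('n, 'k) free set set" where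
  "subalg_D R h = generate_ring (weyl_algebra R h)
     (range (weyl_scalar R h) \<union> {weyl_D R h i j | i j. True})"

definition counit ::
    "'k::field ^ ('n::finite \<times> 'n) ^ ('n \<times> 'n) \<Rightarrow> 'k \<Rightarrow> ('n, 'k) free set \<Rightarrow> 'k" where
  "counit R h = (THE \<epsilon>. \<epsilon> \<in> extensional (subalg_D R h) \<and>
     \<epsilon> \<in> ring_hom (weyl_algebra R h\<lparr>carrier := subalg_D R h\<rparr>) type_ring \<and>
     (\<forall>c. \<epsilon> (weyl_scalar R h c) = c) \<and> (\<forall>i j. \<epsilon> (weyl_D R h i j) = 0))"

text \<open>
  \<open>m\<close> is obtained from \<open>a n\<close> by writing it as a sum of terms \<open>x\<^sub>t y\<^sub>t\<close> with \<open>x\<^sub>t\<close> in the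
  subalgebra of \<open>N\<close> and \<open>y\<^sub>t\<close> in that of \<open>D\<close>, and applying the counit to the \<open>y\<^sub>t\<close>.
\<close>

definition normal_ordered_value ::
    "'k::field ^ ('n::finite \<times> 'n) ^ ('n \<times> 'n) \<Rightarrow> 'k
     \<Rightarrow> ('n, 'k) free set \<Rightarrow> ('n, 'k) free set \<Rightarrow> ('n, 'k) free set \<Rightarrow> bool" where
  "normal_ordered_value R h a n m \<longleftrightarrow>
    (let W = weyl_algebra R h in
     \<exists>(l::nat) x y. (\<forall>t<l. x t \<in> subalg_N R h \<and> y t \<in> subalg_D R h) \<and>
       a \<otimes>\<^bsub>W\<^esub> n = (\<Oplus>\<^bsub>W\<^esub>t\<in>{..<l}. x t \<otimes>\<^bsub>W\<^esub> y t) \<and>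
       m = (\<Oplus>\<^bsub>W\<^esub>t\<in>{..<l}. x t \<otimes>\<^bsub>W\<^esub> weyl_scalar R h (counit R h (y t))))"

definition act ::
    "'k::field ^ ('n::finite \<times> 'n) ^ ('n \<times> 'n) \<Rightarrow> 'k
     \<Rightarrow> ('n, 'k) free set \<Rightarrow> ('n, 'k) free set \<Rightarrow> ('n, 'k) free set" where
  "act R h a n = (THE m. normal_ordered_value R h a n m)"

text \<open>The entrywise action: matrix multiplication with \<open>act\<close> in place of the product.\<close>

definition mat_act ::
    "'k::field ^ ('n::finite \<times> 'n) ^ ('n \<times> 'n) \<Rightarrow> 'k \<Rightarrow> nat
     \<Rightarrow> ('n list \<times> 'n list \<Rightarrow> ('n, 'k) free set) \<Rightarrow> ('n list \<times> 'n list \<Rightarrow> ('n, 'k) free set)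
     \<Rightarrow> ('n list \<times> 'n list \<Rightarrow> ('n, 'k) free set)" where
  "mat_act R h p A X = (\<lambda>(I, J) \<in> multi_index p \<times> multi_index p.
     \<Oplus>\<^bsub>weyl_algebra R h\<^esub>L\<in>multi_index p. act R h (A (I, L)) (X (L, J)))"

end

theory Submission
  imports Defs
begin

text \<open>
  Since \<open>R\<close> is involutive, the third relation for \<open>D' = \<hbar>\<^sup>-\<^sup>1I + D\<close> reads
  \<open>D'\<^sub>1 N\<^sub>2 = N\<^sub>2 D'\<^sub>1 + \<hbar> D'\<^sub>1 R\<^sub>1\<close> with \<open>N\<^sub>k\<close> conjugated as in \<open>bar\<close>; conjugation gives
  \<open>D'\<^sub>1 N\<^sub>k = N\<^sub>k D'\<^sub>1 + \<hbar> D'\<^sub>1 R\<^sub>(\<^sub>1\<^sub>k\<^sub>)\<close>. The operators \<open>R\<^sub>(\<^sub>k\<^sub>l\<^sub>)\<close> multiply like transpositions and those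
  with \<open>k, l < m\<close> commute with \<open>N\<^sub>m\<close>, so the first identity follows by induction on the number of
  factors; each new factor either is passed or prolongs the chain. Subtracting \<open>\<hbar>\<^sup>-\<^sup>1I\<close> from \<open>D'\<close>
  turns it into a normal ordered expression for \<open>D\<^sub>1 N\<^sub>2 \<dots> N\<^sub>p\<close>.

  That the action is well defined needs a model. By skew-invertibility the relation
  determines how \<open>D'\<close> passes a single \<open>N\<close>, hence defines an action of \<open>N\<close> (by multiplication) and \<open>D'\<close>
  on the free algebra of the \<open>N\<close>s, with \<open>D' 1 = \<hbar>\<^sup>-\<^sup>1I\<close>. The relation among the \<open>D\<close>s acts by zero,
  because its entries kill \<open>1\<close> and pass to the right of each \<open>N\<close>; and the ideal of the relation among
  the \<open>N\<close>s is stable, because that relation, moved to the factors 2 and 3, commutes with \<open>D'\<^sub>1\<close>. So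
  the Weyl algebra acts on the algebra of the \<open>N\<close>s, and its subalgebra generated by the \<open>N\<close>s acts
  faithfully on \<open>1\<close>, while that of the \<open>D\<close>s acts on \<open>1\<close> by the counit.
\<close>

section \<open>Matrices on tensor powers\<close>

text \<open>Normal ordering in an algebra given by generators and relations could be ambiguous; the
  model is there to exclude this. It lives on the free algebra, where D' can be defined by recursion
  on words and the third relation holds exactly. The relation among the Ns is then available only
  modulo \<open>N_ideal\<close>, and passing to the quotient waits until that ideal is known to be
  stable. The obstacle that shapes everything else: the relations are matrix identities and control
  entries of products with copies of R in between, whereas ideals, spans and the action concern
  products of single entries. Skew-invertibility removes the R between two factors. So each identity
  is brought to the form matrix, R's, matrix, and a set \<open>A\<close> closed under sums and
  scalars is fixed: if the entries of the product lie in \<open>A\<close>, so do the products of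
  entries. \<open>A\<close> is a set of operators killing a vector, of operators with values in
  \<open>N_ideal\<close>, or a span. The shift by 1/h absorbs the inhomogeneous term R of the third
  relation, so that moving D' past an N keeps the degree in D' equal to one; this gives the
  existence of normal ordering as well.\<close>

lemma finite_multi_index [simp]: "finite (multi_index p :: 'n::finite list set)"
  using finite_lists_length_eq[of "UNIV :: 'n set" p] by (simp add: multi_index_def)

lemma (in abelian_monoid) finsum_swap:
  assumes "finite A" "finite B" "\<And>a b. a \<in> A \<Longrightarrow> b \<in> B \<Longrightarrow> f a b \<in> carrier G"
  shows "(\<Oplus>a\<in>A. \<Oplus>b\<in>B. f a b) = (\<Oplus>b\<in>B. \<Oplus>a\<in>A. f a b)"
  using assms(1,3)
proof (induction A rule: finite_induct)
  case empty
  then show ?case by simp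
next
  case (insert x A)
  have 1: "(\<Oplus>a\<in>insert x A. \<Oplus>b\<in>B. f a b) = (\<Oplus>b\<in>B. f x b) \<oplus> (\<Oplus>a\<in>A. \<Oplus>b\<in>B. f a b)"
    using insert by (intro finsum_insert) (auto intro!: finsum_closed)
  have 2: "(\<Oplus>b\<in>B. \<Oplus>a\<in>insert x A. f a b) = (\<Oplus>b\<in>B. f x b \<oplus> (\<Oplus>a\<in>A. f a b))"
    using insert by (intro finsum_cong' refl finsum_insert) (auto intro!: finsum_closed)
  have 3: "\<dots> = (\<Oplus>b\<in>B. f x b) \<oplus> (\<Oplus>b\<in>B. \<Oplus>a\<in>A. f a b)"
    using insert by (intro finsum_addf) (auto intro!: finsum_closed)
  have IH: "(\<Oplus>a\<in>A. \<Oplus>b\<in>B. f a b) = (\<Oplus>b\<in>B. \<Oplus>a\<in>A. f a b)"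
    using insert by blast
  show ?case by (simp only: 1 2 3 IH)
qed

lemma (in abelian_monoid) finsum_delta:
  assumes "finite A" "a \<in> A" "f a \<in> carrier G"
  shows "(\<Oplus>i\<in>A. if i = a then f i else \<zero>) = f a"
  using assms add.finprod_singleton_swap[of a A "\<lambda>_. f a"]
  by (subst finsum_cong'[where g = "\<lambda>i. if i = a then f a else \<zero>"]) auto

section \<open>The ring axioms for matrices indexed by words\<close>

locale tensor_ring = ring S for S (structure)
begin

abbreviation M where "M p \<equiv> End_tensor S p"
abbreviation mi where "mi p \<equiv> (multi_index p :: 'n::finite list set)"

lemma End_tensor_simps:
  "carrier (M p) = (mi p \<times> mi p) \<rightarrow>\<^sub>E carrier S"
  "\<zero>\<^bsub>M p\<^esub> = (\<lambda>_ \<in> mi p \<times> mi p. \<zero>)"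
  "A \<oplus>\<^bsub>M p\<^esub> B = (\<lambda>IJ \<in> mi p \<times> mi p. A IJ \<oplus> B IJ)"
  by (simp_all add: End_tensor_def)

lemma entry_closed [intro, simp]:
  "A \<in> carrier (M p) \<Longrightarrow> I \<in> mi p \<Longrightarrow> J \<in> mi p \<Longrightarrow> A (I, J) \<in> carrier S"
  by (auto simp: End_tensor_simps PiE_def Pi_def)

lemma mat_eqI:
  assumes "A \<in> carrier (M p)" "B \<in> carrier (M p)"
    and "\<And>I J. I \<in> mi p \<Longrightarrow> J \<in> mi p \<Longrightarrow> A (I, J) = B (I, J)"
  shows "A = B"
  using assms by (auto simp: End_tensor_simps intro!: PiE_ext[where k = "mi p \<times> mi p"])

lemma mult_entry:
  "I \<in> mi p \<Longrightarrow> J \<in> mi p \<Longrightarrow> (A \<otimes>\<^bsub>M p\<^esub> B) (I, J) = (\<Oplus>L\<in>mi p. A (I, L) \<otimes> B (L, J))"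
  by (simp add: End_tensor_def)

lemma one_entry:
  "I \<in> mi p \<Longrightarrow> J \<in> mi p \<Longrightarrow> \<one>\<^bsub>M p\<^esub> (I, J) = (if I = J then \<one> else \<zero>)"
  by (simp add: End_tensor_def)

lemma add_entry:
  "I \<in> mi p \<Longrightarrow> J \<in> mi p \<Longrightarrow> (A \<oplus>\<^bsub>M p\<^esub> B) (I, J) = A (I, J) \<oplus> B (I, J)"
  by (simp add: End_tensor_def)

lemma zero_entry: "I \<in> mi p \<Longrightarrow> J \<in> mi p \<Longrightarrow> \<zero>\<^bsub>M p\<^esub> (I, J) = \<zero>"
  by (simp add: End_tensor_def)

lemma mat_closed:
  assumes "\<And>I J. I \<in> mi p \<Longrightarrow> J \<in> mi p \<Longrightarrow> f I J \<in> carrier S"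
  shows "(\<lambda>(I, J) \<in> mi p \<times> mi p. f I J) \<in> carrier (M p)"
  using assms by (auto simp: End_tensor_simps)

lemma mult_closed: "A \<in> carrier (M p) \<Longrightarrow> B \<in> carrier (M p) \<Longrightarrow> A \<otimes>\<^bsub>M p\<^esub> B \<in> carrier (M p)"
  unfolding End_tensor_def monoid.simps
  by (rule mat_closed[unfolded End_tensor_def]) (auto simp: End_tensor_def intro!: finsum_closed)

lemma one_closed': "\<one>\<^bsub>M p\<^esub> \<in> carrier (M p)"
  unfolding End_tensor_def monoid.simps
  by (rule mat_closed[unfolded End_tensor_def]) auto

lemma zero_closed': "\<zero>\<^bsub>M p\<^esub> \<in> carrier (M p)"
  unfolding End_tensor_simps by auto

lemma add_closed: "A \<in> carrier (M p) \<Longrightarrow> B \<in> carrier (M p) \<Longrightarrow> A \<oplus>\<^bsub>M p\<^esub> B \<in> carrier (M p)"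
  unfolding End_tensor_simps by (auto simp: PiE_def Pi_def)

lemma ring_End_tensor: "ring (M p :: ('n::finite list \<times> 'n list \<Rightarrow> 'a) ring)"
proof (rule ringI)
  show "abelian_group (M p :: ('n list \<times> 'n list \<Rightarrow> 'a) ring)"
  proof (rule abelian_groupI)
    fix x y z :: "'n list \<times> 'n list \<Rightarrow> 'a" 
      assume c: "x \<in> carrier (M p)" "y \<in> carrier (M p)" "z \<in> carrier (M p)"
    show "x \<oplus>\<^bsub>M p\<^esub> y \<oplus>\<^bsub>M p\<^esub> z = x \<oplus>\<^bsub>M p\<^esub> (y \<oplus>\<^bsub>M p\<^esub> z)"
      by (rule mat_eqI[where p = p]) (use c in \<open>auto simp: add_entry a_assoc intro!: add_closed\<close>)
  next
    fix x y :: "'n list \<times> 'n list \<Rightarrow> 'a" assume c: "x \<in> carrier (M p)" "y \<in> carrier (M p)"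
    show "x \<oplus>\<^bsub>M p\<^esub> y = y \<oplus>\<^bsub>M p\<^esub> x"
      by (rule mat_eqI[where p = p]) (use c in \<open>auto simp: add_entry a_comm intro!: add_closed\<close>)
  next
    fix x :: "'n list \<times> 'n list \<Rightarrow> 'a" assume x: "x \<in> carrier (M p)"
    show "\<zero>\<^bsub>M p\<^esub> \<oplus>\<^bsub>M p\<^esub> x = x"
      by (rule mat_eqI[where p = p]) (use x in \<open>auto simp: add_entry zero_entry intro!: add_closed zero_closed'\<close>)
    have c: "(\<lambda>(I, J) \<in> mi p \<times> mi p. \<ominus> x (I, J)) \<in> carrier (M p)"
      by (rule mat_closed) (use x in auto)
    show "\<exists>y\<in>carrier (M p). y \<oplus>\<^bsub>M p\<^esub> x = \<zero>\<^bsub>M p\<^esub>"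
      by (rule bexI[OF _ c], rule mat_eqI[where p = p])
        (use x c in \<open>auto simp: add_entry zero_entry l_neg intro!: add_closed zero_closed'\<close>)
  qed (auto intro: add_closed zero_closed')
next
  show "monoid (M p :: ('n list \<times> 'n list \<Rightarrow> 'a) ring)"
  proof (rule monoidI)
    fix x y z :: "'n list \<times> 'n list \<Rightarrow> 'a"
    
      assume c: "x \<in> carrier (M p)" "y \<in> carrier (M p)" "z \<in> carrier (M p)"
    show "x \<otimes>\<^bsub>M p\<^esub> y \<otimes>\<^bsub>M p\<^esub> z = x \<otimes>\<^bsub>M p\<^esub> (y \<otimes>\<^bsub>M p\<^esub> z)"
    proof (rule mat_eqI)
      fix I J :: "'n list" assume IJ: "I \<in> multi_index p" "J \<in> multi_index p"
      have "(x \<otimes>\<^bsub>M p\<^esub> y \<otimes>\<^bsub>M p\<^esub> z) (I, J)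
          = (\<Oplus>L\<in>mi p. (\<Oplus>K\<in>mi p. x (I, K) \<otimes> y (K, L)) \<otimes> z (L, J))"
        using IJ c by (auto simp: mult_entry intro!: finsum_cong' finsum_closed)
      also have "\<dots> = (\<Oplus>L\<in>mi p. \<Oplus>K\<in>mi p. x (I, K) \<otimes> y (K, L) \<otimes> z (L, J))"
        using IJ c by (intro finsum_cong' refl finsum_ldistr) (auto intro!: finsum_closed)
      also have "\<dots> = (\<Oplus>K\<in>mi p. \<Oplus>L\<in>mi p. x (I, K) \<otimes> y (K, L) \<otimes> z (L, J))"
        using IJ c by (intro finsum_swap) auto
      also have "\<dots> = (\<Oplus>K\<in>mi p. x (I, K) \<otimes> (\<Oplus>L\<in>mi p. y (K, L) \<otimes> z (L, J)))"
        using IJ c by (intro finsum_cong' refl) (auto simp: finsum_rdistr m_assoc intro!: finsum_closed finsum_cong')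
      also have "\<dots> = (x \<otimes>\<^bsub>M p\<^esub> (y \<otimes>\<^bsub>M p\<^esub> z)) (I, J)"
        using IJ c by (auto simp: mult_entry intro!: finsum_cong' finsum_closed)
      finally show "(x \<otimes>\<^bsub>M p\<^esub> y \<otimes>\<^bsub>M p\<^esub> z) (I, J) = (x \<otimes>\<^bsub>M p\<^esub> (y \<otimes>\<^bsub>M p\<^esub> z)) (I, J)" .
    qed (use c in \<open>auto intro: mult_closed\<close>)
  next
    fix x :: "'n list \<times> 'n list \<Rightarrow> 'a" assume c: "x \<in> carrier (M p)"
    show "\<one>\<^bsub>M p\<^esub> \<otimes>\<^bsub>M p\<^esub> x = x"
    proof (rule mat_eqI)
      fix I J :: "'n list" assume IJ: "I \<in> multi_index p" "J \<in> multi_index p"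
      have "(\<one>\<^bsub>M p\<^esub> \<otimes>\<^bsub>M p\<^esub> x) (I, J) = (\<Oplus>L\<in>mi p. if L = I then x (L, J) else \<zero>)"
        using IJ c by (auto simp: mult_entry one_entry intro!: finsum_cong')
      then show "(\<one>\<^bsub>M p\<^esub> \<otimes>\<^bsub>M p\<^esub> x) (I, J) = x (I, J)"
        using IJ c by (simp add: finsum_delta)
    qed (use c in \<open>auto intro: mult_closed one_closed'\<close>)
    show "x \<otimes>\<^bsub>M p\<^esub> \<one>\<^bsub>M p\<^esub> = x"
    proof (rule mat_eqI)
      fix I J :: "'n list" assume IJ: "I \<in> multi_index p" "J \<in> multi_index p"
      have "(x \<otimes>\<^bsub>M p\<^esub> \<one>\<^bsub>M p\<^esub>) (I, J) = (\<Oplus>L\<in>mi p. if L = J then x (I, L) else \<zero>)"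
        using IJ c by (auto simp: mult_entry one_entry intro!: finsum_cong')
      then show "(x \<otimes>\<^bsub>M p\<^esub> \<one>\<^bsub>M p\<^esub>) (I, J) = x (I, J)"
        using IJ c by (simp add: finsum_delta)
    qed (use c in \<open>auto intro: mult_closed one_closed'\<close>)
  qed (auto intro: mult_closed one_closed')
next
  fix x y z :: "'n list \<times> 'n list \<Rightarrow> 'a"
  
      assume c: "x \<in> carrier (M p)" "y \<in> carrier (M p)" "z \<in> carrier (M p)"
  show "(x \<oplus>\<^bsub>M p\<^esub> y) \<otimes>\<^bsub>M p\<^esub> z = x \<otimes>\<^bsub>M p\<^esub> z \<oplus>\<^bsub>M p\<^esub> y \<otimes>\<^bsub>M p\<^esub> z"
  proof (rule mat_eqI)
    fix I J :: "'n list" assume IJ: "I \<in> multi_index p" "J \<in> multi_index p"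
    have "((x \<oplus>\<^bsub>M p\<^esub> y) \<otimes>\<^bsub>M p\<^esub> z) (I, J) = (\<Oplus>L\<in>multi_index p. x (I, L) \<otimes> z (L, J) \<oplus> y (I, L) \<otimes> z (L, J))"
      unfolding mult_entry[OF IJ] by (rule finsum_cong') (use IJ c in \<open>auto simp: add_entry l_distr\<close>)
    also have "\<dots> = (\<Oplus>L\<in>multi_index p. x (I, L) \<otimes> z (L, J)) \<oplus> (\<Oplus>L\<in>multi_index p. y (I, L) \<otimes> z (L, J))"
      using IJ c by (intro finsum_addf) auto
    also have "\<dots> = (x \<otimes>\<^bsub>M p\<^esub> z \<oplus>\<^bsub>M p\<^esub> y \<otimes>\<^bsub>M p\<^esub> z) (I, J)"
      using IJ by (simp add: add_entry mult_entry)
    finally show "((x \<oplus>\<^bsub>M p\<^esub> y) \<otimes>\<^bsub>M p\<^esub> z) (I, J) = (x \<otimes>\<^bsub>M p\<^esub> z \<oplus>\<^bsub>M p\<^esub> y \<otimes>\<^bsub>M p\<^esub> z) (I, J)" .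
  qed (use c in \<open>auto intro: mult_closed add_closed\<close>)
  show "z \<otimes>\<^bsub>M p\<^esub> (x \<oplus>\<^bsub>M p\<^esub> y) = z \<otimes>\<^bsub>M p\<^esub> x \<oplus>\<^bsub>M p\<^esub> z \<otimes>\<^bsub>M p\<^esub> y"
  proof (rule mat_eqI)
    fix I J :: "'n list" assume IJ: "I \<in> multi_index p" "J \<in> multi_index p"
    have "(z \<otimes>\<^bsub>M p\<^esub> (x \<oplus>\<^bsub>M p\<^esub> y)) (I, J) = (\<Oplus>L\<in>multi_index p. z (I, L) \<otimes> x (L, J) \<oplus> z (I, L) \<otimes> y (L, J))"
      unfolding mult_entry[OF IJ] by (rule finsum_cong') (use IJ c in \<open>auto simp: add_entry r_distr\<close>)
    also have "\<dots> = (\<Oplus>L\<in>multi_index p. z (I, L) \<otimes> x (L, J)) \<oplus> (\<Oplus>L\<in>multi_index p. z (I, L) \<otimes> y (L, J))"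
      using IJ c by (intro finsum_addf) auto
    also have "\<dots> = (z \<otimes>\<^bsub>M p\<^esub> x \<oplus>\<^bsub>M p\<^esub> z \<otimes>\<^bsub>M p\<^esub> y) (I, J)"
      using IJ by (simp add: add_entry mult_entry)
    finally show "(z \<otimes>\<^bsub>M p\<^esub> (x \<oplus>\<^bsub>M p\<^esub> y)) (I, J) = (z \<otimes>\<^bsub>M p\<^esub> x \<oplus>\<^bsub>M p\<^esub> z \<otimes>\<^bsub>M p\<^esub> y) (I, J)" .
  qed (use c in \<open>auto intro: mult_closed add_closed\<close>)
qed

lemma neg_entry:
  assumes "A \<in> carrier (M p)" "I \<in> mi p" "J \<in> mi p"
  shows "(\<ominus>\<^bsub>M p\<^esub> A) (I, J) = \<ominus> A (I, J)"
proof -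
  interpret E: ring "M p" by (rule ring_End_tensor)
  have "(\<ominus>\<^bsub>M p\<^esub> A) (I, J) \<oplus> A (I, J) = \<zero>"
    using E.l_neg[OF assms(1)] assms add_entry zero_entry by metis
  then show ?thesis using assms by (metis E.a_inv_closed entry_closed minus_equality)
qed

lemma minus_entry:
  assumes "A \<in> carrier (M p)" "B \<in> carrier (M p)" "I \<in> mi p" "J \<in> mi p"
  shows "(A \<ominus>\<^bsub>M p\<^esub> B) (I, J) = A (I, J) \<ominus> B (I, J)"
  using assms by (simp add: a_minus_def add_entry neg_entry)

text \<open>Lets closure properties of a subgroup, ideal or subring \<open>A\<close> act on whole
  matrix identities, so that single entries are inspected only at the very end.\<close>

definition entries_in :: "nat \<Rightarrow> 'a set \<Rightarrow> ('n::finite list \<times> 'n list \<Rightarrow> 'a) \<Rightarrow> bool" where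
  "entries_in p A X \<longleftrightarrow> X \<in> carrier (M p) \<and> (\<forall>I\<in>mi p. \<forall>J\<in>mi p. X (I, J) \<in> A)"

text \<open>Three independent sets cover left ideals, right ideals, subrings and multiplication by
  scalar matrices at once.\<close>

lemma entries_in_mult:
  assumes "entries_in p B X" "entries_in p C Y"
    and "\<And>b c. b \<in> B \<Longrightarrow> c \<in> C \<Longrightarrow> b \<otimes> c \<in> A"
    and "additive_subgroup A S"
  shows "entries_in p A (X \<otimes>\<^bsub>M p\<^esub> Y)"
proof -
  interpret A: additive_subgroup A S by fact
  have sum: "finite K \<Longrightarrow> (\<And>L. L \<in> K \<Longrightarrow> f L \<in> A) \<Longrightarrow> (\<Oplus>L\<in>K. f L) \<in> A" for f and K :: "'c list set"
  proof (induction K rule: finite_induct)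
    case (insert x F)
    then show ?case by (subst finsum_insert) (auto intro: A.a_Hcarr A.a_closed)
  qed auto
  show ?thesis
    using assms by (auto simp: entries_in_def mult_closed mult_entry intro!: sum)
qed

end

text \<open>The laws of a lens: \<open>get\<close> reads a part of a word and \<open>put\<close>
  overwrites it. The instances are the first letter, two or three adjacent letters, and an initial
  block, so operators in different sets of tensor factors share one calculus.\<close>

locale site =
  fixes p :: nat and Ix :: "'a set" and get :: "'n::finite list \<Rightarrow> 'a"
    and put :: "'n list \<Rightarrow> 'a \<Rightarrow> 'n list"
  assumes finite_Ix: "finite Ix"
    and get_closed: "I \<in> multi_index p \<Longrightarrow> get I \<in> Ix"
    and put_closed: "I \<in> multi_index p \<Longrightarrow> a \<in> Ix \<Longrightarrow> put I a \<in> multi_index p"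
    and get_put: "I \<in> multi_index p \<Longrightarrow> a \<in> Ix \<Longrightarrow> get (put I a) = a"
    and put_put: "I \<in> multi_index p \<Longrightarrow> a \<in> Ix \<Longrightarrow> b \<in> Ix \<Longrightarrow> put (put I a) b = put I b"
    and put_get: "I \<in> multi_index p \<Longrightarrow> put I (get I) = I"

text \<open>The matrix \<open>T\<close> acting on the part of the index that is read by \<open>get\<close> and written by \<open>put\<close>.\<close>

definition local_mat :: "('s, 'm) ring_scheme \<Rightarrow> nat \<Rightarrow> ('n::finite list \<Rightarrow> 'a)
    \<Rightarrow> ('n list \<Rightarrow> 'a \<Rightarrow> 'n list) \<Rightarrow> ('a \<Rightarrow> 'a \<Rightarrow> 's) \<Rightarrow> ('n list \<times> 'n list \<Rightarrow> 's)" where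
  "local_mat S p get put T = (\<lambda>(I, J) \<in> multi_index p \<times> multi_index p.
     if put I (get J) = J then T (get I) (get J) else \<zero>\<^bsub>S\<^esub>)"

locale tensor_site = tensor_ring S + site p Ix get put
  for S :: "('s, 'm) ring_scheme" (structure) and p and Ix :: "'a set"
    and get :: "'n::finite list \<Rightarrow> 'a" and put
begin

abbreviation "loc T \<equiv> local_mat S p get put T"

lemma local_closed:
  "(\<And>a b. a \<in> Ix \<Longrightarrow> b \<in> Ix \<Longrightarrow> T a b \<in> carrier S) \<Longrightarrow> loc T \<in> carrier (M p)"
  unfolding local_mat_def by (rule mat_closed) (auto simp: get_closed)

text \<open>In row \<open>I\<close> the matrix \<open>loc T\<close> can be nonzero only in columns
  \<open>put I a\<close>, so the sum over all words collapses to a sum over \<open>Ix\<close>. The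
  explicit entry formulas further on are instances of this.\<close>

lemma local_mult_entry:
  assumes "\<And>a b. a \<in> Ix \<Longrightarrow> b \<in> Ix \<Longrightarrow> T a b \<in> carrier S" "B \<in> carrier (M p)"
    and "I \<in> mi p" "J \<in> mi p"
  shows "(loc T \<otimes>\<^bsub>M p\<^esub> B) (I, J) = (\<Oplus>a\<in>Ix. T (get I) a \<otimes> B (put I a, J))"
proof -
  have "(loc T \<otimes>\<^bsub>M p\<^esub> B) (I, J)
      = (\<Oplus>L\<in>mi p. (if put I (get L) = L then T (get I) (get L) else \<zero>) \<otimes> B (L, J))"
    using assms local_closed[of T]
    by (auto simp: mult_entry local_mat_def get_closed intro!: finsum_cong')
  also have "\<dots> = (\<Oplus>L\<in>put I ` Ix. T (get I) (get L) \<otimes> B (L, J))"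
  proof (rule add.finprod_mono_neutral_cong_right)
    show "put I ` Ix \<subseteq> mi p" using assms by (auto simp: put_closed)
    show "\<And>i. i \<in> mi p - put I ` Ix \<Longrightarrow>
         (if put I (get i) = i then T (get I) (get i) else \<zero>) \<otimes> B (i, J) = \<zero>"
      using assms by (auto simp: image_iff) (metis get_closed)
    show "\<And>x. x \<in> put I ` Ix \<Longrightarrow>
         (if put I (get x) = x then T (get I) (get x) else \<zero>) \<otimes> B (x, J) =
         T (get I) (get x) \<otimes> B (x, J)"
      using assms by (auto simp: get_put put_put)
  qed (use assms in \<open>auto simp: get_closed\<close>)
  also have "\<dots> = (\<Oplus>a\<in>Ix. T (get I) (get (put I a)) \<otimes> B (put I a, J))"
    using assms
    by (intro finsum_reindex) (auto simp: get_closed get_put put_closed inj_on_def dest: arg_cong[where f = get])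
  also have "\<dots> = (\<Oplus>a\<in>Ix. T (get I) a \<otimes> B (put I a, J))"
    using assms by (intro finsum_cong') (auto simp: get_put get_closed put_closed)
  finally show ?thesis .
qed

lemma local_mult:
  assumes "\<And>a b. a \<in> Ix \<Longrightarrow> b \<in> Ix \<Longrightarrow> T a b \<in> carrier S"
    and "\<And>a b. a \<in> Ix \<Longrightarrow> b \<in> Ix \<Longrightarrow> U a b \<in> carrier S"
  shows "loc T \<otimes>\<^bsub>M p\<^esub> loc U = loc (\<lambda>a b. \<Oplus>c\<in>Ix. T a c \<otimes> U c b)"
proof (rule mat_eqI)
  fix I J :: "'n list" assume IJ: "I \<in> mi p" "J \<in> mi p"
  have "(loc T \<otimes>\<^bsub>M p\<^esub> loc U) (I, J) = (\<Oplus>a\<in>Ix. T (get I) a \<otimes> loc U (put I a, J))"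
    using IJ assms by (intro local_mult_entry local_closed)
  also have "\<dots> = (\<Oplus>a\<in>Ix. if put I (get J) = J then T (get I) a \<otimes> U a (get J) else \<zero>)"
    using IJ assms
    by (intro finsum_cong') (auto simp: local_mat_def put_closed get_put put_put get_closed)
  also have "\<dots> = loc (\<lambda>a b. \<Oplus>c\<in>Ix. T a c \<otimes> U c b) (I, J)"
    using IJ by (simp add: local_mat_def)
  finally show "(loc T \<otimes>\<^bsub>M p\<^esub> loc U) (I, J) = loc (\<lambda>a b. \<Oplus>c\<in>Ix. T a c \<otimes> U c b) (I, J)" .
qed (use assms in \<open>auto intro!: mult_closed local_closed finsum_closed\<close>)

lemma local_add:
  assumes "\<And>a b. a \<in> Ix \<Longrightarrow> b \<in> Ix \<Longrightarrow> T a b \<in> carrier S"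
    and "\<And>a b. a \<in> Ix \<Longrightarrow> b \<in> Ix \<Longrightarrow> U a b \<in> carrier S"
  shows "loc T \<oplus>\<^bsub>M p\<^esub> loc U = loc (\<lambda>a b. T a b \<oplus> U a b)"
  using assms by (auto simp: End_tensor_simps local_mat_def fun_eq_iff get_closed)

lemma local_one: "loc (\<lambda>a b. if a = b then \<one> else \<zero>) = \<one>\<^bsub>M p\<^esub>"
proof (rule mat_eqI)
  fix I J :: "'n list" assume IJ: "I \<in> mi p" "J \<in> mi p"
  show "loc (\<lambda>a b. if a = b then \<one> else \<zero>) (I, J) = \<one>\<^bsub>M p\<^esub> (I, J)"
    using IJ put_get[of I] put_get[of J]
    by (cases "get I = get J") (auto simp: local_mat_def one_entry)
qed (auto intro!: local_closed one_closed')

lemma local_cong: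
  "(\<And>a b. a \<in> Ix \<Longrightarrow> b \<in> Ix \<Longrightarrow> T a b = U a b) \<Longrightarrow> loc T = loc U"
  unfolding local_mat_def by (rule restrict_ext) (auto simp: get_closed)

end

text \<open>Operators in disjoint tensor factors. The entries come from a noncommutative ring, so
  the coefficients have to commute as well; in the applications one of the two matrices has scalar
  entries.\<close>

lemma (in tensor_ring) local_commute:
  fixes get1 :: "'n::finite list \<Rightarrow> 'x" and get2 :: "'n list \<Rightarrow> 'y"
  assumes "site p Ix1 get1 put1" "site p Ix2 get2 put2"
    and T: "\<And>a b. a \<in> Ix1 \<Longrightarrow> b \<in> Ix1 \<Longrightarrow> T a b \<in> carrier S"
    and U: "\<And>a b. a \<in> Ix2 \<Longrightarrow> b \<in> Ix2 \<Longrightarrow> U a b \<in> carrier S"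
    and TU: "\<And>a b c d. a \<in> Ix1 \<Longrightarrow> b \<in> Ix1 \<Longrightarrow> c \<in> Ix2 \<Longrightarrow> d \<in> Ix2 \<Longrightarrow>
      T a b \<otimes> U c d = U c d \<otimes> T a b"
    and g1: "\<And>I a. I \<in> mi p \<Longrightarrow> a \<in> Ix2 \<Longrightarrow> get1 (put2 I a) = get1 I"
    and g2: "\<And>I a. I \<in> mi p \<Longrightarrow> a \<in> Ix1 \<Longrightarrow> get2 (put1 I a) = get2 I"
    and pp: "\<And>I a b. I \<in> mi p \<Longrightarrow> a \<in> Ix1 \<Longrightarrow> b \<in> Ix2 \<Longrightarrow> put2 (put1 I a) b = put1 (put2 I b) a"
  shows "local_mat S p get1 put1 T \<otimes>\<^bsub>M p\<^esub> local_mat S p get2 put2 U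
       = local_mat S p get2 put2 U \<otimes>\<^bsub>M p\<^esub> local_mat S p get1 put1 T"
proof -
  interpret s1: tensor_site S p Ix1 get1 put1
    by (intro tensor_site.intro assms) unfold_locales
  interpret s2: tensor_site S p Ix2 get2 put2
    by (intro tensor_site.intro assms) unfold_locales
  show ?thesis
  proof (rule mat_eqI)
    fix I J :: "'n list" assume IJ: "I \<in> mi p" "J \<in> mi p"
    have "(s1.loc T \<otimes>\<^bsub>M p\<^esub> s2.loc U) (I, J) = (\<Oplus>a\<in>Ix1. T (get1 I) a \<otimes> s2.loc U (put1 I a, J))"
      using IJ T U by (intro s1.local_mult_entry s2.local_closed)
    also have "\<dots> = (\<Oplus>a\<in>Ix1. if a = get1 J then
        (if put2 (put1 I a) (get2 J) = J then T (get1 I) a \<otimes> U (get2 I) (get2 J) else \<zero>) else \<zero>)"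
    proof (rule finsum_cong')
      fix a assume a: "a \<in> Ix1"
      \<comment> \<open>The second \<open>put\<close> does not change what \<open>get1\<close>
        reads, so the intermediate word between \<open>I\<close> and \<open>J\<close> is determined
        and the sum has at most one nonzero term.\<close>
      have "a = get1 J" if "put2 (put1 I a) (get2 J) = J"
        using g1[of "put1 I a" "get2 J"] IJ a that by (simp add: s1.put_closed s2.get_closed s1.get_put)
      then show "T (get1 I) a \<otimes> s2.loc U (put1 I a, J) = (if a = get1 J then
        (if put2 (put1 I a) (get2 J) = J then T (get1 I) a \<otimes> U (get2 I) (get2 J) else \<zero>) else \<zero>)"
        using IJ a T[OF s1.get_closed[OF IJ(1)] a]
        by (cases "put2 (put1 I a) (get2 J) = J")
          (simp_all add: local_mat_def g2 s1.put_closed, auto)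
    qed (use IJ T U in \<open>auto simp: s1.get_closed s2.get_closed\<close>)
    also have "\<dots> = (if put2 (put1 I (get1 J)) (get2 J) = J then T (get1 I) (get1 J) \<otimes> U (get2 I) (get2 J) else \<zero>)"
      using IJ T U by (subst finsum_delta) (auto simp: s1.get_closed s2.get_closed s1.finite_Ix)
    finally have 1: "(s1.loc T \<otimes>\<^bsub>M p\<^esub> s2.loc U) (I, J) = \<dots>" .
    have "(s2.loc U \<otimes>\<^bsub>M p\<^esub> s1.loc T) (I, J) = (\<Oplus>a\<in>Ix2. U (get2 I) a \<otimes> s1.loc T (put2 I a, J))"
      using IJ T U by (intro s2.local_mult_entry s1.local_closed)
    also have "\<dots> = (\<Oplus>a\<in>Ix2. if a = get2 J then
        (if put1 (put2 I a) (get1 J) = J then U (get2 I) a \<otimes> T (get1 I) (get1 J) else \<zero>) else \<zero>)"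
    proof (rule finsum_cong')
      fix a assume a: "a \<in> Ix2"
      have "a = get2 J" if "put1 (put2 I a) (get1 J) = J"
        using g2[of "put2 I a" "get1 J"] IJ a that by (simp add: s2.put_closed s1.get_closed s2.get_put)
      then show "U (get2 I) a \<otimes> s1.loc T (put2 I a, J) = (if a = get2 J then
        (if put1 (put2 I a) (get1 J) = J then U (get2 I) a \<otimes> T (get1 I) (get1 J) else \<zero>) else \<zero>)"
        using IJ a U[OF s2.get_closed[OF IJ(1)] a]
        by (cases "put1 (put2 I a) (get1 J) = J")
          (simp_all add: local_mat_def g1 s2.put_closed, auto)
    qed (use IJ T U in \<open>auto simp: s1.get_closed s2.get_closed\<close>)
    also have "\<dots> = (if put1 (put2 I (get2 J)) (get1 J) = J then U (get2 I) (get2 J) \<otimes> T (get1 I) (get1 J) else \<zero>)"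
      using IJ T U by (subst finsum_delta) (auto simp: s1.get_closed s2.get_closed s2.finite_Ix)
    finally have 2: "(s2.loc U \<otimes>\<^bsub>M p\<^esub> s1.loc T) (I, J) = \<dots>" .
    show "(s1.loc T \<otimes>\<^bsub>M p\<^esub> s2.loc U) (I, J) = (s2.loc U \<otimes>\<^bsub>M p\<^esub> s1.loc T) (I, J)"
      unfolding 1 2 using IJ by (simp add: TU pp s1.get_closed s2.get_closed)
  qed (use T U in \<open>auto intro!: mult_closed s1.local_closed s2.local_closed\<close>)
qed

definition map_mat :: "nat \<Rightarrow> ('s \<Rightarrow> 't) \<Rightarrow> ('n::finite list \<times> 'n list \<Rightarrow> 's) \<Rightarrow> ('n list \<times> 'n list \<Rightarrow> 't)" where
  "map_mat p f A = (\<lambda>IJ \<in> multi_index p \<times> multi_index p. f (A IJ))"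

text \<open>Used to carry the defining relations from the free algebra to its two images: the
  operators of the model and the quotient.\<close>

lemma (in ring_hom_ring) map_mat_hom: "map_mat p h \<in> ring_hom (End_tensor R p) (End_tensor S p)"
proof -
  interpret TR: tensor_ring R by unfold_locales
  interpret TS: tensor_ring S by unfold_locales
  have fs: "h (\<Oplus>\<^bsub>R\<^esub>a\<in>A. f a) = (\<Oplus>\<^bsub>S\<^esub>a\<in>A. h (f a))" if "f \<in> A \<rightarrow> carrier R" for f and A :: "'e list set"
    using that by (simp add: hom_finsum comp_def)
  have c: "map_mat p h x \<in> carrier (End_tensor S p)" if "x \<in> carrier (End_tensor R p)" for x
    using that by (auto simp: map_mat_def End_tensor_def)
  show ?thesis
  proof (rule ring_hom_memI)
    fix x y :: "'e list \<times> 'e list \<Rightarrow> 'a"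
    assume x: "x \<in> carrier (End_tensor R p)" and y: "y \<in> carrier (End_tensor R p)"
    show "map_mat p h (x \<otimes>\<^bsub>End_tensor R p\<^esub> y) = map_mat p h x \<otimes>\<^bsub>End_tensor S p\<^esub> map_mat p h y"
    proof (rule TS.mat_eqI)
      fix I J :: "'e list" assume IJ: "I \<in> multi_index p" "J \<in> multi_index p"
      show "map_mat p h (x \<otimes>\<^bsub>End_tensor R p\<^esub> y) (I, J)
          = (map_mat p h x \<otimes>\<^bsub>End_tensor S p\<^esub> map_mat p h y) (I, J)"
        using IJ x y TR.entry_closed
        by (auto simp: map_mat_def TR.mult_entry TS.mult_entry fs Pi_def intro!: S.finsum_cong')
    qed (use x y in \<open>auto intro!: c TS.mult_closed TR.mult_closed\<close>)
    show "map_mat p h (x \<oplus>\<^bsub>End_tensor R p\<^esub> y) = map_mat p h x \<oplus>\<^bsub>End_tensor S p\<^esub> map_mat p h y"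
      using x y TR.entry_closed by (auto simp: map_mat_def End_tensor_def fun_eq_iff)
  next
    show "map_mat p h \<one>\<^bsub>End_tensor R p\<^esub> = (\<one>\<^bsub>End_tensor S p\<^esub> :: 'e list \<times> 'e list \<Rightarrow> _)"
      by (auto simp: map_mat_def End_tensor_def fun_eq_iff)
  qed (use c in auto)
qed

lemma map_mat_hom:
  assumes "ring S" "ring S'" "f \<in> ring_hom S S'"
  shows "map_mat p f \<in> ring_hom (End_tensor S p) (End_tensor S' p)"
  by (rule ring_hom_ring.map_mat_hom[OF ring_hom_ringI2[OF assms]])

section \<open>Commuting a derivative past the product of the \<open>N\<close>s\<close>

lemma (in monoid) list_prod_Nil [simp]: "list_prod G [] = \<one>"
  by (simp add: list_prod_def)

lemma (in monoid) list_prod_Cons [simp]: "list_prod G (x # xs) = x \<otimes> list_prod G xs"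
  by (simp add: list_prod_def)

lemma (in monoid) list_prod_closed:
  "set xs \<subseteq> carrier G \<Longrightarrow> list_prod G xs \<in> carrier G"
  by (induction xs) auto

lemma (in monoid) list_prod_append:
  "set xs \<subseteq> carrier G \<Longrightarrow> set ys \<subseteq> carrier G \<Longrightarrow>
    list_prod G (xs @ ys) = list_prod G xs \<otimes> list_prod G ys"
  by (induction xs) (auto simp: list_prod_closed m_assoc)

lemma (in monoid) list_prod_snoc:
  "set xs \<subseteq> carrier G \<Longrightarrow> y \<in> carrier G \<Longrightarrow> list_prod G (xs @ [y]) = list_prod G xs \<otimes> y"
  by (simp add: list_prod_append)

lemma (in monoid) commute_mult:
  assumes "x \<otimes> a = a \<otimes> x" "x \<otimes> b = b \<otimes> x"
    and "x \<in> carrier G" "a \<in> carrier G" "b \<in> carrier G"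
  shows "x \<otimes> (a \<otimes> b) = (a \<otimes> b) \<otimes> x"
  using assms by (metis m_assoc)

lemma (in monoid) rewrite_assoc:
  "x \<otimes> y = z \<Longrightarrow> x \<in> carrier G \<Longrightarrow> y \<in> carrier G \<Longrightarrow> t \<in> carrier G \<Longrightarrow> x \<otimes> (y \<otimes> t) = z \<otimes> t"
  by (simp flip: m_assoc)

text \<open>
  The abstract form of the commutation of \<open>D'\<^sub>1\<close> with the \<open>N\<close>s: \<open>r k\<close> plays the role of \<open>R\<^sub>k\<close>,
  \<open>n\<close> and \<open>d\<close> those of \<open>N\<^sub>1\<close> and \<open>D'\<^sub>1\<close>, and \<open>c\<close> that of the scalar \<open>\<hbar>\<close>.
\<close>

locale braided_ring = ring M for M (structure) +
  fixes p :: nat and r :: "nat \<Rightarrow> 'a" and n d c :: 'a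
  assumes r_closed: "1 \<le> k \<Longrightarrow> k < p \<Longrightarrow> r k \<in> carrier M"
    and n_closed [simp]: "n \<in> carrier M" and d_closed [simp]: "d \<in> carrier M"
    and c_closed [simp]: "c \<in> carrier M"
    and r_invol: "1 \<le> k \<Longrightarrow> k < p \<Longrightarrow> r k \<otimes> r k = \<one>"
    and r_braid: "1 \<le> k \<Longrightarrow> Suc k < p \<Longrightarrow> r k \<otimes> (r (Suc k) \<otimes> r k) = r (Suc k) \<otimes> (r k \<otimes> r (Suc k))"
    and r_far: "1 \<le> k \<Longrightarrow> Suc k < l \<Longrightarrow> l < p \<Longrightarrow> r k \<otimes> r l = r l \<otimes> r k"
    and rn: "2 \<le> k \<Longrightarrow> k < p \<Longrightarrow> r k \<otimes> n = n \<otimes> r k"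
    and rd: "2 \<le> k \<Longrightarrow> k < p \<Longrightarrow> r k \<otimes> d = d \<otimes> r k"
    and c_central: "x \<in> carrier M \<Longrightarrow> c \<otimes> x = x \<otimes> c"
    and dn: "2 \<le> p \<Longrightarrow> d \<otimes> (r 1 \<otimes> n \<otimes> r 1) = (r 1 \<otimes> n \<otimes> r 1) \<otimes> d \<oplus> c \<otimes> (d \<otimes> r 1)"
begin

text \<open>\<open>nb k\<close> is the conjugated matrix N with index k, and \<open>rp a b\<close>
  is R with the index pair a, b. Since each \<open>r k\<close> is its own inverse, both arise by one
  more conjugation from the preceding one. The values \<open>nb 0\<close> and \<open>rp a b\<close>
  with \<open>b \<le> a\<close> are arbitrary defaults.\<close>

fun nb :: "nat \<Rightarrow> 'a" where
  "nb 0 = n"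
| "nb (Suc 0) = n"
| "nb (Suc (Suc k)) = r (Suc k) \<otimes> nb (Suc k) \<otimes> r (Suc k)"

fun rp :: "nat \<Rightarrow> nat \<Rightarrow> 'a" where
  "rp a 0 = \<one>"
| "rp a (Suc b) = (if b = a then r a else r b \<otimes> rp a b \<otimes> r b)"

declare nb.simps [simp del] rp.simps [simp del]

lemma nb_1: "nb 1 = n"
  using nb.simps(2) by simp

lemma nb_Suc: "1 \<le> k \<Longrightarrow> nb (Suc k) = r k \<otimes> nb k \<otimes> r k"
  by (cases k) (simp_all add: nb.simps)

lemma rp_base: "rp a (Suc a) = r a"
  by (simp add: rp.simps)

lemma rp_Suc: "a < b \<Longrightarrow> rp a (Suc b) = r b \<otimes> rp a b \<otimes> r b"
  by (simp add: rp.simps)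

lemma nb_closed [intro]: "1 \<le> k \<Longrightarrow> k \<le> p \<Longrightarrow> nb k \<in> carrier M"
proof (induction k rule: dec_induct)
  case base then show ?case by (simp add: nb_1 del: One_nat_def)
next
  case (step k) then show ?case by (auto simp: nb_Suc intro!: m_closed r_closed)
qed

lemma rp_closed [intro]: "1 \<le> a \<Longrightarrow> a < b \<Longrightarrow> b \<le> p \<Longrightarrow> rp a b \<in> carrier M"
proof -
  have "Suc a \<le> b \<Longrightarrow> 1 \<le> a \<Longrightarrow> b \<le> p \<Longrightarrow> rp a b \<in> carrier M"
  proof (induction b rule: dec_induct)
    case base then show ?case by (auto simp: rp_base intro!: r_closed)
  next
    case (step b) then show ?case by (auto simp: rp_Suc intro!: m_closed r_closed)
  qed
  then show "1 \<le> a \<Longrightarrow> a < b \<Longrightarrow> b \<le> p \<Longrightarrow> rp a b \<in> carrier M" by simp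
qed

lemma r_far': "1 \<le> k \<Longrightarrow> 1 \<le> l \<Longrightarrow> k < p \<Longrightarrow> l < p \<Longrightarrow> Suc k < l \<or> Suc l < k \<Longrightarrow> r k \<otimes> r l = r l \<otimes> r k"
  using r_far[of k l] r_far[of l k] by auto

lemma commute_conj:
  assumes "x \<otimes> a = a \<otimes> x" "x \<otimes> b = b \<otimes> x"
    and "x \<in> carrier M" "a \<in> carrier M" "b \<in> carrier M"
  shows "x \<otimes> (a \<otimes> b \<otimes> a) = (a \<otimes> b \<otimes> a) \<otimes> x"
  using assms by (intro commute_mult) auto

lemma r_nb_above: "1 \<le> j \<Longrightarrow> j < i \<Longrightarrow> i < p \<Longrightarrow> r i \<otimes> nb j = nb j \<otimes> r i"
proof (induction j rule: dec_induct)
  case base then show ?case by (simp add: nb_1 rn del: One_nat_def)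
next
  case (step j)
  then show ?case
    by (simp add: nb_Suc) (intro commute_conj r_far' r_closed nb_closed; simp)
qed

text \<open>By the braid relation \<open>r i\<close>, on entering the conjugating factors of
  \<open>nb (i + 2)\<close>, turns into \<open>r (i + 1)\<close>; this commutes with
  \<open>nb i\<close> in the middle and turns back into \<open>r i\<close> on leaving. For larger
  \<open>j\<close> the outer factors are far from \<open>i\<close>.\<close>

lemma r_nb_below: "1 \<le> i \<Longrightarrow> Suc i < j \<Longrightarrow> j \<le> p \<Longrightarrow> r i \<otimes> nb j = nb j \<otimes> r i"
proof -
  have "Suc (Suc i) \<le> j \<Longrightarrow> 1 \<le> i \<Longrightarrow> j \<le> p \<Longrightarrow> r i \<otimes> nb j = nb j \<otimes> r i"
  proof (induction j rule: dec_induct)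
    case base
    define x y z where "x = r i" and "y = r (Suc i)" and "z = nb i"
    have c [simp]: "x \<in> carrier M" "y \<in> carrier M" "z \<in> carrier M"
      using base by (auto simp: x_def y_def z_def intro: r_closed nb_closed)
    have b: "x \<otimes> (y \<otimes> x) = y \<otimes> (x \<otimes> y)"
      using base r_braid by (simp add: x_def y_def)
    have yz: "y \<otimes> z = z \<otimes> y"
      using base by (auto simp: y_def z_def intro: r_nb_above)
    have nbe: "nb (Suc (Suc i)) = y \<otimes> (x \<otimes> z \<otimes> x) \<otimes> y"
      using base by (simp add: nb_Suc x_def y_def z_def)
    have "x \<otimes> nb (Suc (Suc i)) = (x \<otimes> (y \<otimes> x)) \<otimes> (z \<otimes> (x \<otimes> y))"
      by (simp add: nbe m_assoc)
    also have "\<dots> = y \<otimes> (x \<otimes> ((y \<otimes> z) \<otimes> (x \<otimes> y)))"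
      by (simp add: b) (simp add: m_assoc)
    also have "\<dots> = y \<otimes> (x \<otimes> (z \<otimes> (y \<otimes> (x \<otimes> y))))"
      by (simp add: yz) (simp add: m_assoc)
    also have "\<dots> = nb (Suc (Suc i)) \<otimes> x"
      by (simp add: b[symmetric] nbe) (simp add: m_assoc)
    finally show ?case by (simp add: x_def)
  next
    case (step j)
    then show ?case
      by (simp add: nb_Suc) (intro commute_conj r_far' r_closed nb_closed; simp)
  qed
  then show "1 \<le> i \<Longrightarrow> Suc i < j \<Longrightarrow> j \<le> p \<Longrightarrow> r i \<otimes> nb j = nb j \<otimes> r i" by simp
qed

lemma commute_rp:
  assumes "\<And>i. a \<le> i \<Longrightarrow> i < b \<Longrightarrow> x \<otimes> r i = r i \<otimes> x" "x \<in> carrier M"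
    and "1 \<le> a" "a < b" "b \<le> p"
  shows "x \<otimes> rp a b = rp a b \<otimes> x"
proof -
  have "Suc a \<le> b \<Longrightarrow> b \<le> p \<Longrightarrow> (\<And>i. a \<le> i \<Longrightarrow> i < b \<Longrightarrow> x \<otimes> r i = r i \<otimes> x) \<Longrightarrow> x \<otimes> rp a b = rp a b \<otimes> x"
  proof (induction b rule: dec_induct)
    case base then show ?case by (simp add: rp_base)
  next
    case (step b)
    then show ?case using assms
      by (simp add: rp_Suc) (intro commute_conj r_closed rp_closed; simp)
  qed
  then show ?thesis using assms by simp
qed

lemma rp_nb: "1 \<le> a \<Longrightarrow> a < b \<Longrightarrow> b < j \<Longrightarrow> j \<le> p \<Longrightarrow> nb j \<otimes> rp a b = rp a b \<otimes> nb j"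
  by (rule commute_rp) (auto intro: r_nb_below[symmetric])

lemma r_rp: "1 \<le> a \<Longrightarrow> a < b \<Longrightarrow> b < i \<Longrightarrow> i < p \<Longrightarrow> r i \<otimes> rp a b = rp a b \<otimes> r i"
  by (rule commute_rp) (auto intro: r_far' r_closed)

lemma rp_invol: "1 \<le> a \<Longrightarrow> a < b \<Longrightarrow> b \<le> p \<Longrightarrow> rp a b \<otimes> rp a b = \<one>"
proof -
  have "Suc a \<le> b \<Longrightarrow> 1 \<le> a \<Longrightarrow> b \<le> p \<Longrightarrow> rp a b \<otimes> rp a b = \<one>"
  proof (induction b rule: dec_induct)
    case base then show ?case by (simp add: rp_base r_invol)
  next
    case (step b)
    define x y where "x = r b" and "y = rp a b"
    have c [simp]: "x \<in> carrier M" "y \<in> carrier M" and [simp]: "x \<otimes> x = \<one>" "y \<otimes> y = \<one>"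
      using step by (auto simp: x_def y_def r_invol intro: r_closed rp_closed)
    have "(x \<otimes> y \<otimes> x) \<otimes> (x \<otimes> y \<otimes> x) = \<one>"
      by (simp add: m_assoc rewrite_assoc[of x x] rewrite_assoc[of y y])
    then show ?case using step by (simp add: rp_Suc x_def y_def)
  qed
  then show "1 \<le> a \<Longrightarrow> a < b \<Longrightarrow> b \<le> p \<Longrightarrow> rp a b \<otimes> rp a b = \<one>" by simp
qed

text \<open>If \<open>r k\<close> is thought of as the adjacent transposition (k k+1), then
  \<open>rp a b\<close> is (a b), and this is the braid relation between (a b) and (b b+1). In the
  induction step both sides reduce to the common word \<open>y x z x y\<close>.\<close>

lemma rp_braid:
  "1 \<le> a \<Longrightarrow> a < b \<Longrightarrow> b < p \<Longrightarrow> r b \<otimes> (rp a b \<otimes> r b) = rp a b \<otimes> (r b \<otimes> rp a b)"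
proof -
  have "Suc a \<le> b \<Longrightarrow> 1 \<le> a \<Longrightarrow> b < p \<Longrightarrow> r b \<otimes> (rp a b \<otimes> r b) = rp a b \<otimes> (r b \<otimes> rp a b)"
  proof (induction b rule: dec_induct)
    case base then show ?case by (simp add: rp_base r_braid)
  next
    case (step b)
    define x y z where "x = r b" and "y = rp a b" and "z = r (Suc b)"
    have c [simp]: "x \<in> carrier M" "y \<in> carrier M" "z \<in> carrier M"
        and s [simp]: "x \<otimes> x = \<one>" "y \<otimes> y = \<one>"
      using step by (auto simp: x_def y_def z_def r_invol rp_invol intro: r_closed rp_closed)
    have b: "x \<otimes> (z \<otimes> x) = z \<otimes> (x \<otimes> z)"
      using step r_braid by (simp add: x_def z_def)
    have yz: "z \<otimes> y = y \<otimes> z"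
      using step r_rp by (simp add: y_def z_def)
    have xy: "x \<otimes> (y \<otimes> x) = y \<otimes> (x \<otimes> y)"
      using step by (simp add: x_def y_def)
    have "z \<otimes> ((x \<otimes> (y \<otimes> x)) \<otimes> z) = (z \<otimes> y) \<otimes> (x \<otimes> (y \<otimes> z))"
      by (simp add: xy) (simp add: m_assoc)
    also have "\<dots> = (y \<otimes> z) \<otimes> (x \<otimes> (z \<otimes> y))"
      by (simp only: yz)
    also have "\<dots> = y \<otimes> ((z \<otimes> (x \<otimes> z)) \<otimes> y)"
      by (simp add: m_assoc)
    also have "\<dots> = y \<otimes> (x \<otimes> (z \<otimes> (x \<otimes> y)))"
      by (simp add: b[symmetric]) (simp add: m_assoc)
    finally have 1: "z \<otimes> ((x \<otimes> (y \<otimes> x)) \<otimes> z) = y \<otimes> (x \<otimes> (z \<otimes> (x \<otimes> y)))" .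
    have "(x \<otimes> (y \<otimes> x)) \<otimes> (z \<otimes> (x \<otimes> (y \<otimes> x))) = (y \<otimes> (x \<otimes> y)) \<otimes> (z \<otimes> (y \<otimes> (x \<otimes> y)))"
      by (simp only: xy)
    also have "\<dots> = y \<otimes> (x \<otimes> (y \<otimes> ((z \<otimes> y) \<otimes> (x \<otimes> y))))"
      by (simp add: m_assoc)
    also have "\<dots> = y \<otimes> (x \<otimes> (z \<otimes> (x \<otimes> y)))"
      by (simp add: yz) (simp add: m_assoc rewrite_assoc[of y y])
    finally have 2: "(x \<otimes> (y \<otimes> x)) \<otimes> (z \<otimes> (x \<otimes> (y \<otimes> x))) = y \<otimes> (x \<otimes> (z \<otimes> (x \<otimes> y)))" .
    show ?case using step 1 2 by (simp add: rp_Suc x_def y_def z_def m_assoc r_closed rp_closed)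
  qed
  then show "1 \<le> a \<Longrightarrow> a < b \<Longrightarrow> b < p \<Longrightarrow> r b \<otimes> (rp a b \<otimes> r b) = rp a b \<otimes> (r b \<otimes> rp a b)" by simp
qed

text \<open>The identity (a e)(a b) = (a b)(b e) of transpositions. The base case is
  \<open>rp_braid\<close> with one factor cancelled; beyond it, conjugation by \<open>r e\<close>
  does not affect \<open>rp a b\<close> because \<open>b < e\<close>.\<close>

lemma rp_rp:
  assumes "1 \<le> a" "a < b" "b < e" "e \<le> p"
  shows "rp a e \<otimes> rp a b = rp a b \<otimes> rp b e"
proof -
  have "Suc b \<le> e \<Longrightarrow> e \<le> p \<Longrightarrow> rp a e \<otimes> rp a b = rp a b \<otimes> rp b e"
  proof (induction e rule: dec_induct)
    case base
    define x y where "x = r b" and "y = rp a b"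
    have c [simp]: "x \<in> carrier M" "y \<in> carrier M" and s [simp]: "y \<otimes> y = \<one>"
      using base assms by (auto simp: x_def y_def rp_invol intro: r_closed rp_closed)
    have "(x \<otimes> (y \<otimes> x)) \<otimes> y = (y \<otimes> (x \<otimes> y)) \<otimes> y"
      using rp_braid[of a b] base assms by (simp add: x_def y_def)
    also have "\<dots> = y \<otimes> x" by (simp add: m_assoc)
    finally show ?case using assms by (simp add: rp_Suc rp_base x_def y_def m_assoc r_closed rp_closed base)
  next
    case (step e)
    define x y z w where "x = r e" and "y = rp a e" and "z = rp a b" and "w = rp b e"
    have c [simp]: "x \<in> carrier M" "y \<in> carrier M" "z \<in> carrier M" "w \<in> carrier M"
      using step assms by (auto simp: x_def y_def z_def w_def intro: r_closed rp_closed)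
    have xz: "x \<otimes> z = z \<otimes> x" using step assms r_rp by (simp add: x_def z_def)
    have "(x \<otimes> y \<otimes> x) \<otimes> z = x \<otimes> ((y \<otimes> z) \<otimes> x)"
      by (simp add: m_assoc xz)
    also have "\<dots> = (x \<otimes> z) \<otimes> (w \<otimes> x)"
      using step by (simp add: y_def z_def w_def) (simp add: m_assoc flip: y_def z_def w_def)
    also have "\<dots> = z \<otimes> (x \<otimes> w \<otimes> x)"
      by (simp add: xz) (simp add: m_assoc)
    finally show ?case using step assms by (simp add: rp_Suc x_def y_def z_def w_def)
  qed
  then show ?thesis using assms by simp
qed

text \<open>The conjugating \<open>r j\<close> has \<open>j \<ge> 2\<close>, which keeps it away
  from the first factor, where \<open>d\<close> acts, and \<open>c\<close> is central; so only
  \<open>nb j\<close> and \<open>rp 1 j\<close> change.\<close>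

lemma d_nb: "2 \<le> j \<Longrightarrow> j \<le> p \<Longrightarrow> d \<otimes> nb j = nb j \<otimes> d \<oplus> c \<otimes> (d \<otimes> rp 1 j)"
proof (induction j rule: dec_induct)
  case base
  have "nb 2 = r 1 \<otimes> n \<otimes> r 1" by (metis Suc_1 nb_1 nb_Suc order_refl)
  moreover have "rp 1 2 = r 1" by (metis Suc_1 rp_base)
  ultimately show ?case using dn base by presburger
next
  case (step j)
  define x y z where "x = r j" and "y = nb j" and "z = rp 1 j"
  have cl [simp]: "x \<in> carrier M" "y \<in> carrier M" "z \<in> carrier M"
    using step by (auto simp: x_def y_def z_def simp del: One_nat_def intro: r_closed nb_closed rp_closed)
  have xd: "x \<otimes> d = d \<otimes> x" using step rd by (simp add: x_def)
  have IH: "d \<otimes> y = y \<otimes> d \<oplus> c \<otimes> (d \<otimes> z)"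
    using step by (simp add: x_def y_def z_def)
  have "d \<otimes> (x \<otimes> y \<otimes> x) = (d \<otimes> x) \<otimes> (y \<otimes> x)"
    by (simp add: m_assoc)
  also have "\<dots> = x \<otimes> (d \<otimes> y) \<otimes> x"
    by (simp only: xd[symmetric]) (simp add: m_assoc)
  also have "\<dots> = x \<otimes> (y \<otimes> (d \<otimes> x)) \<oplus> (x \<otimes> c) \<otimes> (d \<otimes> (z \<otimes> x))"
    unfolding IH by (simp add: l_distr r_distr m_assoc)
  also have "\<dots> = x \<otimes> (y \<otimes> (x \<otimes> d)) \<oplus> c \<otimes> ((x \<otimes> d) \<otimes> (z \<otimes> x))"
    by (simp only: c_central[OF cl(1), symmetric] xd[symmetric]) (simp add: m_assoc)
  also have "\<dots> = (x \<otimes> y \<otimes> x) \<otimes> d \<oplus> c \<otimes> (d \<otimes> (x \<otimes> z \<otimes> x))"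
    by (subst (2) xd) (simp add: m_assoc)
  finally show ?case using step by (simp add: nb_Suc rp_Suc x_def y_def z_def)
qed

lemma d_nb_3: "3 \<le> p \<Longrightarrow> nb 3 = r 2 \<otimes> nb 2 \<otimes> r 2" "nb 2 = r 1 \<otimes> n \<otimes> r 1"
  "3 \<le> p \<Longrightarrow> rp 1 3 = r 2 \<otimes> r 1 \<otimes> r 2"
proof -
  show "nb 2 = r 1 \<otimes> n \<otimes> r 1" by (metis Suc_1 nb_1 nb_Suc order_refl)
  show "nb 3 = r 2 \<otimes> nb 2 \<otimes> r 2" using nb_Suc[of 2] by (simp add: numeral_3_eq_3 numeral_2_eq_2)
  have "rp 1 2 = r 1" by (metis Suc_1 rp_base)
  then show "rp 1 3 = r 2 \<otimes> r 1 \<otimes> r 2" using rp_Suc[of 1 2] by (simp add: numeral_3_eq_3 numeral_2_eq_2)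
qed

text \<open>
  If the relation among the \<open>N\<close>s is moved to the factors 2 and 3 by conjugation with \<open>R\<^sub>1R\<^sub>2\<close>, then
  it commutes with \<open>D'\<^sub>1\<close>.
\<close>

lemma d_commutes_with_relation:
  assumes "3 \<le> p"
  defines "q \<equiv> (r 1 \<otimes> n \<otimes> r 1 \<otimes> n \<ominus> n \<otimes> r 1 \<otimes> n \<otimes> r 1) \<ominus> c \<otimes> (r 1 \<otimes> n \<ominus> n \<otimes> r 1)"
  shows "d \<otimes> (r 1 \<otimes> (r 2 \<otimes> q)) = (r 1 \<otimes> (r 2 \<otimes> (q \<otimes> (r 2 \<otimes> (r 1 \<otimes> d))))) \<otimes> (r 1 \<otimes> r 2)"
proof -
  define x y a b w where "x = r 1" and "y = r 2" and "a = nb 2" and "b = nb 3" and "w = rp 1 3"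
  have cl [simp]: "x \<in> carrier M" "y \<in> carrier M" "a \<in> carrier M" "b \<in> carrier M"
    using assms(1) by (auto simp: x_def y_def a_def b_def intro: r_closed nb_closed)
  have [simp]: "x \<otimes> x = \<one>" "y \<otimes> y = \<one>"
    using assms(1) by (auto simp: x_def y_def intro!: r_invol)
  note xx = rewrite_assoc[OF \<open>x \<otimes> x = \<one>\<close>] and yy = rewrite_assoc[OF \<open>y \<otimes> y = \<one>\<close>]
  have xyx: "x \<otimes> (y \<otimes> x) = y \<otimes> (x \<otimes> y)"
    using assms(1) r_braid[of 1] by (simp add: x_def y_def numeral_2_eq_2)
  have w: "w = y \<otimes> (x \<otimes> y)"
    using assms(1) d_nb_3(3) by (simp add: w_def x_def y_def m_assoc r_closed)
  have wcl [simp]: "w \<in> carrier M" by (simp add: w)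
  have yn: "y \<otimes> n = n \<otimes> y" using assms(1) rn by (simp add: y_def)
  have a: "a = x \<otimes> (n \<otimes> x)" using d_nb_3(2) assms(1) by (simp add: a_def x_def m_assoc r_closed)
  have b: "b = y \<otimes> (a \<otimes> y)"
    using d_nb_3(1) assms(1) by (simp add: b_def y_def a_def m_assoc r_closed nb_closed)
  have da: "d \<otimes> a = a \<otimes> d \<oplus> c \<otimes> (d \<otimes> x)"
    using d_nb[of 2] assms(1) rp_base[of 1] by (simp add: a_def x_def numeral_2_eq_2)
  have db: "d \<otimes> b = b \<otimes> d \<oplus> c \<otimes> (d \<otimes> w)"
    using d_nb[of 3] assms(1) by (simp add: b_def w_def)
  have xb: "x \<otimes> b = b \<otimes> x"
    using r_nb_below[of 1 3] assms(1) by (simp add: x_def b_def)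
  have yd: "y \<otimes> d = d \<otimes> y" using assms(1) rd by (simp add: y_def)
  have wx: "w \<otimes> x = x \<otimes> y"
    by (simp add: w flip: xyx) (simp add: m_assoc)
  have wa: "w \<otimes> a = a \<otimes> w"
  proof -
    have "w \<otimes> a = (w \<otimes> x) \<otimes> (n \<otimes> x)" by (simp add: a m_assoc)
    also have "\<dots> = x \<otimes> ((y \<otimes> n) \<otimes> x)" by (simp only: wx) (simp add: m_assoc)
    also have "\<dots> = x \<otimes> (n \<otimes> (y \<otimes> x))" by (simp only: yn) (simp add: m_assoc)
    also have "\<dots> = a \<otimes> w" by (simp add: a w flip: xyx) (simp add: m_assoc xx)
    finally show ?thesis .
  qed
  have xw: "x \<otimes> w = y \<otimes> x" by (simp add: w flip: xyx) (simp add: xx)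

  \<comment> \<open>Conjugation by R_1 R_2 is multiplicative, fixes \<open>c\<close> and sends
    \<open>r 1\<close> to \<open>r 2\<close> and \<open>n\<close> to \<open>nb 2\<close>. Hence
    \<open>f q\<close> is the relation written in \<open>nb 2\<close>, \<open>nb 3\<close> and
    \<open>r 2\<close>, all of which \<open>d\<close> can be moved past.\<close>
  define f where "f t = x \<otimes> (y \<otimes> (t \<otimes> (y \<otimes> x)))" for t
  have fm: "f (t \<otimes> u) = f t \<otimes> f u" if "t \<in> carrier M" "u \<in> carrier M" for t u
    using that by (simp add: f_def m_assoc xx yy)
  have fminus: "f (t \<ominus> u) = f t \<ominus> f u" if "t \<in> carrier M" "u \<in> carrier M" for t u
    using that by (simp add: f_def minus_eq l_distr r_distr l_minus r_minus)
  have fc: "f c = c"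
  proof -
    have "f c = ((x \<otimes> y) \<otimes> c) \<otimes> (y \<otimes> x)" by (simp add: f_def m_assoc)
    also have "\<dots> = c" by (simp add: m_assoc yy flip: c_central)
    finally show ?thesis .
  qed
  have fx: "f x = y" by (simp add: f_def) (simp add: xyx xx yy)
  have fn: "f n = a"
    by (simp add: f_def a rewrite_assoc[OF yn[symmetric]]) (simp add: m_assoc rewrite_assoc[OF yn] yy)
  have fq: "f q = (b \<otimes> a \<ominus> a \<otimes> b) \<ominus> c \<otimes> (y \<otimes> a \<ominus> a \<otimes> y)"
    unfolding q_def x_def[symmetric] by (simp add: fminus fc fm fx fn b m_assoc)
  have qcl: "q \<in> carrier M" unfolding q_def x_def[symmetric] by simp
  \<comment> \<open>The correction that appears when \<open>d\<close> passes
    \<open>b a + c a y\<close>. The products \<open>a b + c y a\<close> produce the same correction,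
    and \<open>f q\<close> is the difference of the two, so it cancels.\<close>
  define e where "e = c \<otimes> (a \<otimes> (d \<otimes> w)) \<oplus> (c \<otimes> (b \<otimes> (d \<otimes> x))
     \<oplus> (c \<otimes> (c \<otimes> (d \<otimes> (x \<otimes> y))) \<oplus> c \<otimes> (c \<otimes> (d \<otimes> (y \<otimes> x)))))"
  have c_left: "t \<otimes> (c \<otimes> u) = c \<otimes> (t \<otimes> u)" if "t \<in> carrier M" "u \<in> carrier M" for t u
    using that by (metis c_central c_closed m_assoc)
  note cc = c_left[OF cl(1)] c_left[OF cl(2)] c_left[OF cl(3)] c_left[OF cl(4)] c_left[OF d_closed]
  have ecl: "e \<in> carrier M" by (simp add: e_def)
  have X: "d \<otimes> (b \<otimes> a \<oplus> c \<otimes> (a \<otimes> y)) = (b \<otimes> a \<oplus> c \<otimes> (a \<otimes> y)) \<otimes> d \<oplus> e"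
  proof -
    have "d \<otimes> (b \<otimes> a) = (d \<otimes> b) \<otimes> a" by (simp add: m_assoc)
    also have "\<dots> = b \<otimes> (d \<otimes> a) \<oplus> c \<otimes> (d \<otimes> (w \<otimes> a))"
      by (simp only: db) (simp add: l_distr m_assoc)
    also have "\<dots> = b \<otimes> (d \<otimes> a) \<oplus> c \<otimes> ((d \<otimes> a) \<otimes> w)"
      by (simp only: wa) (simp add: m_assoc)
    also have "\<dots> = b \<otimes> (a \<otimes> d) \<oplus> (c \<otimes> (b \<otimes> (d \<otimes> x)) \<oplus> (c \<otimes> (a \<otimes> (d \<otimes> w)) \<oplus> c \<otimes> (c \<otimes> (d \<otimes> (x \<otimes> w)))))"
      by (simp only: da) (simp add: l_distr r_distr m_assoc cc a_assoc)
    finally have 1: "d \<otimes> (b \<otimes> a) = b \<otimes> (a \<otimes> d) \<oplus> (c \<otimes> (b \<otimes> (d \<otimes> x)) \<oplus> (c \<otimes> (a \<otimes> (d \<otimes> w)) \<oplus> c \<otimes> (c \<otimes> (d \<otimes> (y \<otimes> x)))))"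
      by (simp only: xw)
    have "d \<otimes> (a \<otimes> y) = (d \<otimes> a) \<otimes> y" by (simp add: m_assoc)
    also have "\<dots> = a \<otimes> (d \<otimes> y) \<oplus> c \<otimes> (d \<otimes> (x \<otimes> y))"
      by (simp only: da) (simp add: l_distr m_assoc)
    finally have 2: "d \<otimes> (a \<otimes> y) = a \<otimes> (y \<otimes> d) \<oplus> c \<otimes> (d \<otimes> (x \<otimes> y))"
      by (simp only: yd)
    show ?thesis
      by (simp add: r_distr cc 1 2 e_def) (simp add: l_distr r_distr m_assoc a_ac)
  qed
  have Y: "d \<otimes> (a \<otimes> b \<oplus> c \<otimes> (y \<otimes> a)) = (a \<otimes> b \<oplus> c \<otimes> (y \<otimes> a)) \<otimes> d \<oplus> e"
  proof -
    have "d \<otimes> (a \<otimes> b) = (d \<otimes> a) \<otimes> b" by (simp add: m_assoc)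
    also have "\<dots> = a \<otimes> (d \<otimes> b) \<oplus> c \<otimes> (d \<otimes> (x \<otimes> b))"
      by (simp only: da) (simp add: l_distr m_assoc)
    also have "\<dots> = a \<otimes> (d \<otimes> b) \<oplus> c \<otimes> ((d \<otimes> b) \<otimes> x)"
      by (simp only: xb) (simp add: m_assoc)
    also have "\<dots> = a \<otimes> (b \<otimes> d) \<oplus> (c \<otimes> (a \<otimes> (d \<otimes> w)) \<oplus> (c \<otimes> (b \<otimes> (d \<otimes> x)) \<oplus> c \<otimes> (c \<otimes> (d \<otimes> (w \<otimes> x)))))"
      by (simp only: db) (simp add: l_distr r_distr m_assoc cc a_assoc)
    finally have 1: "d \<otimes> (a \<otimes> b) = a \<otimes> (b \<otimes> d) \<oplus> (c \<otimes> (a \<otimes> (d \<otimes> w)) \<oplus> (c \<otimes> (b \<otimes> (d \<otimes> x)) \<oplus> c \<otimes> (c \<otimes> (d \<otimes> (x \<otimes> y)))))"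
      by (simp only: wx)
    have "d \<otimes> (y \<otimes> a) = (d \<otimes> y) \<otimes> a" by (simp add: m_assoc)
    also have "\<dots> = y \<otimes> (d \<otimes> a)"
      by (simp only: yd[symmetric]) (simp add: m_assoc)
    also have "\<dots> = y \<otimes> (a \<otimes> d) \<oplus> c \<otimes> ((y \<otimes> d) \<otimes> x)"
      by (simp only: da) (simp add: r_distr cc m_assoc)
    finally have 2: "d \<otimes> (y \<otimes> a) = y \<otimes> (a \<otimes> d) \<oplus> c \<otimes> (d \<otimes> (y \<otimes> x))"
      by (simp only: yd) (simp add: m_assoc)
    show ?thesis
      by (simp add: r_distr cc 1 2 e_def) (simp add: l_distr r_distr m_assoc a_ac)
  qed
  have fq': "f q = (b \<otimes> a \<oplus> c \<otimes> (a \<otimes> y)) \<ominus> (a \<otimes> b \<oplus> c \<otimes> (y \<otimes> a))"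
    unfolding fq by (simp add: minus_eq r_distr r_minus minus_add minus_minus a_ac)
  have "d \<otimes> f q = f q \<otimes> d"
  proof -
    define A B where "A = b \<otimes> a \<oplus> c \<otimes> (a \<otimes> y)" and "B = a \<otimes> b \<oplus> c \<otimes> (y \<otimes> a)"
    have AB [simp]: "A \<in> carrier M" "B \<in> carrier M" by (simp_all add: A_def B_def)
    have "d \<otimes> f q = (A \<otimes> d \<oplus> e) \<ominus> (B \<otimes> d \<oplus> e)"
      using X Y by (simp add: fq' A_def[symmetric] B_def[symmetric] minus_eq r_distr r_minus)
    also have "\<dots> = (A \<otimes> d \<ominus> B \<otimes> d) \<oplus> (e \<oplus> \<ominus> e)"
      using ecl by (simp add: minus_eq minus_add a_ac)
    also have "\<dots> = f q \<otimes> d"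
      using ecl by (simp add: r_neg fq' A_def[symmetric] B_def[symmetric] minus_eq l_distr l_minus)
    finally show ?thesis .
  qed
  \<comment> \<open>Multiplying by \<open>x y\<close> removes the trailing \<open>y x\<close> of
    \<open>f q\<close> on the left side and leaves \<open>d x y q\<close>, the form first factor,
    R_1, R_2, block from which skew-invertibility can isolate single entries.\<close>
  then have "(d \<otimes> f q) \<otimes> (x \<otimes> y) = (f q \<otimes> d) \<otimes> (x \<otimes> y)" by simp
  moreover have "(d \<otimes> f q) \<otimes> (x \<otimes> y) = d \<otimes> (x \<otimes> (y \<otimes> q))"
    using qcl by (simp add: f_def m_assoc xx)
  ultimately show ?thesis
    unfolding x_def[symmetric] y_def[symmetric] using qcl by (simp add: f_def m_assoc)
qed

text \<open>With \<open>e = r 1 d r 1\<close> both \<open>e d\<close> and \<open>d e\<close> pass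
  \<open>nb 3\<close> with the same correction factor \<open>c (r 2 + rp 1 3)\<close>, hence so does
  their difference \<open>z\<close>. On the right side \<open>z\<close> is followed only by R's, so
  a vector killed by the entries of \<open>z\<close> stays killed after multiplication by an N. The
  factor \<open>r 2 r 1\<close> cancels the right half of \<open>nb 3\<close> and gives the left
  side the form block, R_2, R_1, first factor.\<close>

lemma d_relation_commutes:
  assumes "3 \<le> p"
  defines "z \<equiv> r 1 \<otimes> d \<otimes> r 1 \<otimes> d \<ominus> d \<otimes> r 1 \<otimes> d \<otimes> r 1"
  shows "z \<otimes> (r 2 \<otimes> (r 1 \<otimes> n)) = (nb 3 \<otimes> z \<oplus> c \<otimes> (z \<otimes> (r 2 \<oplus> rp 1 3))) \<otimes> (r 2 \<otimes> r 1)"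
proof -
  define x y b w where "x = r 1" and "y = r 2" and "b = nb 3" and "w = rp 1 3"
  have cl [simp]: "x \<in> carrier M" "y \<in> carrier M" "b \<in> carrier M"
    using assms(1) by (auto simp: x_def y_def b_def intro: r_closed nb_closed)
  have [simp]: "x \<otimes> x = \<one>" "y \<otimes> y = \<one>"
    using assms(1) by (auto simp: x_def y_def intro!: r_invol)
  note xx = rewrite_assoc[OF \<open>x \<otimes> x = \<one>\<close>] and yy = rewrite_assoc[OF \<open>y \<otimes> y = \<one>\<close>]
  have xyx: "x \<otimes> (y \<otimes> x) = y \<otimes> (x \<otimes> y)"
    using assms(1) r_braid[of 1] by (simp add: x_def y_def numeral_2_eq_2)
  have w: "w = y \<otimes> (x \<otimes> y)"
    using assms(1) d_nb_3(3) by (simp add: w_def x_def y_def m_assoc r_closed)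
  have wcl [simp]: "w \<in> carrier M" by (simp add: w)
  have b: "b = y \<otimes> (x \<otimes> (n \<otimes> (x \<otimes> y)))"
    using d_nb_3 assms(1) by (simp add: b_def y_def x_def m_assoc r_closed)
  have db: "d \<otimes> b = b \<otimes> d \<oplus> c \<otimes> (d \<otimes> w)"
    using d_nb[of 3] assms(1) by (simp add: b_def w_def)
  have xb: "x \<otimes> b = b \<otimes> x"
    using r_nb_below[of 1 3] assms(1) by (simp add: x_def b_def)
  have yd: "y \<otimes> d = d \<otimes> y" using assms(1) rd by (simp add: y_def)
  have c_left: "t \<otimes> (c \<otimes> u) = c \<otimes> (t \<otimes> u)" if "t \<in> carrier M" "u \<in> carrier M" for t u
    using that by (metis c_central c_closed m_assoc)
  define e where "e = x \<otimes> (d \<otimes> x)"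
  have ecl [simp]: "e \<in> carrier M" by (simp add: e_def)
  note cc = c_left[OF cl(1)] c_left[OF cl(2)] c_left[OF cl(3)] c_left[OF ecl] c_left[OF d_closed]
  have eb: "e \<otimes> b = b \<otimes> e \<oplus> c \<otimes> (e \<otimes> y)"
  proof -
    have "e \<otimes> b = x \<otimes> (d \<otimes> (x \<otimes> b))" by (simp add: e_def m_assoc)
    also have "\<dots> = x \<otimes> ((d \<otimes> b) \<otimes> x)" by (simp only: xb) (simp add: m_assoc)
    also have "\<dots> = (x \<otimes> b) \<otimes> (d \<otimes> x) \<oplus> c \<otimes> (x \<otimes> (d \<otimes> (w \<otimes> x)))"
      by (simp only: db) (simp add: l_distr r_distr m_assoc cc)
    also have "w \<otimes> x = x \<otimes> y" by (simp add: w flip: xyx) (simp add: m_assoc)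
    also have "(x \<otimes> b) \<otimes> (d \<otimes> x) \<oplus> c \<otimes> (x \<otimes> (d \<otimes> (x \<otimes> y))) = b \<otimes> e \<oplus> c \<otimes> (e \<otimes> y)"
      by (simp only: xb) (simp add: m_assoc e_def)
    finally show ?thesis .
  qed
  have we: "w \<otimes> e = e \<otimes> w"
  proof -
    have "w \<otimes> e = x \<otimes> ((y \<otimes> d) \<otimes> x)" by (simp add: w e_def flip: xyx) (simp add: m_assoc xx)
    also have "\<dots> = x \<otimes> (d \<otimes> (y \<otimes> x))" by (simp only: yd) (simp add: m_assoc)
    also have "\<dots> = e \<otimes> w" by (simp add: w e_def flip: xyx) (simp add: m_assoc xx)
    finally show ?thesis .
  qed
  have z: "z = e \<otimes> d \<ominus> d \<otimes> e"
    unfolding z_def e_def x_def[symmetric] by (simp add: m_assoc)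
  have 1: "(e \<otimes> d) \<otimes> b = b \<otimes> (e \<otimes> d) \<oplus> c \<otimes> ((e \<otimes> d) \<otimes> (y \<oplus> w))"
  proof -
    have "(e \<otimes> d) \<otimes> b = (e \<otimes> b) \<otimes> d \<oplus> c \<otimes> (e \<otimes> (d \<otimes> w))"
      by (simp add: m_assoc db r_distr cc)
    also have "\<dots> = b \<otimes> (e \<otimes> d) \<oplus> c \<otimes> (e \<otimes> (y \<otimes> d)) \<oplus> c \<otimes> (e \<otimes> (d \<otimes> w))"
      by (simp add: eb l_distr m_assoc)
    finally show ?thesis by (simp only: yd) (simp add: r_distr m_assoc a_assoc)
  qed
  have 2: "(d \<otimes> e) \<otimes> b = b \<otimes> (d \<otimes> e) \<oplus> c \<otimes> ((d \<otimes> e) \<otimes> (y \<oplus> w))"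
  proof -
    have "(d \<otimes> e) \<otimes> b = (d \<otimes> b) \<otimes> e \<oplus> c \<otimes> (d \<otimes> (e \<otimes> y))"
      by (simp add: m_assoc eb r_distr cc)
    also have "\<dots> = b \<otimes> (d \<otimes> e) \<oplus> c \<otimes> (d \<otimes> (w \<otimes> e)) \<oplus> c \<otimes> (d \<otimes> (e \<otimes> y))"
      by (simp add: db l_distr m_assoc)
    finally show ?thesis by (simp only: we) (simp add: r_distr m_assoc a_ac)
  qed
  define A B where "A = e \<otimes> d" and "B = d \<otimes> e"
  have AB [simp]: "A \<in> carrier M" "B \<in> carrier M" by (simp_all add: A_def B_def)
  have "z \<otimes> b = (b \<otimes> A \<oplus> c \<otimes> (A \<otimes> (y \<oplus> w))) \<ominus> (b \<otimes> B \<oplus> c \<otimes> (B \<otimes> (y \<oplus> w)))"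
    using 1 2 by (simp add: z A_def[symmetric] B_def[symmetric] minus_eq l_distr l_minus)
  also have "\<dots> = b \<otimes> z \<oplus> c \<otimes> (z \<otimes> (y \<oplus> w))"
    by (simp add: z A_def[symmetric] B_def[symmetric] minus_eq l_distr l_minus r_distr r_minus minus_add a_ac)
  finally have "z \<otimes> b \<otimes> (y \<otimes> x) = (b \<otimes> z \<oplus> c \<otimes> (z \<otimes> (y \<oplus> w))) \<otimes> (y \<otimes> x)" by simp
  moreover have "z \<otimes> b \<otimes> (y \<otimes> x) = z \<otimes> (y \<otimes> (x \<otimes> n))"
    by (simp add: b z A_def[symmetric] B_def[symmetric] m_assoc yy)
  ultimately show ?thesis by (simp add: x_def y_def b_def w_def)
qed

section \<open>Chains of indices and the expansion over them\<close>

definition chains :: "nat \<Rightarrow> nat list set" where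
  "chains q = {ks. sorted_wrt (<) ks \<and> set ks \<subseteq> {2..q}}"

lemma finite_chains: "finite (chains q)"
proof (rule finite_imageD)
  show "finite (set ` chains q)"
    by (rule finite_subset[of _ "Pow {2..q}"]) (auto simp: chains_def)
  show "inj_on set (chains q)"
    by (auto simp: inj_on_def chains_def intro: strict_sorted_equal)
qed

lemma chains_Suc:
  assumes "1 \<le> q"
  shows "chains (Suc q) = chains q \<union> (\<lambda>ks. ks @ [Suc q]) ` chains q"
proof (intro equalityI subsetI)
  fix ks assume ks: "ks \<in> chains (Suc q)"
  show "ks \<in> chains q \<union> (\<lambda>ks. ks @ [Suc q]) ` chains q"
  proof (cases ks rule: rev_cases)
    case Nil then show ?thesis by (simp add: chains_def)
  next
    case (snoc xs x)
    have xs: "sorted_wrt (<) xs" "\<forall>y\<in>set xs. y < x" "x \<le> Suc q" "set xs \<subseteq> {2..}" "2 \<le> x"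
      using ks by (auto simp: chains_def snoc sorted_wrt_append)
    show ?thesis
    proof (cases "x = Suc q")
      case True then have "xs \<in> chains q" using xs by (force simp: chains_def)
      then show ?thesis using True snoc by simp
    next
      case False then have "ks \<in> chains q" using xs snoc by (force simp: chains_def sorted_wrt_append)
      then show ?thesis by simp
    qed
  qed
next
  fix ks assume "ks \<in> chains q \<union> (\<lambda>ks. ks @ [Suc q]) ` chains q"
  then show "ks \<in> chains (Suc q)"
    using assms by (force simp: chains_def sorted_wrt_append)
qed

definition rc :: "nat \<Rightarrow> nat list \<Rightarrow> 'a" where
  "rc a ks = list_prod M (map (\<lambda>(k, l). rp k l) (zip (a # ks) ks))"

lemma rc_Nil [simp]: "rc a [] = \<one>"
  by (simp add: rc_def)

lemma rc_Cons: "rc a (b # ks) = rp a b \<otimes> rc b ks"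
  by (simp add: rc_def)

lemma rc_closed:
  "1 \<le> a \<Longrightarrow> sorted_wrt (<) ks \<Longrightarrow> set ks \<subseteq> {a<..p} \<Longrightarrow> rc a ks \<in> carrier M"
proof (induction ks arbitrary: a)
  case (Cons b ks)
  then have "rc b ks \<in> carrier M" by (intro Cons.IH) auto
  then show ?case using Cons.prems by (auto simp: rc_Cons intro!: m_closed rp_closed)
qed simp

text \<open>When \<open>d\<close> passes the factor with index \<open>e\<close>, the new
  \<open>rp a e\<close> appears at the left end of the chain product. By \<open>rp_rp\<close> it
  moves to the right, its first index running through the chain, until it stands at the end and
  prolongs the chain by \<open>e\<close>.\<close>

lemma rp_rc:
  "1 \<le> a \<Longrightarrow> sorted_wrt (<) ks \<Longrightarrow> set ks \<subseteq> {a<..<e} \<Longrightarrow> a < e \<Longrightarrow> e \<le> p \<Longrightarrow>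
    rp a e \<otimes> rc a ks = rc a (ks @ [e])"
proof (induction ks arbitrary: a)
  case (Cons b ks)
  have cl: "rc b ks \<in> carrier M" "rp a b \<in> carrier M" "rp a e \<in> carrier M" "rp b e \<in> carrier M"
    using Cons.prems by (force intro!: rc_closed rp_closed)+
  have "rp a e \<otimes> (rp a b \<otimes> rc b ks) = (rp a e \<otimes> rp a b) \<otimes> rc b ks"
    using cl by (simp add: m_assoc)
  also have "\<dots> = rp a b \<otimes> (rp b e \<otimes> rc b ks)"
    using cl Cons.prems by (subst rp_rp) (auto simp: m_assoc)
  also have "rp b e \<otimes> rc b ks = rc b (ks @ [e])"
    using Cons.prems by (intro Cons.IH) auto
  finally show ?case by (simp add: rc_Cons)
qed (simp_all add: rc_Cons rp_closed)

lemma nb_rc: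
  "1 \<le> a \<Longrightarrow> sorted_wrt (<) ks \<Longrightarrow> set ks \<subseteq> {a<..<e} \<Longrightarrow> 1 \<le> e \<Longrightarrow> e \<le> p \<Longrightarrow> nb e \<otimes> rc a ks = rc a ks \<otimes> nb e"
proof (induction ks arbitrary: a)
  case (Cons b ks)
  have "nb e \<otimes> (rp a b \<otimes> rc b ks) = (rp a b \<otimes> rc b ks) \<otimes> nb e"
  proof (rule commute_mult)
    show "nb e \<otimes> rp a b = rp a b \<otimes> nb e" using Cons.prems by (intro rp_nb) auto
    show "nb e \<otimes> rc b ks = rc b ks \<otimes> nb e" using Cons.prems by (intro Cons.IH) auto
    show "rc b ks \<in> carrier M" "rp a b \<in> carrier M" "nb e \<in> carrier M"
      using Cons.prems by (force intro!: rc_closed rp_closed nb_closed)+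
  qed
  then show ?case by (simp add: rc_Cons)
qed (simp add: nb_closed)

definition ns :: "nat \<Rightarrow> nat list \<Rightarrow> 'a" where
  "ns q ks = list_prod M (map nb (filter (\<lambda>k. k \<notin> set ks) [2..<Suc q]))"

lemma ns_closed: "q \<le> p \<Longrightarrow> ns q ks \<in> carrier M"
  unfolding ns_def by (rule list_prod_closed) (auto intro!: nb_closed)

lemma ns_Suc:
  assumes "ks \<in> chains q" "1 \<le> q" "Suc q \<le> p"
  shows "ns (Suc q) ks = ns q ks \<otimes> nb (Suc q)" "ns (Suc q) (ks @ [Suc q]) = ns q ks"
proof -
  have eq: "[2..<Suc (Suc q)] = [2..<Suc q] @ [Suc q]" using assms by simp
  have nin: "Suc q \<notin> set ks" using assms(1) by (auto simp: chains_def)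
  show "ns (Suc q) ks = ns q ks \<otimes> nb (Suc q)"
    unfolding ns_def eq using nin assms
    by (auto intro!: list_prod_snoc nb_closed simp del: upt_Suc)
  have "filter (\<lambda>k. k \<notin> set (ks @ [Suc q])) [2..<Suc q] = filter (\<lambda>k. k \<notin> set ks) [2..<Suc q]"
    by (rule filter_cong) auto
  then show "ns (Suc q) (ks @ [Suc q]) = ns q ks"
    unfolding ns_def eq by (simp del: upt_Suc)
qed

definition dterm :: "nat \<Rightarrow> nat list \<Rightarrow> 'a" where
  "dterm q ks = c [^] length ks \<otimes> (ns q ks \<otimes> d \<otimes> rc 1 ks)"

lemma rc_chain_closed: "ks \<in> chains q \<Longrightarrow> q \<le> p \<Longrightarrow> rc 1 ks \<in> carrier M"
  by (rule rc_closed) (auto simp: chains_def)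

lemma dterm_closed: "ks \<in> chains q \<Longrightarrow> q \<le> p \<Longrightarrow> dterm q ks \<in> carrier M"
  by (auto simp: dterm_def simp del: One_nat_def intro!: m_closed ns_closed rc_chain_closed)

lemma dterm_Suc:
  assumes "ks \<in> chains q" "1 \<le> q" "Suc q \<le> p"
  shows "dterm q ks \<otimes> nb (Suc q) = dterm (Suc q) ks \<oplus> dterm (Suc q) (ks @ [Suc q])"
proof -
  define C x y z w where "C = c [^] length ks" and "x = ns q ks" and "y = rc 1 ks"
    and "z = nb (Suc q)" and "w = rp 1 (Suc q)"
  have cl [simp]: "C \<in> carrier M" "x \<in> carrier M" "y \<in> carrier M" "z \<in> carrier M" "w \<in> carrier M"
    using assms by (auto simp: C_def x_def y_def z_def w_def simp del: One_nat_def
      intro!: ns_closed rc_chain_closed nb_closed rp_closed)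
  have zy: "z \<otimes> y = y \<otimes> z"
    unfolding z_def y_def using assms by (intro nb_rc) (auto simp: chains_def)
  have wy: "w \<otimes> y = rc 1 (ks @ [Suc q])"
    unfolding w_def y_def using assms by (intro rp_rc) (auto simp: chains_def)
  have dz: "d \<otimes> z = z \<otimes> d \<oplus> c \<otimes> (d \<otimes> w)"
    unfolding z_def w_def using assms by (intro d_nb) auto
  have "dterm q ks \<otimes> z = C \<otimes> (x \<otimes> (d \<otimes> (y \<otimes> z)))"
    by (simp add: dterm_def C_def[symmetric] x_def[symmetric] y_def[symmetric] m_assoc del: One_nat_def)
  also have "\<dots> = C \<otimes> (x \<otimes> ((d \<otimes> z) \<otimes> y))"
    by (simp only: zy[symmetric]) (simp add: m_assoc)
  also have "\<dots> = C \<otimes> (x \<otimes> z \<otimes> d \<otimes> y) \<oplus> C \<otimes> ((x \<otimes> c) \<otimes> (d \<otimes> (w \<otimes> y)))"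
    by (simp only: dz) (simp add: l_distr r_distr m_assoc)
  also have "C \<otimes> ((x \<otimes> c) \<otimes> (d \<otimes> (w \<otimes> y))) = (C \<otimes> c) \<otimes> (x \<otimes> d \<otimes> (w \<otimes> y))"
    by (subst c_central[symmetric]) (simp_all add: m_assoc)
  also have "C \<otimes> (x \<otimes> z \<otimes> d \<otimes> y) = dterm (Suc q) ks"
    using ns_Suc(1)[OF assms] by (simp add: dterm_def C_def x_def y_def z_def)
  also have "(C \<otimes> c) \<otimes> (x \<otimes> d \<otimes> (w \<otimes> y)) = dterm (Suc q) (ks @ [Suc q])"
    using ns_Suc(2)[OF assms] by (simp add: dterm_def C_def x_def wy)
  finally show ?thesis by (simp add: z_def)
qed

text \<open>Chains of all lengths are kept in one sum, the empty chain being the term in which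
  \<open>d\<close> has passed everything. The induction step then matches the decomposition of the
  chains in \<open>chains_Suc\<close>.\<close>

lemma d_ns_chains: "1 \<le> q \<Longrightarrow> q \<le> p \<Longrightarrow> d \<otimes> ns q [] = (\<Oplus>ks\<in>chains q. dterm q ks)"
proof (induction q rule: dec_induct)
  case base
  have "chains (Suc 0) = {[]}" by (auto simp: chains_def)
  then show ?case by (simp add: dterm_def ns_def)
next
  case (step q)
  have emp: "[] \<in> chains q" by (simp add: chains_def)
  have nins: "chains q \<inter> (\<lambda>ks. ks @ [Suc q]) ` chains q = {}" by (auto simp: chains_def)
  have sub: "chains q \<subseteq> chains (Suc q)" "(\<lambda>ks. ks @ [Suc q]) ` chains q \<subseteq> chains (Suc q)"
    using chains_Suc[of q] step by auto
  have "d \<otimes> ns (Suc q) [] = d \<otimes> ns q [] \<otimes> nb (Suc q)"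
    using step(1,3-) ns_Suc(1)[OF emp] m_assoc[of d "ns q []" "nb (Suc q)"]
    by (simp add: ns_closed nb_closed)
  also have "\<dots> = (\<Oplus>ks\<in>chains q. dterm q ks) \<otimes> nb (Suc q)"
    using step.IH step.prems step.hyps by simp
  also have "\<dots> = (\<Oplus>ks\<in>chains q. dterm q ks \<otimes> nb (Suc q))"
    using step finite_chains by (intro finsum_ldistr) (auto intro!: dterm_closed nb_closed)
  also have "\<dots> = (\<Oplus>ks\<in>chains q. dterm (Suc q) ks \<oplus> dterm (Suc q) (ks @ [Suc q]))"
    using step sub by (intro finsum_cong') (auto intro!: a_closed dterm_closed dterm_Suc)
  also have "\<dots> = (\<Oplus>ks\<in>chains q. dterm (Suc q) ks) \<oplus> (\<Oplus>ks\<in>chains q. dterm (Suc q) (ks @ [Suc q]))"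
    using step sub by (intro finsum_addf) (auto intro!: dterm_closed)
  also have "(\<Oplus>ks\<in>chains q. dterm (Suc q) (ks @ [Suc q])) = (\<Oplus>ks\<in>(\<lambda>ks. ks @ [Suc q]) ` chains q. dterm (Suc q) ks)"
    using step sub by (intro finsum_reindex[symmetric]) (auto simp: inj_on_def intro!: dterm_closed)
  also have "(\<Oplus>ks\<in>chains q. dterm (Suc q) ks) \<oplus> \<dots> = (\<Oplus>ks\<in>chains (Suc q). dterm (Suc q) ks)"
    unfolding chains_Suc[OF step(1)] using step sub finite_chains nins
    by (intro finsum_Un_disjoint[symmetric]) (auto intro!: dterm_closed)
  finally show ?case .
qed

lemma index_chains_chains: "index_chains q s = {ks \<in> chains q. length ks = s}"
  by (auto simp: index_chains_def chains_def)

lemma length_chains: "ks \<in> chains q \<Longrightarrow> length ks \<le> q - 1"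
proof -
  assume ks: "ks \<in> chains q"
  then have "card (set ks) \<le> card {2..q}" by (intro card_mono) (auto simp: chains_def)
  moreover have "card (set ks) = length ks"
    using ks by (intro distinct_card) (auto simp: chains_def strict_sorted_iff)
  ultimately show ?thesis by simp
qed

lemma d_ns:
  assumes "2 \<le> p"
  shows "d \<otimes> ns p [] = ns p [] \<otimes> d \<oplus>
    (\<Oplus>s\<in>{1..p - 1}. c [^] s \<otimes> (\<Oplus>ks\<in>index_chains p s. ns p ks \<otimes> d \<otimes> rc 1 ks))"
proof -
  have fin: "finite (index_chains p s)" for s
    using finite_chains[of p] by (simp add: index_chains_chains)
  \<comment> \<open>Only now are the chains sorted by length; length 0 is split off below as the
    separate first term of the identity.\<close>
  have "chains p = (\<Union>s\<in>{0..p - 1}. index_chains p s)"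
    using length_chains by (auto simp: index_chains_chains)
  then have "d \<otimes> ns p [] = (\<Oplus>ks\<in>(\<Union>s\<in>{0..p - 1}. index_chains p s). dterm p ks)"
    using d_ns_chains[of p] assms by simp
  also have "\<dots> = (\<Oplus>s\<in>{0..p - 1}. \<Oplus>ks\<in>index_chains p s. dterm p ks)"
    using fin by (intro add.finprod_UN_disjoint) (auto simp: index_chains_chains disjnt_def pairwise_def intro!: dterm_closed)
  also have "\<dots> = (\<Oplus>s\<in>{0..p - 1}. c [^] s \<otimes> (\<Oplus>ks\<in>index_chains p s. ns p ks \<otimes> d \<otimes> rc 1 ks))"
  proof (rule finsum_cong')
    fix s assume "s \<in> {0..p - 1}"
    have "(\<Oplus>ks\<in>index_chains p s. dterm p ks) = (\<Oplus>ks\<in>index_chains p s. c [^] s \<otimes> (ns p ks \<otimes> d \<otimes> rc 1 ks))"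
      by (intro finsum_cong') (auto simp: dterm_def index_chains_chains simp del: One_nat_def intro!: m_closed ns_closed rc_chain_closed)
    also have "\<dots> = c [^] s \<otimes> (\<Oplus>ks\<in>index_chains p s. ns p ks \<otimes> d \<otimes> rc 1 ks)"
      using fin by (intro finsum_rdistr[symmetric]) (auto simp: index_chains_chains simp del: One_nat_def intro!: m_closed ns_closed rc_chain_closed)
    finally show "(\<Oplus>ks\<in>index_chains p s. dterm p ks) = c [^] s \<otimes> (\<Oplus>ks\<in>index_chains p s. ns p ks \<otimes> d \<otimes> rc 1 ks)" .
  qed (auto simp: index_chains_chains simp del: One_nat_def intro!: m_closed finsum_closed ns_closed rc_chain_closed)
  also have "{0..p - 1} = insert 0 {1..p - 1}" by auto
  also have "(\<Oplus>s\<in>insert 0 {1..p - 1}. c [^] s \<otimes> (\<Oplus>ks\<in>index_chains p s. ns p ks \<otimes> d \<otimes> rc 1 ks))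
     = c [^] (0::nat) \<otimes> (\<Oplus>ks\<in>index_chains p 0. ns p ks \<otimes> d \<otimes> rc 1 ks) \<oplus>
      (\<Oplus>s\<in>{1..p - 1}. c [^] s \<otimes> (\<Oplus>ks\<in>index_chains p s. ns p ks \<otimes> d \<otimes> rc 1 ks))"
    by (rule finsum_insert)
      (auto simp: index_chains_chains simp del: One_nat_def intro!: m_closed finsum_closed ns_closed rc_chain_closed)
  also have "index_chains p 0 = {[]}" by (auto simp: index_chains_def)
  also have "c [^] (0::nat) \<otimes> (\<Oplus>ks\<in>{[]}. ns p ks \<otimes> d \<otimes> rc 1 ks) = ns p [] \<otimes> d"
    using ns_closed[of p "[]"] by simp
  finally show ?thesis .
qed

end

context braided_ring
begin

text \<open>\<open>u\<close> is the inverse of \<open>c\<close>. In a summand of length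
  \<open>s\<close> the part \<open>u\<close> of \<open>d\<close> lowers \<open>c^s\<close> to
  \<open>c^(s-1)\<close> and leaves no derivative, while the two terms \<open>u ns\<close> cancel.
  In the remaining terms \<open>d'\<close> has only R's to its right, so the result is normal
  ordered.\<close>

lemma shifted_d_ns:
  assumes "2 \<le> p" and u: "u \<in> carrier M" "c \<otimes> u = \<one>" "\<And>x. x \<in> carrier M \<Longrightarrow> u \<otimes> x = x \<otimes> u"
    and d': "d' \<in> carrier M" "d = u \<oplus> d'"
  shows "d' \<otimes> ns p [] =
    (\<Oplus>s\<in>{1..p - 1}. c [^] (s - 1) \<otimes> (\<Oplus>ks\<in>index_chains p s. ns p ks \<otimes> rc 1 ks)) \<oplus>
    (ns p [] \<otimes> d' \<oplus>
      (\<Oplus>s\<in>{1..p - 1}. c [^] s \<otimes> (\<Oplus>ks\<in>index_chains p s. ns p ks \<otimes> d' \<otimes> rc 1 ks)))"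
proof -
  have fin: "finite (index_chains p s)" for s
    using finite_chains[of p] by (simp add: index_chains_chains)
  have rcc: "rc 1 ks \<in> carrier M" if "ks \<in> index_chains p s" for ks s
    using that by (intro rc_chain_closed[of _ p]) (auto simp: index_chains_chains)
  have nsc [simp]: "ns p ks \<in> carrier M" for ks by (simp add: ns_closed)
  define A where "A s = (\<Oplus>ks\<in>index_chains p s. ns p ks \<otimes> rc 1 ks)" for s
  define B where "B s = (\<Oplus>ks\<in>index_chains p s. ns p ks \<otimes> d' \<otimes> rc 1 ks)" for s
  have AB [simp]: "A s \<in> carrier M" "B s \<in> carrier M" for s
    using rcc d' by (auto simp: A_def B_def simp del: One_nat_def intro!: finsum_closed)
  have s1: "c [^] s \<otimes> (\<Oplus>ks\<in>index_chains p s. ns p ks \<otimes> d \<otimes> rc 1 ks)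
      = c [^] (s - 1) \<otimes> A s \<oplus> c [^] s \<otimes> B s" if "s \<in> {1..p - 1}" for s
  proof -
    have "ns p ks \<otimes> d \<otimes> rc 1 ks = u \<otimes> (ns p ks \<otimes> rc 1 ks) \<oplus> ns p ks \<otimes> d' \<otimes> rc 1 ks"
      if "ks \<in> index_chains p s" for ks
      using rcc[OF that] u(1) d' u(3)[of "ns p ks"]
      by (simp add: r_distr l_distr del: One_nat_def) (simp flip: m_assoc)
    then have "(\<Oplus>ks\<in>index_chains p s. ns p ks \<otimes> d \<otimes> rc 1 ks)
        = (\<Oplus>ks\<in>index_chains p s. u \<otimes> (ns p ks \<otimes> rc 1 ks) \<oplus> ns p ks \<otimes> d' \<otimes> rc 1 ks)"
      using rcc u d' by (intro finsum_cong') (auto simp del: One_nat_def)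
    also have "\<dots> = (\<Oplus>ks\<in>index_chains p s. u \<otimes> (ns p ks \<otimes> rc 1 ks)) \<oplus> B s"
      unfolding B_def using rcc u d' by (intro finsum_addf) (auto simp del: One_nat_def)
    also have "(\<Oplus>ks\<in>index_chains p s. u \<otimes> (ns p ks \<otimes> rc 1 ks)) = u \<otimes> A s"
      unfolding A_def using rcc u d' fin by (intro finsum_rdistr[symmetric]) (auto simp del: One_nat_def)
    finally have "c [^] s \<otimes> (\<Oplus>ks\<in>index_chains p s. ns p ks \<otimes> d \<otimes> rc 1 ks)
      = c [^] s \<otimes> (u \<otimes> A s) \<oplus> c [^] s \<otimes> B s" using u by (simp add: r_distr)
    \<comment> \<open>Needs \<open>s \<ge> 1\<close>, because \<open>s - 1\<close> is truncated
      subtraction.\<close>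
    also have "c [^] s = c [^] (s - 1) \<otimes> c"
      using that by (metis One_nat_def Suc_pred' atLeastAtMost_iff less_eq_Suc_le nat_pow_Suc)
    also have "c [^] (s - 1) \<otimes> c \<otimes> (u \<otimes> A s) = c [^] (s - 1) \<otimes> A s"
      using u(1,2) by (simp add: m_assoc rewrite_assoc[OF u(2)])
    finally show ?thesis
      using \<open>c [^] s = c [^] (s - 1) \<otimes> c\<close> by simp
  qed
  define X Y where "X = (\<Oplus>s\<in>{1..p - 1}. c [^] (s - 1) \<otimes> A s)" and "Y = (\<Oplus>s\<in>{1..p - 1}. c [^] s \<otimes> B s)"
  have XY [simp]: "X \<in> carrier M" "Y \<in> carrier M"
    by (auto simp: X_def Y_def intro!: finsum_closed)
  have "(\<Oplus>s\<in>{1..p - 1}. c [^] s \<otimes> (\<Oplus>ks\<in>index_chains p s. ns p ks \<otimes> d \<otimes> rc 1 ks))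
      = (\<Oplus>s\<in>{1..p - 1}. c [^] (s - 1) \<otimes> A s \<oplus> c [^] s \<otimes> B s)"
    using s1 by (intro finsum_cong') (auto simp del: One_nat_def)
  also have "\<dots> = X \<oplus> Y"
    unfolding X_def Y_def by (intro finsum_addf) auto
  finally have "(u \<oplus> d') \<otimes> ns p [] = ns p [] \<otimes> (u \<oplus> d') \<oplus> (X \<oplus> Y)"
    using d_ns[OF assms(1)] d' by simp
  then have "u \<otimes> ns p [] \<oplus> d' \<otimes> ns p [] = u \<otimes> ns p [] \<oplus> (X \<oplus> (ns p [] \<otimes> d' \<oplus> Y))"
    using u d' u(3)[of "ns p []"] by (simp add: l_distr r_distr a_ac)
  then have "d' \<otimes> ns p [] = X \<oplus> (ns p [] \<otimes> d' \<oplus> Y)"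
    using u(1) d' r_neg1[of "u \<otimes> ns p []"] by (metis XY a_closed m_closed nsc)
  then show ?thesis by (simp only: X_def Y_def A_def B_def)
qed

end

section \<open>Operators in tensor factors\<close>

text \<open>\<open>matrix_inv\<close> is a choice of a two-sided inverse, and \<open>R\<close>
  itself is one. This eliminates the inverse of R from the relations and from the conjugated
  Ns.\<close>

lemma matrix_inv_involution:
  fixes R :: "'k::field ^ 'a::finite ^ 'a"
  assumes "R ** R = mat 1"
  shows "matrix_inv R = R"
proof -
  have "R ** matrix_inv R = mat 1 \<and> matrix_inv R ** R = mat 1"
    unfolding matrix_inv_def by (rule someI[of _ R]) (use assms in simp)
  then show ?thesis
    using assms by (metis matrix_mul_assoc matrix_mul_lid)
qed

definition pair_get :: "nat \<Rightarrow> 'n list \<Rightarrow> 'n \<times> 'n" where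
  "pair_get k I = (I ! (k - 1), I ! k)"

definition pair_put :: "nat \<Rightarrow> 'n list \<Rightarrow> 'n \<times> 'n \<Rightarrow> 'n list" where
  "pair_put k I a = I[k - 1 := fst a, k := snd a]"

definition triple_get :: "nat \<Rightarrow> 'n list \<Rightarrow> 'n \<times> 'n \<times> 'n" where
  "triple_get k I = (I ! (k - 1), I ! k, I ! Suc k)"

definition triple_put :: "nat \<Rightarrow> 'n list \<Rightarrow> 'n \<times> 'n \<times> 'n \<Rightarrow> 'n list" where
  "triple_put k I a = I[k - 1 := fst a, k := fst (snd a), Suc k := snd (snd a)]"

lemma site_pair: "1 \<le> k \<Longrightarrow> k < p \<Longrightarrow> site p (UNIV :: ('n::finite \<times> 'n) set) (pair_get k) (pair_put k)"
  by unfold_locales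
    (auto simp: pair_get_def pair_put_def multi_index_def list_eq_iff_nth_eq nth_list_update)

lemma site_triple:
  "1 \<le> k \<Longrightarrow> Suc k < p \<Longrightarrow> site p (UNIV :: ('n::finite \<times> 'n \<times> 'n) set) (triple_get k) (triple_put k)"
  by unfold_locales
    (auto simp: triple_get_def triple_put_def multi_index_def list_eq_iff_nth_eq nth_list_update)

lemma site_first: "1 \<le> p \<Longrightarrow> site p (UNIV :: 'n::finite set) hd (\<lambda>I x. x # tl I)"
  by unfold_locales (auto simp: multi_index_def neq_Nil_conv Suc_le_length_iff)

lemma site_block: "m \<le> p \<Longrightarrow> site p (multi_index m :: 'n::finite list set) (take m) (\<lambda>I L. L @ drop m I)"
  by unfold_locales (auto simp: multi_index_def finite_multi_index[unfolded multi_index_def])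

lemma in_first_local:
  fixes X :: "'n::finite \<Rightarrow> 'n \<Rightarrow> 's"
  assumes "1 \<le> p"
  shows "in_first S p X = local_mat S p hd (\<lambda>I x. x # tl I) X"
  unfolding in_first_def local_mat_def
proof (rule restrict_ext, clarify)
  fix I J :: "'n list" assume "I \<in> multi_index p" "J \<in> multi_index p"
  then have "(tl I = tl J) = (hd J # tl I = J)"
    using assms by (cases J) (auto simp: multi_index_def)
  then show "(if tl I = tl J then X (hd I) (hd J) else \<zero>\<^bsub>S\<^esub>) =
    (if hd J # tl I = J then X (hd I) (hd J) else \<zero>\<^bsub>S\<^esub>)" by simp
qed

lemma in_factors_local:
  fixes A :: "'k::field ^ ('n::finite \<times> 'n) ^ ('n \<times> 'n)"
  assumes "1 \<le> k" "k < p"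
  shows "in_factors S \<iota> p A k = local_mat S p (pair_get k) (pair_put k) (\<lambda>a b. \<iota> (A $ a $ b))"
  unfolding in_factors_def local_mat_def
proof (rule restrict_ext, clarify)
  fix I J :: "'n list" assume IJ: "I \<in> multi_index p" "J \<in> multi_index p"
  have "(\<forall>m<p. m \<noteq> k - 1 \<and> m \<noteq> k \<longrightarrow> I ! m = J ! m) = (pair_put k I (pair_get k J) = J)"
    using assms IJ
    by (auto simp: pair_get_def pair_put_def multi_index_def list_eq_iff_nth_eq nth_list_update)
  then show "(if \<forall>m<p. m \<noteq> k - 1 \<and> m \<noteq> k \<longrightarrow> I ! m = J ! m
        then \<iota> (A $ (I ! (k - 1), I ! k) $ (J ! (k - 1), J ! k)) else \<zero>\<^bsub>S\<^esub>) =
       (if pair_put k I (pair_get k J) = J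
        then \<iota> (A $ pair_get k I $ pair_get k J) else \<zero>\<^bsub>S\<^esub>)"
    by (simp add: pair_get_def)
qed

lemma triple_update_iff:
  assumes "I \<in> multi_index p" "J \<in> multi_index p" "1 \<le> k" "Suc k < p"
  shows "(triple_put k I (triple_get k J) = J) =
    (\<forall>m<p. m \<noteq> k - 1 \<and> m \<noteq> k \<and> m \<noteq> Suc k \<longrightarrow> I ! m = J ! m)"
  using assms
  by (auto simp: triple_get_def triple_put_def multi_index_def list_eq_iff_nth_eq nth_list_update)

text \<open>Seen on three adjacent letters, the operators in the factors k, k+1 and k+1, k+2 become
  \<open>on12 A\<close> and \<open>on23 A\<close>, so the braid relation assumed for R can be
  applied literally at any place of the tensor power.\<close>

lemma in_factors_triple:
  fixes A :: "'k::field ^ ('n::finite \<times> 'n) ^ ('n \<times> 'n)"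
  assumes "1 \<le> k" "Suc k < p" "\<iota> 0 = \<zero>\<^bsub>S\<^esub>"
  shows "in_factors S \<iota> p A k = local_mat S p (triple_get k) (triple_put k) (\<lambda>a b. \<iota> (on12 A $ a $ b))"
    and "in_factors S \<iota> p A (Suc k) = local_mat S p (triple_get k) (triple_put k) (\<lambda>a b. \<iota> (on23 A $ a $ b))"
proof -
  show "in_factors S \<iota> p A k = local_mat S p (triple_get k) (triple_put k) (\<lambda>a b. \<iota> (on12 A $ a $ b))"
    unfolding in_factors_def local_mat_def
  proof (rule restrict_ext, clarify)
    fix I J :: "'n list" assume IJ: "I \<in> multi_index p" "J \<in> multi_index p"
    have "(\<forall>m<p. m \<noteq> k - 1 \<and> m \<noteq> k \<longrightarrow> I ! m = J ! m)
        = (triple_put k I (triple_get k J) = J \<and> I ! Suc k = J ! Suc k)"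
      unfolding triple_update_iff[OF IJ assms(1,2)] using assms(2) by (auto; metis)
    then show "(if \<forall>m<p. m \<noteq> k - 1 \<and> m \<noteq> k \<longrightarrow> I ! m = J ! m
          then \<iota> (A $ (I ! (k - 1), I ! k) $ (J ! (k - 1), J ! k)) else \<zero>\<^bsub>S\<^esub>) =
         (if triple_put k I (triple_get k J) = J
          then \<iota> (on12 A $ triple_get k I $ triple_get k J) else \<zero>\<^bsub>S\<^esub>)"
      using assms(3) by (simp add: triple_get_def on12_def)
  qed
  show "in_factors S \<iota> p A (Suc k) = local_mat S p (triple_get k) (triple_put k) (\<lambda>a b. \<iota> (on23 A $ a $ b))"
    unfolding in_factors_def local_mat_def
  proof (rule restrict_ext, clarify)
    fix I J :: "'n list" assume IJ: "I \<in> multi_index p" "J \<in> multi_index p"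
    have "(\<forall>m<p. m \<noteq> Suc k - 1 \<and> m \<noteq> Suc k \<longrightarrow> I ! m = J ! m)
        = (triple_put k I (triple_get k J) = J \<and> I ! (k - 1) = J ! (k - 1))"
    proof -
      have "k - 1 < p" "k - 1 \<noteq> k" "k - 1 \<noteq> Suc k" "Suc k - 1 = k" using assms by auto
      then show ?thesis unfolding triple_update_iff[OF IJ assms(1,2)] by metis
    qed
    then show "(if \<forall>m<p. m \<noteq> Suc k - 1 \<and> m \<noteq> Suc k \<longrightarrow> I ! m = J ! m
          then \<iota> (A $ (I ! (Suc k - 1), I ! Suc k) $ (J ! (Suc k - 1), J ! Suc k)) else \<zero>\<^bsub>S\<^esub>) =
         (if triple_put k I (triple_get k J) = J
          then \<iota> (on23 A $ triple_get k I $ triple_get k J) else \<zero>\<^bsub>S\<^esub>)"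
      using assms(3) by (simp add: triple_get_def on23_def)
  qed
qed

section \<open>Coefficient algebras with central scalars\<close>

lemma ring_type_ring: "ring (type_ring :: 'a::ring_1 ring)"
proof (rule ringI)
  show "abelian_group (type_ring :: 'a ring)"
  proof (rule abelian_groupI)
    fix x :: 'a assume "x \<in> carrier type_ring"
    show "\<exists>y\<in>carrier type_ring. y \<oplus>\<^bsub>type_ring\<^esub> x = \<zero>\<^bsub>type_ring\<^esub>"
      by (rule bexI[of _ "- x"]) (simp_all add: type_ring_def)
  qed (simp_all add: type_ring_def algebra_simps)
  show "monoid (type_ring :: 'a ring)"
    by (rule monoidI) (simp_all add: type_ring_def algebra_simps)
qed (simp_all add: type_ring_def algebra_simps)

lemma type_ring_simps [simp]:
  "carrier type_ring = UNIV" "x \<otimes>\<^bsub>type_ring\<^esub> y = x * y" "x \<oplus>\<^bsub>type_ring\<^esub> y = x + y"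
  "\<one>\<^bsub>type_ring\<^esub> = 1" "\<zero>\<^bsub>type_ring\<^esub> = 0"
  by (simp_all add: type_ring_def)

locale kalg = tensor_ring S for S :: "('s, 'm) ring_scheme" (structure) +
  fixes \<iota> :: "'k::field \<Rightarrow> 's"
  assumes \<iota>_hom: "\<iota> \<in> ring_hom type_ring S"
    and \<iota>_central: "x \<in> carrier S \<Longrightarrow> \<iota> a \<otimes> x = x \<otimes> \<iota> a"
begin

lemma \<iota>_closed [simp]: "\<iota> a \<in> carrier S"
  using ring_hom_closed[OF \<iota>_hom] by simp

lemma \<iota>_add: "\<iota> (a + b) = \<iota> a \<oplus> \<iota> b"
  using ring_hom_add[OF \<iota>_hom, of a b] by simp

lemma \<iota>_mult: "\<iota> (a * b) = \<iota> a \<otimes> \<iota> b"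
  using ring_hom_mult[OF \<iota>_hom, of a b] by simp

lemma \<iota>_1 [simp]: "\<iota> 1 = \<one>"
  using ring_hom_one[OF \<iota>_hom] by simp

lemma \<iota>_0 [simp]: "\<iota> 0 = \<zero>"
  using \<iota>_add[of 0 0] by (metis \<iota>_closed add.l_cancel_one' add_0)

lemma \<iota>_sum: "finite A \<Longrightarrow> \<iota> (\<Sum>a\<in>A. f a) = (\<Oplus>a\<in>A. \<iota> (f a))"
proof (induction A rule: finite_induct)
  case (insert x F)
  then show ?case by (subst finsum_insert) (auto simp: \<iota>_add)
qed simp

lemma klocal_mult:
  fixes A B :: "'k ^ 'a::finite ^ 'a"
  assumes "site p (UNIV :: 'a set) get put"
  shows "local_mat S p get put (\<lambda>a b. \<iota> (A $ a $ b)) \<otimes>\<^bsub>M p\<^esub> local_mat S p get put (\<lambda>a b. \<iota> (B $ a $ b))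
    = local_mat S p get put (\<lambda>a b. \<iota> ((A ** B) $ a $ b))"
proof -
  interpret s: tensor_site S p UNIV get put by (intro tensor_site.intro assms) unfold_locales
  show ?thesis
    by (subst s.local_mult) (auto simp: matrix_matrix_mult_def \<iota>_sum \<iota>_mult)
qed

lemma in_factors_closed: "1 \<le> k \<Longrightarrow> k < p \<Longrightarrow> in_factors S \<iota> p A k \<in> carrier (M p)"
  unfolding in_factors_def by (rule mat_closed) auto

lemma in_first_closed: "(\<And>i j. X i j \<in> carrier S) \<Longrightarrow> in_first S p X \<in> carrier (M p)"
  unfolding in_first_def by (rule mat_closed) auto

lemma in_factors_invol:
  fixes R :: "'k ^ ('n::finite \<times> 'n) ^ ('n \<times> 'n)"
  assumes "1 \<le> k" "k < p" "R ** R = mat 1"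
  shows "in_factors S \<iota> p R k \<otimes>\<^bsub>M p\<^esub> in_factors S \<iota> p R k = \<one>\<^bsub>M p\<^esub>"
proof -
  interpret s: tensor_site S p UNIV "pair_get k" "pair_put k"
    by (intro tensor_site.intro site_pair assms) unfold_locales
  have "(\<lambda>a b. \<iota> ((mat 1 :: 'k ^ ('n \<times> 'n) ^ ('n \<times> 'n)) $ a $ b)) = (\<lambda>a b. if a = b then \<one> else \<zero>)"
    by (auto simp: mat_def fun_eq_iff)
  then show ?thesis
    using assms by (simp add: in_factors_local klocal_mult[OF site_pair] s.local_one)
qed

lemma in_factors_braid:
  assumes "1 \<le> k" "Suc k < p" "involutive_symmetry R"
  shows "in_factors S \<iota> p R k \<otimes>\<^bsub>M p\<^esub> (in_factors S \<iota> p R (Suc k) \<otimes>\<^bsub>M p\<^esub> in_factors S \<iota> p R k)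
   = in_factors S \<iota> p R (Suc k) \<otimes>\<^bsub>M p\<^esub> (in_factors S \<iota> p R k \<otimes>\<^bsub>M p\<^esub> in_factors S \<iota> p R (Suc k))"
  using assms(3) by (simp add: in_factors_triple[OF assms(1,2)] klocal_mult[OF site_triple[OF assms(1,2)]]
      involutive_symmetry_def matrix_mul_assoc)

lemma in_factors_far:
  assumes "1 \<le> k" "Suc k < l" "l < p"
  shows "in_factors S \<iota> p A k \<otimes>\<^bsub>M p\<^esub> in_factors S \<iota> p B l = in_factors S \<iota> p B l \<otimes>\<^bsub>M p\<^esub> in_factors S \<iota> p A k"
proof -
  have kl: "1 \<le> k" "k < p" "1 \<le> l" "l < p" using assms by auto
  have ne: "k - 1 \<noteq> l - 1" "k - 1 \<noteq> l" "k \<noteq> l - 1" "k \<noteq> l" using assms by auto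
  show ?thesis
    unfolding in_factors_local[OF kl(1,2)] in_factors_local[OF kl(3,4)]
  proof (rule local_commute[OF site_pair site_pair])
    show "pair_put l (pair_put k I a) b = pair_put k (pair_put l I b) a" if "I \<in> mi p" for I a b
      using ne kl that by (intro nth_equalityI) (auto simp: pair_put_def multi_index_def nth_list_update)
    show "\<And>I a. pair_get k (pair_put l I a) = pair_get k I" "\<And>I a. pair_get l (pair_put k I a) = pair_get l I"
      using ne by (auto simp: pair_get_def pair_put_def)
  qed (use kl in \<open>auto intro: \<iota>_central\<close>)
qed

lemma in_factors_first:
  fixes A :: "'k ^ ('n::finite \<times> 'n) ^ ('n \<times> 'n)"
  assumes "2 \<le> k" "k < p" "\<And>i j. X i j \<in> carrier S"
  shows "in_factors S \<iota> p A k \<otimes>\<^bsub>M p\<^esub> in_first S p X = in_first S p X \<otimes>\<^bsub>M p\<^esub> in_factors S \<iota> p A k"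
proof -
  have 1: "hd (pair_put k I a) = hd I" "tl (pair_put k I a) = pair_put (k - 1) (tl I) a"
    "pair_put k (x # tl I) a = x # pair_put (k - 1) (tl I) a"
    "pair_get k (x # tl I) = pair_get k I"
    if "I \<in> multi_index p" for I :: "'n list" and a x
    using assms that
    by (cases I; cases k; cases "k - 1"; auto simp: pair_get_def pair_put_def multi_index_def)+
  have "1 \<le> k" "1 \<le> p" using assms by auto
  then show ?thesis
    using assms
    by (simp add: in_factors_local in_first_local, intro local_commute[OF site_pair site_first])
      (auto simp: 1 \<iota>_central)
qed

abbreviation scal where "scal p a \<equiv> scale_mat S \<iota> p a (\<one>\<^bsub>M p\<^esub>)"

lemma scal_entry: "I \<in> mi p \<Longrightarrow> J \<in> mi p \<Longrightarrow> scal p a (I, J) = (if I = J then \<iota> a else \<zero>)"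
  by (simp add: scale_mat_def one_entry)

lemma scale_closed: "A \<in> carrier (M p) \<Longrightarrow> scale_mat S \<iota> p a A \<in> carrier (M p)"
  by (auto simp: scale_mat_def End_tensor_simps)

text \<open>Turns scaling into multiplication by a central element of the matrix ring, which is the
  role of \<open>c\<close> in \<open>braided_ring\<close>.\<close>

lemma scale_scal:
  fixes A :: "'n::finite list \<times> 'n list \<Rightarrow> 's"
  assumes A: "A \<in> carrier (M p)"
  shows "scale_mat S \<iota> p a A = scal p a \<otimes>\<^bsub>M p\<^esub> A" "scal p a \<otimes>\<^bsub>M p\<^esub> A = A \<otimes>\<^bsub>M p\<^esub> scal p a"
proof -
  have 1: "(scal p a \<otimes>\<^bsub>M p\<^esub> A) (I, J) = \<iota> a \<otimes> A (I, J)" if IJ: "I \<in> mi p" "J \<in> mi p" for I J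
  proof -
    have "(scal p a \<otimes>\<^bsub>M p\<^esub> A) (I, J) = (\<Oplus>L\<in>mi p. if L = I then \<iota> a \<otimes> A (L, J) else \<zero>)"
      unfolding mult_entry[OF IJ] by (rule finsum_cong') (use IJ A in \<open>auto simp: scal_entry\<close>)
    then show ?thesis using IJ A by (simp add: finsum_delta)
  qed
  have 2: "(A \<otimes>\<^bsub>M p\<^esub> scal p a) (I, J) = A (I, J) \<otimes> \<iota> a" if IJ: "I \<in> mi p" "J \<in> mi p" for I J
  proof -
    have "(A \<otimes>\<^bsub>M p\<^esub> scal p a) (I, J) = (\<Oplus>L\<in>mi p. if L = J then A (I, L) \<otimes> \<iota> a else \<zero>)"
      unfolding mult_entry[OF IJ] by (rule finsum_cong') (use IJ A in \<open>auto simp: scal_entry\<close>)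
    then show ?thesis using IJ A by (simp add: finsum_delta)
  qed
  show "scale_mat S \<iota> p a A = scal p a \<otimes>\<^bsub>M p\<^esub> A"
  proof (rule mat_eqI)
    fix I J :: "'n list" assume IJ: "I \<in> mi p" "J \<in> mi p"
    show "scale_mat S \<iota> p a A (I, J) = (scal p a \<otimes>\<^bsub>M p\<^esub> A) (I, J)"
      unfolding 1[OF IJ] using IJ by (simp add: scale_mat_def)
  qed (use A in \<open>auto intro!: scale_closed mult_closed one_closed'\<close>)
  show "scal p a \<otimes>\<^bsub>M p\<^esub> A = A \<otimes>\<^bsub>M p\<^esub> scal p a"
    by (rule mat_eqI) (use A 1 2 in \<open>auto intro!: scale_closed mult_closed one_closed' simp: \<iota>_central\<close>)
qed

lemma scal_mult:
  "(scal p (a * b) :: 'n::finite list \<times> 'n list \<Rightarrow> 's) = scal p a \<otimes>\<^bsub>M p\<^esub> scal p b"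
proof -
  have "(scal p (a * b) :: 'n list \<times> 'n list \<Rightarrow> 's) = scale_mat S \<iota> p a (scal p b)"
    unfolding scale_mat_def by (rule restrict_ext) (auto simp: \<iota>_mult one_entry)
  also have "\<dots> = scal p a \<otimes>\<^bsub>M p\<^esub> scal p b"
    by (rule scale_scal(1)) (simp add: scale_closed one_closed')
  finally show ?thesis .
qed

lemma scal_1: "scal p 1 = \<one>\<^bsub>M p\<^esub>"
  by (rule mat_eqI) (auto intro!: scale_closed one_closed' simp: scal_entry one_entry)

lemma scal_pow:
  "(scal p (a ^ l) :: 'n::finite list \<times> 'n list \<Rightarrow> 's) = scal p a [^]\<^bsub>M p\<^esub> (l::nat)"
proof (induction l)
  case 0
  show ?case by (simp only: power_0 scal_1 monoid.nat_pow_0[OF ring.is_monoid[OF ring_End_tensor]])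
next
  case (Suc l)
  show ?case
    by (simp only: power_Suc2 scal_mult Suc monoid.nat_pow_Suc[OF ring.is_monoid[OF ring_End_tensor]])
qed

text \<open>The operator \<open>A\<close> tensored with the identity on the factors after the
  second. The defining relations are given on two factors; this ring homomorphism transports them to
  any number of factors.\<close>

definition emb :: "nat \<Rightarrow> ('n::finite list \<times> 'n list \<Rightarrow> 's) \<Rightarrow> ('n list \<times> 'n list \<Rightarrow> 's)" where
  "emb p A = local_mat S p (take 2) (\<lambda>I L. L @ drop 2 I) (\<lambda>I J. A (I, J))"

lemma emb_closed: "2 \<le> p \<Longrightarrow> A \<in> carrier (M 2) \<Longrightarrow> emb p A \<in> carrier (M p)"
  unfolding emb_def
  by (intro tensor_site.local_closed[where Ix = "mi 2"] tensor_site.intro site_block) (auto, unfold_locales)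

lemma emb_mult:
  assumes "2 \<le> p" "A \<in> carrier (M 2)" "B \<in> carrier (M 2)"
  shows "emb p (A \<otimes>\<^bsub>M 2\<^esub> B) = emb p A \<otimes>\<^bsub>M p\<^esub> emb p B"
proof -
  interpret s: tensor_site S p "mi 2" "take 2" "\<lambda>I L. L @ drop 2 I"
    by (intro tensor_site.intro site_block assms) unfold_locales
  show ?thesis
    unfolding emb_def using assms by (subst s.local_mult) (auto simp: mult_entry intro!: s.local_cong)
qed

lemma emb_add:
  assumes "2 \<le> p" "A \<in> carrier (M 2)" "B \<in> carrier (M 2)"
  shows "emb p (A \<oplus>\<^bsub>M 2\<^esub> B) = emb p A \<oplus>\<^bsub>M p\<^esub> emb p B"
proof -
  interpret s: tensor_site S p "mi 2" "take 2" "\<lambda>I L. L @ drop 2 I"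
    by (intro tensor_site.intro site_block assms) unfold_locales
  show ?thesis
    unfolding emb_def using assms by (subst s.local_add) (auto simp: add_entry intro!: s.local_cong)
qed

lemma emb_scale:
  assumes "2 \<le> p" "A \<in> carrier (M 2)"
  shows "emb p (scale_mat S \<iota> 2 a A) = scale_mat S \<iota> p a (emb p A)"
  unfolding emb_def local_mat_def scale_mat_def using assms
  by (intro restrict_ext) (auto simp: multi_index_def)

lemma emb_first:
  fixes X :: "'n::finite \<Rightarrow> 'n \<Rightarrow> 's"
  shows "2 \<le> p \<Longrightarrow> emb p (in_first S 2 X) = in_first S p X"
  unfolding emb_def local_mat_def in_first_def
proof (intro restrict_ext, clarify)
  fix I J :: "'n list" assume p: "2 \<le> p" and IJ: "I \<in> multi_index p" "J \<in> multi_index p"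
  obtain a b I' c d J' where "I = a # b # I'" "J = c # d # J'" "length I' = length J'"
    using p IJ by (cases I; cases J; cases "tl I"; cases "tl J") (auto simp: multi_index_def)
  then show "(if take 2 J @ drop 2 I = J
     then (\<lambda>(I, J)\<in>multi_index 2 \<times> multi_index 2. if tl I = tl J then X (hd I) (hd J) else \<zero>) (take 2 I, take 2 J)
     else \<zero>) = (if tl I = tl J then X (hd I) (hd J) else \<zero>)"
    by (auto simp: multi_index_def)
qed

lemma emb_factors:
  fixes A :: "'k ^ ('n::finite \<times> 'n) ^ ('n \<times> 'n)"
  assumes p: "2 \<le> p"
  shows "emb p (in_factors S \<iota> 2 A 1) = in_factors S \<iota> p A 1"
proof -
  have e: "in_factors S \<iota> p A 1 = local_mat S p (pair_get 1) (pair_put 1) (\<lambda>a b. \<iota> (A $ a $ b))"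
    "in_factors S \<iota> 2 A 1 = local_mat S 2 (pair_get 1) (pair_put 1) (\<lambda>a b. \<iota> (A $ a $ b))"
    by (rule in_factors_local; use p in simp)+
  show ?thesis
    unfolding emb_def e local_mat_def
  proof (intro restrict_ext, clarify)
    fix I J :: "'n list" assume IJ: "I \<in> multi_index p" "J \<in> multi_index p"
    obtain a b I' c d J' where "I = a # b # I'" "J = c # d # J'" "length I' = length J'"
      using p IJ by (cases I; cases J; cases "tl I"; cases "tl J") (auto simp: multi_index_def)
    then show "(if take 2 J @ drop 2 I = J then
         (\<lambda>(I, J)\<in>multi_index 2 \<times> multi_index 2.
           if pair_put 1 I (pair_get 1 J) = J then \<iota> (A $ pair_get 1 I $ pair_get 1 J) else \<zero>)
          (take 2 I, take 2 J) else \<zero>) =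
       (if pair_put 1 I (pair_get 1 J) = J then \<iota> (A $ pair_get 1 I $ pair_get 1 J) else \<zero>)"
      by (auto simp: multi_index_def pair_get_def pair_put_def)
  qed
qed

end

section \<open>The defining relations\<close>

text \<open>Because \<open>c u\<close> is the unit, the inhomogeneous term \<open>r\<close> is the
  contribution of \<open>u\<close> to \<open>c (u + d') r\<close>; in the commutator the central
  \<open>u\<close> cancels.\<close>

lemma (in ring) unshift_relation:
  assumes cl [simp]: "c \<in> carrier R" "u \<in> carrier R" "d' \<in> carrier R" "r \<in> carrier R" "x \<in> carrier R"
    and cu: "c \<otimes> u = \<one>" and u: "u \<otimes> x = x \<otimes> u"
  shows "(d' \<otimes> x \<ominus> x \<otimes> d') \<ominus> (r \<oplus> c \<otimes> (d' \<otimes> r))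
    = ((u \<oplus> d') \<otimes> x \<ominus> x \<otimes> (u \<oplus> d')) \<ominus> c \<otimes> ((u \<oplus> d') \<otimes> r)"
proof -
  have 1: "c \<otimes> ((u \<oplus> d') \<otimes> r) = r \<oplus> c \<otimes> (d' \<otimes> r)"
    by (simp add: l_distr r_distr rewrite_assoc[OF cu])
  have "(u \<oplus> d') \<otimes> x \<ominus> x \<otimes> (u \<oplus> d') = (d' \<otimes> x \<ominus> x \<otimes> d') \<oplus> (u \<otimes> x \<oplus> \<ominus> (x \<otimes> u))"
    by (simp add: l_distr r_distr minus_eq minus_add a_ac)
  also have "\<dots> = d' \<otimes> x \<ominus> x \<otimes> d'" by (simp add: u r_neg)
  finally show ?thesis by (simp add: 1)
qed

text \<open>With \<open>u\<close> central and \<open>r\<close> an involution, the terms containing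
  \<open>u\<close> are the same in both products, namely \<open>e\<close>, and drop out of the
  difference.\<close>

lemma (in ring) unshift_square:
  assumes cl [simp]: "u \<in> carrier R" "d' \<in> carrier R" "r \<in> carrier R"
    and r: "r \<otimes> r = \<one>" and u: "\<And>x. x \<in> carrier R \<Longrightarrow> u \<otimes> x = x \<otimes> u"
  defines "d \<equiv> u \<oplus> d'"
  shows "r \<otimes> d' \<otimes> r \<otimes> d' \<ominus> d' \<otimes> r \<otimes> d' \<otimes> r = r \<otimes> d \<otimes> r \<otimes> d \<ominus> d \<otimes> r \<otimes> d \<otimes> r"
proof -
  note rr = rewrite_assoc[OF r]
  have ul: "x \<otimes> (u \<otimes> y) = u \<otimes> (x \<otimes> y)" if "x \<in> carrier R" "y \<in> carrier R" for x y
    using that u[of x] by (simp flip: m_assoc)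
  have u1: "u \<otimes> d' = d' \<otimes> u" "u \<otimes> r = r \<otimes> u" by (simp_all add: u)
  define e where "e = u \<otimes> u \<oplus> (u \<otimes> d' \<oplus> u \<otimes> (r \<otimes> (d' \<otimes> r)))"
  have e: "e \<in> carrier R" by (simp add: e_def)
  have 1: "r \<otimes> d \<otimes> r \<otimes> d = r \<otimes> d' \<otimes> r \<otimes> d' \<oplus> e"
    by (simp add: d_def e_def l_distr r_distr m_assoc ul[of r] ul[of d'] rr r a_ac flip: u1)
  have 2: "d \<otimes> r \<otimes> d \<otimes> r = d' \<otimes> r \<otimes> d' \<otimes> r \<oplus> e"
    by (simp add: d_def e_def l_distr r_distr m_assoc ul[of r] ul[of d'] rr r a_ac flip: u1)
  have "r \<otimes> d \<otimes> r \<otimes> d \<ominus> d \<otimes> r \<otimes> d \<otimes> r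
      = (r \<otimes> d' \<otimes> r \<otimes> d' \<ominus> d' \<otimes> r \<otimes> d' \<otimes> r) \<oplus> (e \<oplus> \<ominus> e)"
    unfolding 1 2 using e by (simp add: minus_eq minus_add a_ac)
  then show ?thesis using e by (simp add: r_neg)
qed

text \<open>The three relations are written for an arbitrary coefficient algebra and any number of
  factors, so that they can be mapped along algebra homomorphisms and along \<open>emb\<close>. The
  inverse of R is replaced by R throughout.\<close>

definition N_relation :: "('s, 'm) ring_scheme \<Rightarrow> ('k::field \<Rightarrow> 's) \<Rightarrow> nat \<Rightarrow> 'k ^ ('n::finite \<times> 'n) ^ ('n \<times> 'n)
    \<Rightarrow> 'k \<Rightarrow> ('n \<Rightarrow> 'n \<Rightarrow> 's) \<Rightarrow> ('n list \<times> 'n list \<Rightarrow> 's)" where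
  "N_relation S \<iota> p R h X =
    (let M = End_tensor S p; r = in_factors S \<iota> p R 1; N = in_first S p X in
     (r \<otimes>\<^bsub>M\<^esub> N \<otimes>\<^bsub>M\<^esub> r \<otimes>\<^bsub>M\<^esub> N \<ominus>\<^bsub>M\<^esub> N \<otimes>\<^bsub>M\<^esub> r \<otimes>\<^bsub>M\<^esub> N \<otimes>\<^bsub>M\<^esub> r)
       \<ominus>\<^bsub>M\<^esub> scale_mat S \<iota> p h (r \<otimes>\<^bsub>M\<^esub> N \<ominus>\<^bsub>M\<^esub> N \<otimes>\<^bsub>M\<^esub> r))"

definition D_relation :: "('s, 'm) ring_scheme \<Rightarrow> ('k::field \<Rightarrow> 's) \<Rightarrow> nat \<Rightarrow> 'k ^ ('n::finite \<times> 'n) ^ ('n \<times> 'n)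
    \<Rightarrow> ('n \<Rightarrow> 'n \<Rightarrow> 's) \<Rightarrow> ('n list \<times> 'n list \<Rightarrow> 's)" where
  "D_relation S \<iota> p R X =
    (let M = End_tensor S p; r = in_factors S \<iota> p R 1; D = in_first S p X in
     r \<otimes>\<^bsub>M\<^esub> D \<otimes>\<^bsub>M\<^esub> r \<otimes>\<^bsub>M\<^esub> D \<ominus>\<^bsub>M\<^esub> D \<otimes>\<^bsub>M\<^esub> r \<otimes>\<^bsub>M\<^esub> D \<otimes>\<^bsub>M\<^esub> r)"

definition ND_relation :: "('s, 'm) ring_scheme \<Rightarrow> ('k::field \<Rightarrow> 's) \<Rightarrow> nat \<Rightarrow> 'k ^ ('n::finite \<times> 'n) ^ ('n \<times> 'n)
    \<Rightarrow> 'k \<Rightarrow> ('n \<Rightarrow> 'n \<Rightarrow> 's) \<Rightarrow> ('n \<Rightarrow> 'n \<Rightarrow> 's) \<Rightarrow> ('n list \<times> 'n list \<Rightarrow> 's)" where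
  "ND_relation S \<iota> p R h X Y =
    (let M = End_tensor S p; r = in_factors S \<iota> p R 1; N = in_first S p X; D = in_first S p Y in
     (D \<otimes>\<^bsub>M\<^esub> r \<otimes>\<^bsub>M\<^esub> N \<otimes>\<^bsub>M\<^esub> r \<ominus>\<^bsub>M\<^esub> r \<otimes>\<^bsub>M\<^esub> N \<otimes>\<^bsub>M\<^esub> r \<otimes>\<^bsub>M\<^esub> D)
       \<ominus>\<^bsub>M\<^esub> (r \<oplus>\<^bsub>M\<^esub> scale_mat S \<iota> p h (D \<otimes>\<^bsub>M\<^esub> r)))"

lemma weyl_relations_eq:
  assumes "R ** R = mat 1"
  shows "weyl_relations R h = (\<Union>rel\<in>{N_relation free_algebra free_scalar 2 R h (\<lambda>i j. free_gen (Gen_N i j)),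
      D_relation free_algebra free_scalar 2 R (\<lambda>i j. free_gen (Gen_D i j)),
      ND_relation free_algebra free_scalar 2 R h (\<lambda>i j. free_gen (Gen_N i j)) (\<lambda>i j. free_gen (Gen_D i j))}.
    rel ` (multi_index 2 \<times> multi_index 2))"
  by (simp add: weyl_relations_def Let_def N_relation_def D_relation_def ND_relation_def
      matrix_inv_involution[OF assms])

lemma (in ring_hom_ring) hom_a_minus:
  "x \<in> carrier R \<Longrightarrow> y \<in> carrier R \<Longrightarrow> h (x \<ominus> y) = h x \<ominus>\<^bsub>S\<^esub> h y"
  by (simp add: a_minus_def)

lemma map_mat_first:
  "f \<zero>\<^bsub>S\<^esub> = \<zero>\<^bsub>S'\<^esub> \<Longrightarrow> map_mat p f (in_first S p X) = in_first S' p (\<lambda>i j. f (X i j))"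
  unfolding map_mat_def in_first_def by (intro restrict_ext) auto

lemma map_mat_factors:
  "f \<zero>\<^bsub>S\<^esub> = \<zero>\<^bsub>S'\<^esub> \<Longrightarrow> map_mat p f (in_factors S \<iota> p A k) = in_factors S' (\<lambda>a. f (\<iota> a)) p A k"
  unfolding map_mat_def in_factors_def by (intro restrict_ext) auto

lemma map_mat_entry: "I \<in> multi_index p \<Longrightarrow> J \<in> multi_index p \<Longrightarrow> map_mat p f A (I, J) = f (A (I, J))"
  by (simp add: map_mat_def)

context kalg
begin

lemma emb_hom:
  assumes "2 \<le> p"
  shows "emb p \<in> ring_hom (M 2) (M p :: ('n::finite list \<times> 'n list \<Rightarrow> 's) ring)"
proof (rule ring_hom_memI)
  interpret s: tensor_site S p "mi 2 :: 'n list set" "take 2" "\<lambda>I L. L @ drop 2 I"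
    by (intro tensor_site.intro site_block assms) unfold_locales
  have "emb p \<one>\<^bsub>M 2\<^esub> = s.loc (\<lambda>a b. if a = b then \<one> else \<zero>)"
    unfolding emb_def by (rule s.local_cong) (simp add: one_entry)
  then show "emb p \<one>\<^bsub>M 2\<^esub> = (\<one>\<^bsub>M p\<^esub> :: 'n list \<times> 'n list \<Rightarrow> 's)"
    by (simp only: s.local_one)
qed (auto simp: emb_closed emb_mult emb_add assms)

lemma emb_hom_ring: "2 \<le> p \<Longrightarrow> ring_hom_ring (M 2) (M p) (emb p)"
  by (intro ring_hom_ringI2 ring_End_tensor emb_hom)

lemma emb_N_relation:
  fixes R :: "'k ^ ('n::finite \<times> 'n) ^ ('n \<times> 'n)"
  assumes p: "2 \<le> p" and X: "\<And>i j. X i j \<in> carrier S"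
  shows "emb p (N_relation S \<iota> 2 R h X) = N_relation S \<iota> p R h X"
proof -
  interpret E: ring_hom_ring "M 2" "M p" "emb p :: ('n list \<times> 'n list \<Rightarrow> 's) \<Rightarrow> _" by (rule emb_hom_ring[OF p])
  have c: "in_factors S \<iota> 2 R 1 \<in> carrier (M 2)" "in_first S 2 X \<in> carrier (M 2)"
    using X by (auto intro: in_factors_closed in_first_closed)
  show ?thesis
    using c by (simp add: N_relation_def Let_def E.hom_a_minus emb_scale[OF p] emb_first[OF p] emb_factors[OF p] scale_closed
        del: One_nat_def)
qed

lemma emb_D_relation:
  fixes R :: "'k ^ ('n::finite \<times> 'n) ^ ('n \<times> 'n)"
  assumes p: "2 \<le> p" and X: "\<And>i j. X i j \<in> carrier S"
  shows "emb p (D_relation S \<iota> 2 R X) = D_relation S \<iota> p R X"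
proof -
  interpret E: ring_hom_ring "M 2" "M p" "emb p :: ('n list \<times> 'n list \<Rightarrow> 's) \<Rightarrow> _" by (rule emb_hom_ring[OF p])
  have c: "in_factors S \<iota> 2 R 1 \<in> carrier (M 2)" "in_first S 2 X \<in> carrier (M 2)"
    using X by (auto intro: in_factors_closed in_first_closed)
  show ?thesis
    using c by (simp add: D_relation_def Let_def E.hom_a_minus emb_first[OF p] emb_factors[OF p] del: One_nat_def)
qed

lemma relations_closed:
  assumes "2 \<le> p" "\<And>i j. X i j \<in> carrier S" "\<And>i j. Y i j \<in> carrier S"
  shows "N_relation S \<iota> p R h X \<in> carrier (M p)" "D_relation S \<iota> p R X \<in> carrier (M p)"
    "ND_relation S \<iota> p R h X Y \<in> carrier (M p)"
proof -
  interpret E: ring "M p" by (rule ring_End_tensor)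
  have c: "in_factors S \<iota> p R 1 \<in> carrier (M p)" "in_first S p X \<in> carrier (M p)" "in_first S p Y \<in> carrier (M p)"
    using assms by (auto intro: in_factors_closed in_first_closed)
  then show "N_relation S \<iota> p R h X \<in> carrier (M p)" "D_relation S \<iota> p R X \<in> carrier (M p)"
    "ND_relation S \<iota> p R h X Y \<in> carrier (M p)"
    by (simp_all add: N_relation_def D_relation_def ND_relation_def Let_def scale_closed del: One_nat_def)
qed

end

locale kalg_hom = A: kalg S \<iota> + B: kalg S' \<iota>'
  for S :: "('s, 'm) ring_scheme" and \<iota> :: "'k::field \<Rightarrow> 's"
    and S' :: "('t, 'l) ring_scheme" and \<iota>' :: "'k \<Rightarrow> 't" +
  fixes f
  assumes hom: "f \<in> ring_hom S S'" and scalar: "f (\<iota> a) = \<iota>' a"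
begin

sublocale f: ring_hom_ring S S' f
  by (intro ring_hom_ringI2 hom A.ring_axioms B.ring_axioms)

lemma map_scale:
  assumes "A \<in> carrier (End_tensor S p)"
  shows "map_mat p f (scale_mat S \<iota> p a A) = scale_mat S' \<iota>' p a (map_mat p f A)"
  unfolding map_mat_def scale_mat_def using assms A.entry_closed
  by (intro restrict_ext) (auto simp: scalar)

lemma map_relations:
  fixes R :: "'k ^ ('n::finite \<times> 'n) ^ ('n \<times> 'n)"
  assumes p: "2 \<le> p" and X: "\<And>i j. X i j \<in> carrier S" "\<And>i j. Y i j \<in> carrier S"
  shows "map_mat p f (N_relation S \<iota> p R h X) = N_relation S' \<iota>' p R h (\<lambda>i j. f (X i j))"
    "map_mat p f (D_relation S \<iota> p R X) = D_relation S' \<iota>' p R (\<lambda>i j. f (X i j))"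
    "map_mat p f (ND_relation S \<iota> p R h X Y) = ND_relation S' \<iota>' p R h (\<lambda>i j. f (X i j)) (\<lambda>i j. f (Y i j))"
proof -
  interpret E: ring_hom_ring "End_tensor S p" "End_tensor S' p" "map_mat p f :: ('n list \<times> 'n list \<Rightarrow> 's) \<Rightarrow> _"
    by (intro ring_hom_ringI2 A.ring_End_tensor B.ring_End_tensor f.map_mat_hom)
  have c: "in_factors S \<iota> p R 1 \<in> carrier (End_tensor S p)" "in_first S p X \<in> carrier (End_tensor S p)"
    "in_first S p Y \<in> carrier (End_tensor S p)"
    using X p by (auto intro: A.in_factors_closed A.in_first_closed)
  show "map_mat p f (N_relation S \<iota> p R h X) = N_relation S' \<iota>' p R h (\<lambda>i j. f (X i j))"
    "map_mat p f (D_relation S \<iota> p R X) = D_relation S' \<iota>' p R (\<lambda>i j. f (X i j))"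
    "map_mat p f (ND_relation S \<iota> p R h X Y) = ND_relation S' \<iota>' p R h (\<lambda>i j. f (X i j)) (\<lambda>i j. f (Y i j))"
    using c by (simp_all add: N_relation_def D_relation_def ND_relation_def Let_def E.hom_a_minus map_scale A.scale_closed
        map_mat_first[where S = S and S' = S' and f = f] map_mat_factors[where S = S and S' = S' and f = f] scalar del: One_nat_def)
qed

end

lemma (in ring) minus_eq_iff:
  assumes "x \<in> carrier R" "y \<in> carrier R" "z \<in> carrier R"
  shows "(x \<ominus> y) \<ominus> z = \<zero> \<longleftrightarrow> x = y \<oplus> z"
proof -
  have "(x \<ominus> y) \<ominus> z = x \<ominus> (y \<oplus> z)"
    using assms by (simp add: minus_eq minus_add a_ac)
  then show ?thesis using assms by simp
qed

locale braided_data = kalg S \<iota> for S :: "('s, 'm) ring_scheme" (structure) and \<iota> :: "'k::field \<Rightarrow> 's" +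
  fixes R :: "'k ^ ('n::finite \<times> 'n) ^ ('n \<times> 'n)" and h :: 'k and N D :: "'n \<Rightarrow> 'n \<Rightarrow> 's"
  assumes inv: "involutive_symmetry R" and h: "h \<noteq> 0"
    and N_closed [simp]: "N i j \<in> carrier S" and D_closed [simp]: "D i j \<in> carrier S"
begin

definition D' :: "'n \<Rightarrow> 'n \<Rightarrow> 's" where
  "D' i j = \<iota> (if i = j then inverse h else 0) \<oplus> D i j"

abbreviation r where "r p \<equiv> in_factors S \<iota> p R"
abbreviation N\<^sub>1 where "N\<^sub>1 p \<equiv> in_first S p N"
abbreviation D\<^sub>1 where "D\<^sub>1 p \<equiv> in_first S p D"
abbreviation D'\<^sub>1 where "D'\<^sub>1 p \<equiv> in_first S p D'"

lemma RR: "R ** R = mat 1"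
  using inv by (simp add: involutive_symmetry_def)

lemma D'_closed [simp]: "D' i j \<in> carrier S"
  by (simp add: D'_def)

lemma D'1_eq: "1 \<le> p \<Longrightarrow> D'\<^sub>1 p = scal p (inverse h) \<oplus>\<^bsub>M p\<^esub> D\<^sub>1 p"
proof (rule mat_eqI)
  fix I J :: "'n list" assume p: "1 \<le> p" and IJ: "I \<in> mi p" "J \<in> mi p"
  have "I = J \<longleftrightarrow> tl I = tl J \<and> hd I = hd J"
    using p IJ by (cases I; cases J) (auto simp: multi_index_def)
  then show "D'\<^sub>1 p (I, J) = (scal p (inverse h) \<oplus>\<^bsub>M p\<^esub> D\<^sub>1 p) (I, J)"
    using IJ by (auto simp: add_entry scal_entry in_first_def D'_def)
qed (auto intro!: in_first_closed add_closed scale_closed one_closed')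

lemma ND_relation_iff:
  "ND_relation S \<iota> 2 R h N D = \<zero>\<^bsub>M 2\<^esub> \<longleftrightarrow>
    D'\<^sub>1 2 \<otimes>\<^bsub>M 2\<^esub> (r 2 1 \<otimes>\<^bsub>M 2\<^esub> N\<^sub>1 2 \<otimes>\<^bsub>M 2\<^esub> r 2 1)
    = (r 2 1 \<otimes>\<^bsub>M 2\<^esub> N\<^sub>1 2 \<otimes>\<^bsub>M 2\<^esub> r 2 1) \<otimes>\<^bsub>M 2\<^esub> D'\<^sub>1 2 \<oplus>\<^bsub>M 2\<^esub> scale_mat S \<iota> 2 h (D'\<^sub>1 2 \<otimes>\<^bsub>M 2\<^esub> r 2 1)"
proof -
  interpret E: ring "M 2 :: ('n list \<times> 'n list \<Rightarrow> 's) ring" by (rule ring_End_tensor)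
  have c: "r 2 1 \<in> carrier (M 2)" "N\<^sub>1 2 \<in> carrier (M 2)" "D\<^sub>1 2 \<in> carrier (M 2)" "D'\<^sub>1 2 \<in> carrier (M 2)"
    "(scal 2 h :: 'n list \<times> 'n list \<Rightarrow> 's) \<in> carrier (M 2)" "(scal 2 (inverse h) :: 'n list \<times> 'n list \<Rightarrow> 's) \<in> carrier (M 2)"
    by (auto intro!: in_factors_closed in_first_closed scale_closed one_closed')
  have cu: "(scal 2 h \<otimes>\<^bsub>M 2\<^esub> scal 2 (inverse h) :: 'n list \<times> 'n list \<Rightarrow> 's) = \<one>\<^bsub>M 2\<^esub>"
    using h by (simp flip: scal_mult add: scal_1)
  let ?x = "r 2 1 \<otimes>\<^bsub>M 2\<^esub> N\<^sub>1 2 \<otimes>\<^bsub>M 2\<^esub> r 2 1"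
  have x: "?x \<in> carrier (M 2)" using c by (auto intro!: mult_closed)
  have "ND_relation S \<iota> 2 R h N D
    = (D\<^sub>1 2 \<otimes>\<^bsub>M 2\<^esub> ?x \<ominus>\<^bsub>M 2\<^esub> ?x \<otimes>\<^bsub>M 2\<^esub> D\<^sub>1 2) \<ominus>\<^bsub>M 2\<^esub> (r 2 1 \<oplus>\<^bsub>M 2\<^esub> scal 2 h \<otimes>\<^bsub>M 2\<^esub> (D\<^sub>1 2 \<otimes>\<^bsub>M 2\<^esub> r 2 1))"
    using c scale_scal(1)[of "D\<^sub>1 2 \<otimes>\<^bsub>M 2\<^esub> r 2 1" 2 h] by (simp add: ND_relation_def Let_def E.m_assoc del: One_nat_def)
  also have "\<dots> = (D'\<^sub>1 2 \<otimes>\<^bsub>M 2\<^esub> ?x \<ominus>\<^bsub>M 2\<^esub> ?x \<otimes>\<^bsub>M 2\<^esub> D'\<^sub>1 2) \<ominus>\<^bsub>M 2\<^esub> scal 2 h \<otimes>\<^bsub>M 2\<^esub> (D'\<^sub>1 2 \<otimes>\<^bsub>M 2\<^esub> r 2 1)"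
    using E.unshift_relation[OF c(5,6,3,1) x cu scale_scal(2)[OF x]] by (simp add: D'1_eq)
  finally have 1: "ND_relation S \<iota> 2 R h N D = \<dots>" .
  have 2: "\<dots> = \<zero>\<^bsub>M 2\<^esub> \<longleftrightarrow> D'\<^sub>1 2 \<otimes>\<^bsub>M 2\<^esub> ?x = ?x \<otimes>\<^bsub>M 2\<^esub> D'\<^sub>1 2 \<oplus>\<^bsub>M 2\<^esub> scal 2 h \<otimes>\<^bsub>M 2\<^esub> (D'\<^sub>1 2 \<otimes>\<^bsub>M 2\<^esub> r 2 1)"
    using c x by (intro E.minus_eq_iff) auto
  have 3: "scale_mat S \<iota> 2 h (D'\<^sub>1 2 \<otimes>\<^bsub>M 2\<^esub> r 2 1) = scal 2 h \<otimes>\<^bsub>M 2\<^esub> (D'\<^sub>1 2 \<otimes>\<^bsub>M 2\<^esub> r 2 1)"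
    using c by (intro scale_scal(1)) auto
  show ?thesis unfolding 1 2 3 by simp
qed

text \<open>Allows switching between D, which kills the vector 1 of the model, and D', which passes
  the Ns homogeneously.\<close>

lemma D_relation_shift:
  assumes "2 \<le> p"
  shows "D_relation S \<iota> p R D = D_relation S \<iota> p R D'"
proof -
  interpret E: ring "M p :: ('n list \<times> 'n list \<Rightarrow> 's) ring" by (rule ring_End_tensor)
  have c: "(scal p (inverse h) :: 'n list \<times> 'n list \<Rightarrow> 's) \<in> carrier (M p)" "D\<^sub>1 p \<in> carrier (M p)" "r p 1 \<in> carrier (M p)"
    using assms by (auto intro!: in_factors_closed in_first_closed scale_closed one_closed')
  show ?thesis
    using E.unshift_square[OF c in_factors_invol[OF _ _ RR] scale_scal(2)] assms
    by (simp add: D_relation_def Let_def D'1_eq del: One_nat_def)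
qed

end

text \<open>Has two instances, the operators on the free algebra and the Weyl algebra. In the former
  the relation among the Ns is available only modulo \<open>N_ideal\<close>, so the commutation
  calculus is based on the third relation.\<close>

locale braided_system = braided_data S \<iota> R h N D
  for S :: "('s, 'm) ring_scheme" (structure) and \<iota> :: "'k::field \<Rightarrow> 's"
    and R :: "'k ^ ('n::finite \<times> 'n) ^ ('n \<times> 'n)" and h N D +
  assumes ND: "ND_relation S \<iota> 2 R h N D = \<zero>\<^bsub>M 2\<^esub>"
begin

lemma shifted_relation:
  assumes "2 \<le> p"
  shows "D'\<^sub>1 p \<otimes>\<^bsub>M p\<^esub> (r p 1 \<otimes>\<^bsub>M p\<^esub> N\<^sub>1 p \<otimes>\<^bsub>M p\<^esub> r p 1)
    = (r p 1 \<otimes>\<^bsub>M p\<^esub> N\<^sub>1 p \<otimes>\<^bsub>M p\<^esub> r p 1) \<otimes>\<^bsub>M p\<^esub> D'\<^sub>1 p \<oplus>\<^bsub>M p\<^esub> scal p h \<otimes>\<^bsub>M p\<^esub> (D'\<^sub>1 p \<otimes>\<^bsub>M p\<^esub> r p 1)"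
proof -
  have c: "r 2 1 \<in> carrier (M 2)" "N\<^sub>1 2 \<in> carrier (M 2)" "D\<^sub>1 2 \<in> carrier (M 2)" "D'\<^sub>1 2 \<in> carrier (M 2)"
    by (auto intro!: in_factors_closed in_first_closed)
  let ?x = "r 2 1 \<otimes>\<^bsub>M 2\<^esub> N\<^sub>1 2 \<otimes>\<^bsub>M 2\<^esub> r 2 1"
  have x: "?x \<in> carrier (M 2)" using c by (auto intro!: mult_closed)
  note 2 = ND[unfolded ND_relation_iff]
  interpret F: ring_hom_ring "M 2" "M p" "emb p :: ('n list \<times> 'n list \<Rightarrow> 's) \<Rightarrow> _" by (rule emb_hom_ring[OF assms])
  have "D'\<^sub>1 p \<otimes>\<^bsub>M p\<^esub> (r p 1 \<otimes>\<^bsub>M p\<^esub> N\<^sub>1 p \<otimes>\<^bsub>M p\<^esub> r p 1)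
    = (r p 1 \<otimes>\<^bsub>M p\<^esub> N\<^sub>1 p \<otimes>\<^bsub>M p\<^esub> r p 1) \<otimes>\<^bsub>M p\<^esub> D'\<^sub>1 p \<oplus>\<^bsub>M p\<^esub> scale_mat S \<iota> p h (D'\<^sub>1 p \<otimes>\<^bsub>M p\<^esub> r p 1)"
    using arg_cong[OF 2, of "emb p"] c x assms
    by (simp add: scale_closed emb_scale emb_first emb_factors del: One_nat_def)
  moreover have "D'\<^sub>1 p \<otimes>\<^bsub>M p\<^esub> r p 1 \<in> carrier (M p)"
    using assms by (auto intro!: mult_closed in_factors_closed in_first_closed)
  ultimately show ?thesis using scale_scal(1) by metis
qed

lemma braided_ring:
  assumes "1 \<le> p"
  shows "braided_ring (M p) p (r p) (N\<^sub>1 p) (D'\<^sub>1 p) (scal p h)"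
proof (rule braided_ring.intro[OF ring_End_tensor], unfold_locales)
  show "2 \<le> p \<Longrightarrow> D'\<^sub>1 p \<otimes>\<^bsub>M p\<^esub> (r p 1 \<otimes>\<^bsub>M p\<^esub> N\<^sub>1 p \<otimes>\<^bsub>M p\<^esub> r p 1)
    = (r p 1 \<otimes>\<^bsub>M p\<^esub> N\<^sub>1 p \<otimes>\<^bsub>M p\<^esub> r p 1) \<otimes>\<^bsub>M p\<^esub> D'\<^sub>1 p \<oplus>\<^bsub>M p\<^esub> scal p h \<otimes>\<^bsub>M p\<^esub> (D'\<^sub>1 p \<otimes>\<^bsub>M p\<^esub> r p 1)"
    by (rule shifted_relation)
qed (auto intro!: in_factors_closed in_first_closed scale_closed one_closed' in_factors_braid[OF _ _ inv]
     in_factors_invol[OF _ _ RR] in_factors_first in_factors_far scale_scal(2))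

lemma bar_nb:
  assumes "1 \<le> p" "1 \<le> k" "k \<le> p"
  shows "bar S \<iota> p R N k = braided_ring.nb (M p) (r p) (N\<^sub>1 p) k"
proof -
  interpret E: braided_ring "M p" p "r p" "N\<^sub>1 p" "D'\<^sub>1 p" "scal p h" by (rule braided_ring[OF assms(1)])
  note inv_R = matrix_inv_involution[OF RR]
  show ?thesis
    using assms(2,3)
  proof (induction k rule: dec_induct)
    case base
    show ?case by (simp add: bar_def E.nb.simps)
  next
    case (step k)
    let ?l = "map (r p) (rev [1..<k]) @ [N\<^sub>1 p] @ map (r p) [1..<k]"
    have cl: "set ?l \<subseteq> carrier (M p)" "r p k \<in> carrier (M p)"
      using step by (auto intro!: in_factors_closed in_first_closed)
    have "bar S \<iota> p R N (Suc k) = list_prod (M p) ((r p k # ?l) @ [r p k])"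
      using step(1) by (simp add: bar_def inv_R)
    also have "\<dots> = r p k \<otimes>\<^bsub>M p\<^esub> list_prod (M p) ?l \<otimes>\<^bsub>M p\<^esub> r p k"
      using cl by (subst E.list_prod_snoc) auto
    also have "list_prod (M p) ?l = E.nb k"
      using step by (simp add: bar_def inv_R)
    finally show ?case using step(1) by (simp add: E.nb_Suc)
  qed
qed

lemma R_pair_rp:
  assumes "1 \<le> p" "1 \<le> k" "k < l" "l \<le> p"
  shows "R_pair S \<iota> p R k l = braided_ring.rp (M p) (r p) k l"
proof -
  interpret E: braided_ring "M p" p "r p" "N\<^sub>1 p" "D'\<^sub>1 p" "scal p h" by (rule braided_ring[OF assms(1)])
  have "Suc k \<le> l \<Longrightarrow> l \<le> p \<Longrightarrow> R_pair S \<iota> p R k l = E.rp k l"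
  proof (induction l rule: dec_induct)
    case base
    have "r p k \<in> carrier (M p)" using assms base by (auto intro!: in_factors_closed)
    then show ?case by (simp add: R_pair_def E.rp_base)
  next
    case (step l)
    let ?l = "map (r p) (rev [k..<l] @ [Suc k..<l])"
    have cl: "set ?l \<subseteq> carrier (M p)" "r p l \<in> carrier (M p)"
      using step assms by (auto intro!: in_factors_closed)
    have "R_pair S \<iota> p R k (Suc l) = list_prod (M p) ((r p l # ?l) @ [r p l])"
      using step(1) by (simp add: R_pair_def)
    also have "\<dots> = r p l \<otimes>\<^bsub>M p\<^esub> list_prod (M p) ?l \<otimes>\<^bsub>M p\<^esub> r p l"
      using cl by (subst E.list_prod_snoc) auto
    also have "list_prod (M p) ?l = E.rp k l"
      using step by (simp add: R_pair_def)
    finally show ?case using step(1) by (simp add: E.rp_Suc)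
  qed
  then show ?thesis using assms by simp
qed

lemma R_cycle_rc:
  assumes "1 \<le> p" "ks \<in> index_chains p s"
  shows "R_cycle S \<iota> p R ks = braided_ring.rc (M p) (r p) 1 ks"
proof -
  interpret E: braided_ring "M p" p "r p" "N\<^sub>1 p" "D'\<^sub>1 p" "scal p h" by (rule braided_ring[OF assms(1)])
  have "sorted_wrt (<) ks \<Longrightarrow> set ks \<subseteq> {a<..p} \<Longrightarrow> 1 \<le> a \<Longrightarrow>
    map (\<lambda>(k, l). R_pair S \<iota> p R k l) (zip (a # ks) ks) = map (\<lambda>(k, l). E.rp k l) (zip (a # ks) ks)" for a
  proof (induction ks arbitrary: a)
    case (Cons b ks)
    then have "R_pair S \<iota> p R a b = E.rp a b" by (intro R_pair_rp assms) auto
    moreover have "map (\<lambda>(k, l). R_pair S \<iota> p R k l) (zip (b # ks) ks) = map (\<lambda>(k, l). E.rp k l) (zip (b # ks) ks)"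
      using Cons.prems by (intro Cons.IH) auto
    ultimately show ?case by simp
  qed simp
  moreover have "sorted_wrt (<) ks" "set ks \<subseteq> {1<..p}" using assms(2) by (auto simp: index_chains_def)
  ultimately show ?thesis unfolding R_cycle_def E.rc_def by (metis order_refl)
qed

lemma bar_prod_ns: "1 \<le> p \<Longrightarrow> bar_prod S \<iota> p R N ks = braided_ring.ns (M p) (r p) (N\<^sub>1 p) p ks"
proof -
  assume p: "1 \<le> p"
  interpret E: braided_ring "M p" p "r p" "N\<^sub>1 p" "D'\<^sub>1 p" "scal p h" by (rule braided_ring[OF p])
  show ?thesis unfolding bar_prod_def E.ns_def
    by (rule arg_cong[where f = "list_prod (M p)"], rule map_cong) (auto intro!: bar_nb p)
qed

end

section \<open>Skew-invertibility\<close>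

text \<open>In coordinates the partial trace identity says that \<open>A\<close>, with rows (a, c)
  and columns (j, y), and \<open>B\<close>, with rows (j, y) and columns (d, b), are inverse to each
  other.\<close>

lemma Tr2_flip_entry:
  fixes A B :: "'k::field ^ ('n::finite \<times> 'n) ^ ('n \<times> 'n)"
  assumes "Tr2 (on12 A ** on23 B) = flip_mat"
  shows "(\<Sum>j\<in>UNIV. \<Sum>y\<in>UNIV. A $ (a, j) $ (c, y) * B $ (y, b) $ (j, d)) = (if a = d \<and> b = c then 1 else 0)"
proof -
  have "(on12 A ** on23 B) $ (a, j, b) $ (c, j, d) = (\<Sum>y\<in>UNIV. A $ (a, j) $ (c, y) * B $ (y, b) $ (j, d))" for j
  proof -
    have "(on12 A ** on23 B) $ (a, j, b) $ (c, j, d)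
      = (\<Sum>(x, y, z)\<in>UNIV. (if b = z then A $ (a, j) $ (x, y) else 0) * (if x = c then B $ (y, z) $ (j, d) else 0))"
      unfolding matrix_matrix_mult_def by (auto simp: on12_def on23_def intro!: sum.cong)
    also have "\<dots> = (\<Sum>(x, y, z)\<in>UNIV \<times> UNIV \<times> UNIV. (if b = z then A $ (a, j) $ (x, y) else 0) * (if x = c then B $ (y, z) $ (j, d) else 0))"
      by simp
    also have "\<dots> = (\<Sum>x\<in>UNIV. \<Sum>y\<in>UNIV. \<Sum>z\<in>UNIV. if z = b then (if x = c then A $ (a, j) $ (x, y) * B $ (y, z) $ (j, d) else 0) else 0)"
      by (simp only: sum.cartesian_product[symmetric]) (intro sum.cong refl, auto)
    also have "\<dots> = (\<Sum>x\<in>UNIV. if x = c then (\<Sum>y\<in>UNIV. A $ (a, j) $ (x, y) * B $ (y, b) $ (j, d)) else 0)"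
      by (intro sum.cong refl) simp
    finally show ?thesis by simp
  qed
  moreover have "Tr2 (on12 A ** on23 B) $ (a, b) $ (c, d) = (if a = d \<and> b = c then 1 else 0)"
    by (simp add: assms flip_mat_def)
  ultimately show ?thesis by (simp add: Tr2_def)
qed

context kalg
begin

lemma sum_in_subgroup:
  assumes "additive_subgroup A S" "finite K" "\<And>i. i \<in> K \<Longrightarrow> f i \<in> A"
  shows "(\<Oplus>i\<in>K. f i) \<in> A"
  using assms(2,3)
proof (induction K rule: finite_induct)
  interpret A: additive_subgroup A S by fact
  case (insert x F)
  then show ?case by (subst finsum_insert) (auto intro: A.a_Hcarr A.a_closed)
qed (use assms additive_subgroup.zero_closed in auto)

text \<open>The entries of R, regrouped, are the coefficients of an invertible linear system for the
  unknowns \<open>f x y\<close>. Solving it uses only scalars and sums, under which \<open>A\<close>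
  is closed, so membership passes from the right-hand sides to the unknowns.\<close>

lemma skew_solve:
  fixes R :: "'k ^ ('n::finite \<times> 'n) ^ ('n \<times> 'n)" and f :: "'n \<Rightarrow> 'n \<Rightarrow> 's"
  assumes \<Psi>: "Tr2 (on12 R ** on23 \<Psi>) = flip_mat" and f: "\<And>x y. f x y \<in> carrier S"
    and A: "additive_subgroup A S" "\<And>a c. a \<in> A \<Longrightarrow> \<iota> c \<otimes> a \<in> A"
    and mem: "\<And>b e. (\<Oplus>x\<in>UNIV. \<Oplus>y\<in>UNIV. \<iota> (R $ (x, b) $ (y, e)) \<otimes> f x y) \<in> A"
  shows "f u v \<in> A"
proof -
  let ?g = "\<lambda>b e. (\<Oplus>x\<in>UNIV. \<Oplus>y\<in>UNIV. \<iota> (R $ (x, b) $ (y, e)) \<otimes> f x y)"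
  \<comment> \<open>The coefficients of the inverse system: summing over \<open>b\<close> and
    \<open>e\<close> against \<open>R $ (x, b) $ (y, e)\<close> gives an entry of the partial trace,
    which is 1 for \<open>x = u\<close>, \<open>y = v\<close> and 0 otherwise.\<close>
  let ?P = "\<lambda>b e. \<iota> (\<Psi> $ (e, v) $ (b, u))"
  have "(\<Oplus>b\<in>UNIV. \<Oplus>e\<in>UNIV. ?P b e \<otimes> ?g b e)
    = (\<Oplus>b\<in>UNIV. \<Oplus>e\<in>UNIV. \<Oplus>x\<in>UNIV. \<Oplus>y\<in>UNIV. ?P b e \<otimes> (\<iota> (R $ (x, b) $ (y, e)) \<otimes> f x y))"
    using f by (intro finsum_cong' refl) (auto simp: finsum_rdistr intro!: finsum_closed finsum_cong')
  also have "\<dots> = (\<Oplus>b\<in>UNIV. \<Oplus>x\<in>UNIV. \<Oplus>e\<in>UNIV. \<Oplus>y\<in>UNIV. ?P b e \<otimes> (\<iota> (R $ (x, b) $ (y, e)) \<otimes> f x y))"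
    using f by (intro finsum_cong' refl finsum_swap) (auto intro!: finsum_closed)
  also have "\<dots> = (\<Oplus>x\<in>UNIV. \<Oplus>b\<in>UNIV. \<Oplus>e\<in>UNIV. \<Oplus>y\<in>UNIV. ?P b e \<otimes> (\<iota> (R $ (x, b) $ (y, e)) \<otimes> f x y))"
    using f by (intro finsum_swap) (auto intro!: finsum_closed)
  also have "\<dots> = (\<Oplus>x\<in>UNIV. \<Oplus>b\<in>UNIV. \<Oplus>y\<in>UNIV. \<Oplus>e\<in>UNIV. ?P b e \<otimes> (\<iota> (R $ (x, b) $ (y, e)) \<otimes> f x y))"
    using f by (intro finsum_cong' refl finsum_swap) (auto intro!: finsum_closed)
  also have "\<dots> = (\<Oplus>x\<in>UNIV. \<Oplus>y\<in>UNIV. \<Oplus>b\<in>UNIV. \<Oplus>e\<in>UNIV. ?P b e \<otimes> (\<iota> (R $ (x, b) $ (y, e)) \<otimes> f x y))"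
    using f by (intro finsum_cong' refl finsum_swap) (auto intro!: finsum_closed)
  also have "\<dots> = (\<Oplus>x\<in>UNIV. \<Oplus>y\<in>UNIV. if y = v then (if x = u then f x y else \<zero>) else \<zero>)"
  proof (intro finsum_cong' refl)
    fix x y
    have "(\<Oplus>b\<in>UNIV. \<Oplus>e\<in>UNIV. ?P b e \<otimes> (\<iota> (R $ (x, b) $ (y, e)) \<otimes> f x y))
      = (\<Oplus>b\<in>UNIV. \<Oplus>e\<in>UNIV. \<iota> (R $ (x, b) $ (y, e) * \<Psi> $ (e, v) $ (b, u)) \<otimes> f x y)"
    proof (intro finsum_cong' refl)
      fix b e
      have "\<iota> (R $ (x, b) $ (y, e) * \<Psi> $ (e, v) $ (b, u)) = ?P b e \<otimes> \<iota> (R $ (x, b) $ (y, e))"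
        by (simp add: mult.commute flip: \<iota>_mult)
      then show "?P b e \<otimes> (\<iota> (R $ (x, b) $ (y, e)) \<otimes> f x y)
        = \<iota> (R $ (x, b) $ (y, e) * \<Psi> $ (e, v) $ (b, u)) \<otimes> f x y"
        using f by (simp add: m_assoc)
    qed (use f in \<open>auto intro!: finsum_closed\<close>)
    also have "\<dots> = (\<Oplus>b\<in>UNIV. (\<Oplus>e\<in>UNIV. \<iota> (R $ (x, b) $ (y, e) * \<Psi> $ (e, v) $ (b, u))) \<otimes> f x y)"
      using f by (intro finsum_cong' refl) (auto simp: finsum_ldistr intro!: finsum_closed)
    also have "\<dots> = (\<Oplus>b\<in>UNIV. \<Oplus>e\<in>UNIV. \<iota> (R $ (x, b) $ (y, e) * \<Psi> $ (e, v) $ (b, u))) \<otimes> f x y"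
      using f by (intro finsum_ldistr[symmetric]) (auto intro!: finsum_closed)
    also have "(\<Oplus>b\<in>UNIV. \<Oplus>e\<in>UNIV. \<iota> (R $ (x, b) $ (y, e) * \<Psi> $ (e, v) $ (b, u)))
      = \<iota> (if x = u \<and> v = y then 1 else 0)"
      by (simp add: Tr2_flip_entry[OF \<Psi>, symmetric] \<iota>_sum)
    finally show "(\<Oplus>b\<in>UNIV. \<Oplus>e\<in>UNIV. ?P b e \<otimes> (\<iota> (R $ (x, b) $ (y, e)) \<otimes> f x y))
      = (if y = v then (if x = u then f x y else \<zero>) else \<zero>)"
      using f by auto
  qed (use f in \<open>auto intro!: finsum_closed\<close>)
  also have "\<dots> = (\<Oplus>x\<in>UNIV. if x = u then f x v else \<zero>)"
    using f by (intro finsum_cong' refl finsum_delta) auto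
  also have "\<dots> = f u v"
    using f by (intro finsum_delta) auto
  finally have "f u v = (\<Oplus>b\<in>UNIV. \<Oplus>e\<in>UNIV. ?P b e \<otimes> ?g b e)" by simp
  also have "\<dots> \<in> A"
    by (intro sum_in_subgroup A mem) auto
  finally show ?thesis .
qed

lemma finsum_pairs:
  fixes f :: "'a::finite \<times> 'b::finite \<Rightarrow> 's"
  assumes "\<And>x. f x \<in> carrier S"
  shows "(\<Oplus>p\<in>UNIV. f p) = (\<Oplus>x\<in>UNIV. \<Oplus>y\<in>UNIV. f (x, y))"
proof -
  have "(\<Oplus>p\<in>UNIV. f p) = (\<Oplus>p\<in>(\<Union>x\<in>UNIV. Pair x ` UNIV). f p)"
    by (rule arg_cong[where f = "finsum S f"]) auto
  also have "\<dots> = (\<Oplus>x\<in>UNIV. \<Oplus>p\<in>Pair x ` UNIV. f p)"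
    using assms by (intro add.finprod_UN_disjoint) (auto simp: pairwise_def disjnt_def)
  also have "\<dots> = (\<Oplus>x\<in>UNIV. \<Oplus>y\<in>UNIV. f (x, y))"
    using assms by (intro finsum_cong' refl finsum_reindex) (auto simp: inj_on_def intro!: finsum_closed)
  finally show ?thesis .
qed

lemma mult_scalar_sum:
  assumes "finite K" "x \<in> carrier S" "\<And>j. j \<in> K \<Longrightarrow> t j \<in> carrier S"
  shows "x \<otimes> (\<Oplus>j\<in>K. \<iota> (c j) \<otimes> t j) = (\<Oplus>j\<in>K. \<iota> (c j) \<otimes> (x \<otimes> t j))"
proof -
  have "x \<otimes> (\<Oplus>j\<in>K. \<iota> (c j) \<otimes> t j) = (\<Oplus>j\<in>K. x \<otimes> (\<iota> (c j) \<otimes> t j))"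
    using assms by (intro finsum_rdistr) auto
  also have "\<dots> = (\<Oplus>j\<in>K. \<iota> (c j) \<otimes> (x \<otimes> t j))"
    using assms by (intro finsum_cong' refl) (auto simp: \<iota>_central[of x] simp flip: m_assoc)
  finally show ?thesis .
qed

lemma first_entry:
  assumes "\<And>i j. X i j \<in> carrier S" "B \<in> carrier (M (Suc p))" "length I = p" "length J = Suc p"
  shows "(in_first S (Suc p) X \<otimes>\<^bsub>M (Suc p)\<^esub> B) (a # I, J) = (\<Oplus>x\<in>UNIV. X a x \<otimes> B (x # I, J))"
proof -
  interpret s: tensor_site S "Suc p" UNIV hd "\<lambda>I x. x # tl I"
    by (intro tensor_site.intro site_first) (unfold_locales, simp)
  show ?thesis
    unfolding in_first_local[of "Suc p", simplified]
    using assms by (subst s.local_mult_entry) (auto simp: multi_index_def)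
qed

lemma factors_entry:
  fixes A :: "'k ^ ('n::finite \<times> 'n) ^ ('n \<times> 'n)"
  assumes k: "1 \<le> k" "k < p" and B: "B \<in> carrier (M p)" "I \<in> mi p" "J \<in> mi p"
  shows "(in_factors S \<iota> p A k \<otimes>\<^bsub>M p\<^esub> B) (I, J)
    = (\<Oplus>x\<in>UNIV. \<Oplus>y\<in>UNIV. \<iota> (A $ (I ! (k - 1), I ! k) $ (x, y)) \<otimes> B (I[k - 1 := x, k := y], J))"
proof -
  interpret s: tensor_site S p UNIV "pair_get k" "pair_put k"
    by (intro tensor_site.intro site_pair k) unfold_locales
  have "(in_factors S \<iota> p A k \<otimes>\<^bsub>M p\<^esub> B) (I, J)
    = (\<Oplus>a\<in>UNIV. \<iota> (A $ pair_get k I $ a) \<otimes> B (pair_put k I a, J))"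
    unfolding in_factors_local[OF k] using B by (intro s.local_mult_entry) auto
  also have "\<dots> = (\<Oplus>x\<in>UNIV. \<Oplus>y\<in>UNIV. \<iota> (A $ pair_get k I $ (x, y)) \<otimes> B (pair_put k I (x, y), J))"
    by (intro finsum_pairs m_closed \<iota>_closed entry_closed[where p = p] B s.put_closed UNIV_I)
  finally show ?thesis by (simp add: pair_get_def pair_put_def)
qed

lemma entries_inD: "entries_in p A X \<Longrightarrow> I \<in> multi_index p \<Longrightarrow> J \<in> multi_index p \<Longrightarrow> X (I, J) \<in> A"
  by (simp add: entries_in_def)

lemma multi_index_2: "multi_index 2 = range (\<lambda>(x, y). [x, y])"
  by (auto simp: multi_index_def length_Suc_conv numeral_2_eq_2 image_iff)

lemma finsum_mi2:
  assumes "\<And>x y. f [x, y] \<in> carrier S"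
  shows "(\<Oplus>L\<in>multi_index 2. f (L :: 'a::finite list)) = (\<Oplus>x\<in>UNIV. \<Oplus>y\<in>UNIV. f [x, y])"
proof -
  have "(\<Oplus>L\<in>multi_index 2. f L) = (\<Oplus>L\<in>(\<lambda>(x, y). [x, y]) ` UNIV. f L)"
    by (simp only: multi_index_2)
  also have "\<dots> = (\<Oplus>q\<in>UNIV. f (case q of (x, y) \<Rightarrow> [x, y]))"
    using assms by (intro finsum_reindex) (auto simp: inj_on_def)
  also have "\<dots> = (\<Oplus>x\<in>UNIV. \<Oplus>y\<in>UNIV. f [x, y])"
    using assms by (subst finsum_pairs) auto
  finally show ?thesis .
qed

lemma emb_entry:
  fixes J :: "'n::finite list"
  assumes "2 \<le> p" "A \<in> carrier (M 2)" "B \<in> carrier (M p)" "length I + 2 = p" "J \<in> multi_index p"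
  shows "(emb p A \<otimes>\<^bsub>M p\<^esub> B) (a # b # I, J) = (\<Oplus>x\<in>UNIV. \<Oplus>y\<in>UNIV. A ([a, b], [x, y]) \<otimes> B (x # y # I, J))"
proof -
  interpret s: tensor_site S p "multi_index 2 :: 'n list set" "take 2" "\<lambda>I L. L @ drop 2 I"
    by (intro tensor_site.intro site_block assms) unfold_locales
  have "(emb p A \<otimes>\<^bsub>M p\<^esub> B) (a # b # I, J) = (\<Oplus>L\<in>multi_index 2. A ([a, b], L) \<otimes> B (L @ I, J))"
    unfolding emb_def using assms by (subst s.local_mult_entry) (auto simp: multi_index_def)
  also have "\<dots> = (\<Oplus>x\<in>UNIV. \<Oplus>y\<in>UNIV. A ([a, b], [x, y]) \<otimes> B (x # y # I, J))"
    using assms by (subst finsum_mi2) (auto simp: multi_index_def)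
  finally show ?thesis .
qed

text \<open>An R between two matrices in the first factor yields the kind of sum that
  \<open>skew_solve\<close> inverts.\<close>

lemma first_factors_first_entry:
  fixes R :: "'k ^ ('n::finite \<times> 'n) ^ ('n \<times> 'n)"
  assumes c: "\<And>i j. X i j \<in> carrier S" "\<And>i j. Y i j \<in> carrier S"
  shows "(in_first S 2 X \<otimes>\<^bsub>M 2\<^esub> (in_factors S \<iota> 2 R 1 \<otimes>\<^bsub>M 2\<^esub> in_first S 2 Y)) ([a, b], [d, e])
    = (\<Oplus>x\<in>UNIV. \<Oplus>y\<in>UNIV. \<iota> (R $ (x, b) $ (y, e)) \<otimes> (X a x \<otimes> Y y d))"
proof -
  have cl: "in_first S 2 Y \<in> carrier (M 2)" "in_factors S \<iota> 2 R 1 \<in> carrier (M 2)"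
    using c by (auto intro!: in_first_closed in_factors_closed)
  have 1: "(in_factors S \<iota> 2 R 1 \<otimes>\<^bsub>M 2\<^esub> in_first S 2 Y) ([x, b], [d, e])
      = (\<Oplus>y\<in>UNIV. \<iota> (R $ (x, b) $ (y, e)) \<otimes> Y y d)" for x
  proof -
    have "(in_factors S \<iota> 2 R 1 \<otimes>\<^bsub>M 2\<^esub> in_first S 2 Y) ([x, b], [d, e])
      = (\<Oplus>y\<in>UNIV. \<Oplus>z\<in>UNIV. if z = e then \<iota> (R $ (x, b) $ (y, z)) \<otimes> Y y d else \<zero>)"
      using c cl by (subst factors_entry) (auto simp: in_first_def multi_index_def intro!: finsum_cong' finsum_closed)
    also have "\<dots> = (\<Oplus>y\<in>UNIV. \<iota> (R $ (x, b) $ (y, e)) \<otimes> Y y d)"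
      using c by (intro finsum_cong' refl finsum_delta) auto
    finally show ?thesis .
  qed
  have "(in_first S 2 X \<otimes>\<^bsub>M 2\<^esub> (in_factors S \<iota> 2 R 1 \<otimes>\<^bsub>M 2\<^esub> in_first S 2 Y)) ([a, b], [d, e])
    = (\<Oplus>x\<in>UNIV. X a x \<otimes> (\<Oplus>y\<in>UNIV. \<iota> (R $ (x, b) $ (y, e)) \<otimes> Y y d))"
    using first_entry[of X "in_factors S \<iota> 2 R 1 \<otimes>\<^bsub>M 2\<^esub> in_first S 2 Y" 1 "[b]" "[d, e]" a] c cl
    by (simp add: numeral_2_eq_2[symmetric] mult_closed 1[unfolded One_nat_def])
  also have "\<dots> = (\<Oplus>x\<in>UNIV. \<Oplus>y\<in>UNIV. \<iota> (R $ (x, b) $ (y, e)) \<otimes> (X a x \<otimes> Y y d))"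
    using c by (intro finsum_cong' refl mult_scalar_sum) (auto intro!: finsum_closed)
  finally show ?thesis .
qed

lemma entries_in_add:
  assumes "additive_subgroup A S" "entries_in p A X" "entries_in p A Y"
  shows "entries_in p A (X \<oplus>\<^bsub>M p\<^esub> Y)"
  using assms by (auto simp: entries_in_def add_closed add_entry intro: additive_subgroup.a_closed)

lemma entries_in_minus:
  assumes "additive_subgroup A S" "entries_in p A X" "entries_in p A Y"
  shows "entries_in p A (X \<ominus>\<^bsub>M p\<^esub> Y)"
proof -
  interpret E: ring "M p" by (rule ring_End_tensor)
  show ?thesis
    using assms unfolding entries_in_def
    by (auto simp: minus_entry a_minus_def[of S] intro!: additive_subgroup.a_closed additive_subgroup.a_inv_closed)
qed

lemma entries_in_scale:
  assumes "\<And>a c. a \<in> A \<Longrightarrow> \<iota> c \<otimes> a \<in> A" "entries_in p A X"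
  shows "entries_in p A (scale_mat S \<iota> p c X)"
  using assms by (auto simp: entries_in_def scale_closed) (auto simp: scale_mat_def)

lemma entries_in_first:
  "(\<And>i j. X i j \<in> A) \<Longrightarrow> \<zero> \<in> A \<Longrightarrow> A \<subseteq> carrier S \<Longrightarrow> entries_in p A (in_first S p X)"
  unfolding entries_in_def by (auto intro!: in_first_closed) (auto simp: in_first_def)

lemma entries_in_factors:
  "1 \<le> k \<Longrightarrow> k < p \<Longrightarrow> (\<And>c. \<iota> c \<in> A) \<Longrightarrow> entries_in p A (in_factors S \<iota> p B k)"
  unfolding entries_in_def using \<iota>_0
  by (auto intro!: in_factors_closed) (auto simp: in_factors_def simp flip: \<iota>_0)

lemma entries_in_carrier: "X \<in> carrier (M p) \<Longrightarrow> entries_in p (carrier S) X"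
  by (auto simp: entries_in_def)

lemma entries_in_zero: "entries_in p {\<zero>} X \<Longrightarrow> X = \<zero>\<^bsub>M p\<^esub>"
  by (rule mat_eqI[where p = p]) (auto simp: entries_in_def zero_entry zero_closed')

end

text \<open>Cancellation of R inside matrix products. Each lemma of this locale passes from the
  entries of a product with R's in between to sums or products of the entries of the outer
  matrices.\<close>

locale skew_kalg = kalg S \<iota> for S :: "('s, 'm) ring_scheme" (structure) and \<iota> :: "'k::field \<Rightarrow> 's" +
  fixes R \<Psi> :: "'k ^ ('n::finite \<times> 'n) ^ ('n \<times> 'n)" and A :: "'s set"
  assumes \<Psi>: "Tr2 (on12 R ** on23 \<Psi>) = flip_mat"
    and A: "additive_subgroup A S" "\<And>a c. a \<in> A \<Longrightarrow> \<iota> c \<otimes> a \<in> A"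
begin

lemmas skew = skew_solve[OF \<Psi> _ A]

lemma skew_first_first:
  assumes c: "\<And>i j. X i j \<in> carrier S" "\<And>i j. Y i j \<in> carrier S"
    and mem: "entries_in 2 A (in_first S 2 X \<otimes>\<^bsub>M 2\<^esub> (in_factors S \<iota> 2 R 1 \<otimes>\<^bsub>M 2\<^esub> in_first S 2 Y))"
  shows "X a u \<otimes> Y v d \<in> A"
proof (rule skew[where f = "\<lambda>u v. X a u \<otimes> Y v d"])
  fix b e
  show "(\<Oplus>x\<in>UNIV. \<Oplus>y\<in>UNIV. \<iota> (R $ (x, b) $ (y, e)) \<otimes> (X a x \<otimes> Y y d)) \<in> A"
    using entries_inD[OF mem, of "[a, b]" "[d, e]"] first_factors_first_entry[OF c, where R = R and a = a and b = b and d = d and e = e]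
    by (simp add: multi_index_def)
qed (use c in auto)

text \<open>The blocks \<open>P\<close> and \<open>B\<close> share the factors 1 and 2, but R_2
  touches only the second. One application of \<open>skew_solve\<close> separates the indices there,
  while the contraction over the first factor remains as the sum over \<open>x\<close>.\<close>

lemma skew_block_block:
  assumes c: "P \<in> carrier (M 2)" "B \<in> carrier (M 2)"
    and mem: "entries_in 3 A (emb 3 P \<otimes>\<^bsub>M 3\<^esub> (in_factors S \<iota> 3 R 2 \<otimes>\<^bsub>M 3\<^esub> emb 3 B))"
  shows "(\<Oplus>x\<in>UNIV. P ([a, b], [x, y]) \<otimes> B ([x, u], [d, e])) \<in> A"
proof (rule skew[where f = "\<lambda>y u. \<Oplus>x\<in>UNIV. P ([a, b], [x, y]) \<otimes> B ([x, u], [d, e])"])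
  have Pc: "P ([a, b], [x, y]) \<in> carrier S" and Bc: "B ([a, b], [x, y]) \<in> carrier S" for a b x y
    using c by (auto simp: multi_index_def)
  then show "(\<Oplus>x\<in>UNIV. P ([a, b], [x, y]) \<otimes> B ([x, u], [d, e])) \<in> carrier S" for y u
    by (auto intro!: finsum_closed)
  fix g f
  have cl: "emb 3 B \<in> carrier (M 3)" "emb 3 P \<in> carrier (M 3)" "in_factors S \<iota> 3 R 2 \<in> carrier (M 3)"
    using c by (auto intro!: emb_closed in_factors_closed)
  have 1: "(in_factors S \<iota> 3 R 2 \<otimes>\<^bsub>M 3\<^esub> emb 3 B) ([x, y, g], [d, e, f])
      = (\<Oplus>u\<in>UNIV. \<iota> (R $ (y, g) $ (u, f)) \<otimes> B ([x, u], [d, e]))" for x y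
  proof -
    have "(in_factors S \<iota> 3 R 2 \<otimes>\<^bsub>M 3\<^esub> emb 3 B) ([x, y, g], [d, e, f])
      = (\<Oplus>u\<in>UNIV. \<Oplus>z\<in>UNIV. if z = f then \<iota> (R $ (y, g) $ (u, z)) \<otimes> B ([x, u], [d, e]) else \<zero>)"
      using Bc cl by (subst factors_entry)
        (auto simp: emb_def local_mat_def multi_index_def intro!: finsum_cong' finsum_closed)
    also have "\<dots> = (\<Oplus>u\<in>UNIV. \<iota> (R $ (y, g) $ (u, f)) \<otimes> B ([x, u], [d, e]))"
      using Bc by (intro finsum_cong' refl finsum_delta) auto
    finally show ?thesis .
  qed
  have "(emb 3 P \<otimes>\<^bsub>M 3\<^esub> (in_factors S \<iota> 3 R 2 \<otimes>\<^bsub>M 3\<^esub> emb 3 B)) ([a, b, g], [d, e, f])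
    = (\<Oplus>x\<in>UNIV. \<Oplus>y\<in>UNIV. P ([a, b], [x, y]) \<otimes> (\<Oplus>u\<in>UNIV. \<iota> (R $ (y, g) $ (u, f)) \<otimes> B ([x, u], [d, e])))"
    using c cl by (subst emb_entry) (auto simp: mult_closed 1 multi_index_def)
  also have "\<dots> = (\<Oplus>x\<in>UNIV. \<Oplus>y\<in>UNIV. \<Oplus>u\<in>UNIV. \<iota> (R $ (y, g) $ (u, f)) \<otimes> (P ([a, b], [x, y]) \<otimes> B ([x, u], [d, e])))"
    using Pc Bc by (intro finsum_cong' refl mult_scalar_sum) (auto intro!: finsum_closed)
  also have "\<dots> = (\<Oplus>y\<in>UNIV. \<Oplus>x\<in>UNIV. \<Oplus>u\<in>UNIV. \<iota> (R $ (y, g) $ (u, f)) \<otimes> (P ([a, b], [x, y]) \<otimes> B ([x, u], [d, e])))"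
    using Pc Bc by (intro finsum_swap) (auto intro!: finsum_closed)
  also have "\<dots> = (\<Oplus>y\<in>UNIV. \<Oplus>u\<in>UNIV. \<Oplus>x\<in>UNIV. \<iota> (R $ (y, g) $ (u, f)) \<otimes> (P ([a, b], [x, y]) \<otimes> B ([x, u], [d, e])))"
    using Pc Bc by (intro finsum_cong' refl finsum_swap) (auto intro!: finsum_closed)
  also have "\<dots> = (\<Oplus>y\<in>UNIV. \<Oplus>u\<in>UNIV. \<iota> (R $ (y, g) $ (u, f)) \<otimes> (\<Oplus>x\<in>UNIV. P ([a, b], [x, y]) \<otimes> B ([x, u], [d, e])))"
    using Pc Bc by (intro finsum_cong' refl finsum_rdistr[symmetric]) (auto intro!: finsum_closed)
  finally show "(\<Oplus>y\<in>UNIV. \<Oplus>u\<in>UNIV. \<iota> (R $ (y, g) $ (u, f)) \<otimes> (\<Oplus>x\<in>UNIV. P ([a, b], [x, y]) \<otimes> B ([x, u], [d, e]))) \<in> A"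
    using entries_inD[OF mem, of "[a, b, g]" "[d, e, f]"] by (simp add: multi_index_def)
qed

text \<open>R_2 is removed first, by \<open>skew_block_block\<close> with the block formed by X_1
  and R_1. The sum left over in the first factor is then again of the form contracted with R, and a
  second cancellation removes R_1. \<open>skew_block_first\<close> is the mirror image.\<close>

lemma skew_first_block:
  assumes c: "\<And>i j. X i j \<in> carrier S" "B \<in> carrier (M 2)"
    and mem: "entries_in 3 A (in_first S 3 X \<otimes>\<^bsub>M 3\<^esub> (in_factors S \<iota> 3 R 1 \<otimes>\<^bsub>M 3\<^esub>
      (in_factors S \<iota> 3 R 2 \<otimes>\<^bsub>M 3\<^esub> emb 3 B)))"
  shows "X a w \<otimes> B ([x, u], [d, e]) \<in> A"
proof (rule skew[where f = "\<lambda>w x. X a w \<otimes> B ([x, u], [d, e])"])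
  interpret E: ring "M 3 :: ('n list \<times> 'n list \<Rightarrow> 's) ring" by (rule ring_End_tensor)
  have Bc: "B ([a, b], [x, y]) \<in> carrier S" for a b x y
    using c by (auto simp: multi_index_def)
  then show "X a w \<otimes> B ([x, u], [d, e]) \<in> carrier S" for w x
    using c by auto
  fix b y
  let ?P = "in_first S 2 X \<otimes>\<^bsub>M 2\<^esub> in_factors S \<iota> 2 R 1"
  have cl: "in_first S 2 X \<in> carrier (M 2)" "in_factors S \<iota> 2 R 1 \<in> carrier (M 2)"
    "in_first S 3 X \<in> carrier (M 3)" "in_factors S \<iota> 3 R 1 \<in> carrier (M 3)"
    "in_factors S \<iota> 3 R 2 \<in> carrier (M 3)" "emb 3 B \<in> carrier (M 3)"
    using c by (auto intro!: in_first_closed in_factors_closed emb_closed)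
  have "emb 3 ?P = in_first S 3 X \<otimes>\<^bsub>M 3\<^esub> in_factors S \<iota> 3 R 1"
    using cl by (simp add: emb_mult emb_first emb_factors del: One_nat_def)
  then have mP: "(\<Oplus>x\<in>UNIV. ?P ([a, b], [x, y]) \<otimes> B ([x, u], [d, e])) \<in> A"
    using c cl mem by (intro skew_block_block) (auto simp: mult_closed E.m_assoc)
  have rr: "in_factors S \<iota> 2 R 1 ([w, b], [x, y]) = \<iota> (R $ (w, b) $ (x, y))" for w x
    by (auto simp: in_factors_def multi_index_def less_2_cases_iff)
  have "?P ([a, b], [x, y]) = (\<Oplus>w\<in>UNIV. X a w \<otimes> \<iota> (R $ (w, b) $ (x, y)))" for x
    using first_entry[of X "in_factors S \<iota> 2 R 1" 1 "[b]" "[x, y]" a] c cl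
    by (simp add: numeral_2_eq_2[symmetric] multi_index_def rr[unfolded One_nat_def])
  with mP have "(\<Oplus>x\<in>UNIV. (\<Oplus>w\<in>UNIV. X a w \<otimes> \<iota> (R $ (w, b) $ (x, y))) \<otimes> B ([x, u], [d, e])) \<in> A"
    by (simp only:)
  also have "(\<Oplus>x\<in>UNIV. (\<Oplus>w\<in>UNIV. X a w \<otimes> \<iota> (R $ (w, b) $ (x, y))) \<otimes> B ([x, u], [d, e]))
    = (\<Oplus>x\<in>UNIV. \<Oplus>w\<in>UNIV. \<iota> (R $ (w, b) $ (x, y)) \<otimes> (X a w \<otimes> B ([x, u], [d, e])))"
    using c Bc by (intro finsum_cong' refl)
      (auto simp: finsum_ldistr \<iota>_central[of "X _ _", symmetric] m_assoc intro!: finsum_closed)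
  also have "\<dots> = (\<Oplus>w\<in>UNIV. \<Oplus>x\<in>UNIV. \<iota> (R $ (w, b) $ (x, y)) \<otimes> (X a w \<otimes> B ([x, u], [d, e])))"
    using c Bc by (intro finsum_swap) auto
  finally show "(\<Oplus>w\<in>UNIV. \<Oplus>x\<in>UNIV. \<iota> (R $ (w, b) $ (x, y)) \<otimes> (X a w \<otimes> B ([x, u], [d, e]))) \<in> A" .
qed

lemma skew_block_first:
  assumes c: "\<And>i j. X i j \<in> carrier S" "P \<in> carrier (M 2)"
    and mem: "entries_in 3 A (emb 3 P \<otimes>\<^bsub>M 3\<^esub> (in_factors S \<iota> 3 R 2 \<otimes>\<^bsub>M 3\<^esub>
      (in_factors S \<iota> 3 R 1 \<otimes>\<^bsub>M 3\<^esub> in_first S 3 X)))"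
  shows "P ([a, b], [x, y]) \<otimes> X z d \<in> A"
proof (rule skew[where f = "\<lambda>x z. P ([a, b], [x, y]) \<otimes> X z d"])
  have Pc: "P ([a, b], [x, y]) \<in> carrier S" for a b x y
    using c by (auto simp: multi_index_def)
  then show "P ([a, b], [x, y]) \<otimes> X z d \<in> carrier S" for x z
    using c by auto
  fix u e
  let ?B = "in_factors S \<iota> 2 R 1 \<otimes>\<^bsub>M 2\<^esub> in_first S 2 X"
  have cl: "in_first S 2 X \<in> carrier (M 2)" "in_factors S \<iota> 2 R 1 \<in> carrier (M 2)"
    using c by (auto intro!: in_first_closed in_factors_closed)
  have "emb 3 ?B = in_factors S \<iota> 3 R 1 \<otimes>\<^bsub>M 3\<^esub> in_first S 3 X"
    using cl by (simp add: emb_mult emb_first emb_factors del: One_nat_def)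
  then have "(\<Oplus>x\<in>UNIV. P ([a, b], [x, y]) \<otimes> ?B ([x, u], [d, e])) \<in> A"
    using c cl mem by (intro skew_block_block) (auto simp: mult_closed)
  moreover have "?B ([x, u], [d, e]) = (\<Oplus>z\<in>UNIV. \<iota> (R $ (x, u) $ (z, e)) \<otimes> X z d)" for x
  proof -
    have "?B ([x, u], [d, e]) = (\<Oplus>y\<in>UNIV. \<Oplus>z\<in>UNIV. if z = e then \<iota> (R $ (x, u) $ (y, z)) \<otimes> X y d else \<zero>)"
      using c cl by (subst factors_entry) (auto simp: in_first_def multi_index_def intro!: finsum_cong' finsum_closed)
    also have "\<dots> = (\<Oplus>y\<in>UNIV. \<iota> (R $ (x, u) $ (y, e)) \<otimes> X y d)"
      using c by (intro finsum_cong' refl finsum_delta) auto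
    finally show ?thesis .
  qed
  ultimately have "(\<Oplus>x\<in>UNIV. P ([a, b], [x, y]) \<otimes> (\<Oplus>z\<in>UNIV. \<iota> (R $ (x, u) $ (z, e)) \<otimes> X z d)) \<in> A"
    by (simp only:)
  also have "(\<Oplus>x\<in>UNIV. P ([a, b], [x, y]) \<otimes> (\<Oplus>z\<in>UNIV. \<iota> (R $ (x, u) $ (z, e)) \<otimes> X z d))
    = (\<Oplus>x\<in>UNIV. \<Oplus>z\<in>UNIV. \<iota> (R $ (x, u) $ (z, e)) \<otimes> (P ([a, b], [x, y]) \<otimes> X z d))"
    using c Pc by (intro finsum_cong' refl mult_scalar_sum) (auto intro!: finsum_closed)
  finally show "(\<Oplus>x\<in>UNIV. \<Oplus>z\<in>UNIV. \<iota> (R $ (x, u) $ (z, e)) \<otimes> (P ([a, b], [x, y]) \<otimes> X z d)) \<in> A" .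
qed

end

section \<open>Linear operators on the free algebra\<close>

lemma free_scalar_simps:
  "free_scalar 0 = 0" "free_scalar 1 = 1" "free_scalar (a + b) = free_scalar a + free_scalar b"
  "free_scalar (a * b) = free_scalar a * free_scalar b"
  by (simp_all add: free_scalar_def single_add mult_single flip: zero_list_def)

lemma free_scalar_sum: "free_scalar (\<Sum>i\<in>K. f i) = (\<Sum>i\<in>K. free_scalar (f i))"
  by (induction K rule: infinite_finite_induct) (auto simp: free_scalar_simps)

lemma poly_mapping_sum_single: "v = (\<Sum>w\<in>Poly_Mapping.keys v. Poly_Mapping.single w (Poly_Mapping.lookup v w))"
  by (rule poly_mapping_eqI) (auto simp: lookup_sum lookup_single when_def in_keys_iff)

lemma free_induct [case_names single add]:
  fixes v :: "'a \<Rightarrow>\<^sub>0 'b::comm_monoid_add"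
  assumes "\<And>w c. P (Poly_Mapping.single w c)" "\<And>u v. P u \<Longrightarrow> P v \<Longrightarrow> P (u + v)"
  shows "P v"
proof -
  have "P (\<Sum>w\<in>A. Poly_Mapping.single w (Poly_Mapping.lookup v w))" if "finite A" for A
    using that
  proof (induction A rule: finite_induct)
    case empty
    then show ?case using assms(1)[of undefined 0] by simp
  qed (auto intro: assms)
  then show ?thesis using poly_mapping_sum_single[of v] by (metis finite_keys)
qed

lemma free_scalar_single: "free_scalar c * Poly_Mapping.single w b = Poly_Mapping.single w (c * b)"
  by (simp add: free_scalar_def mult_single plus_list_def)

lemma free_scalar_commute: "free_scalar c * v = v * free_scalar c"
  by (induction v rule: free_induct)
    (auto simp: free_scalar_def mult_single plus_list_def mult.commute distrib_left distrib_right)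

lemma free_single_Cons: "Poly_Mapping.single (g # w) c = free_gen g * Poly_Mapping.single w c"
  by (simp add: free_gen_def mult_single plus_list_def)

text \<open>A concatenation is empty only if both words are, so taking the constant term is
  multiplicative. This later separates nonzero scalars from \<open>N_ideal\<close>.\<close>

lemma lookup_mult_Nil:
  fixes u v :: "('n, 'k::field) free"
  shows "Poly_Mapping.lookup (u * v) [] = Poly_Mapping.lookup u [] * Poly_Mapping.lookup v []"
proof (induction u rule: free_induct)
  case (single w c)
  show ?case
    by (induction v rule: free_induct)
      (auto simp: mult_single plus_list_def lookup_single lookup_add distrib_left when_def)
qed (simp add: distrib_right lookup_add)

section \<open>Linear operators as a coefficient algebra\<close>

definition lin_ext :: "('n gen list \<Rightarrow> ('n, 'k::field) free) \<Rightarrow> ('n, 'k) free \<Rightarrow> ('n, 'k) free" where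
  "lin_ext f v = (\<Sum>w\<in>Poly_Mapping.keys v. free_scalar (Poly_Mapping.lookup v w) * f w)"

lemma lin_ext_superset:
  "finite K \<Longrightarrow> Poly_Mapping.keys v \<subseteq> K \<Longrightarrow> lin_ext f v = (\<Sum>w\<in>K. free_scalar (Poly_Mapping.lookup v w) * f w)"
  unfolding lin_ext_def by (rule sum.mono_neutral_left) (auto simp: in_keys_iff free_scalar_simps)

lemma lin_ext_add: "lin_ext f (u + v) = lin_ext f u + lin_ext f v"
proof -
  let ?K = "Poly_Mapping.keys u \<union> Poly_Mapping.keys v"
  have "lin_ext f (u + v) = (\<Sum>w\<in>?K. free_scalar (Poly_Mapping.lookup (u + v) w) * f w)"
    using keys_add[of u v] by (intro lin_ext_superset) auto
  also have "\<dots> = (\<Sum>w\<in>?K. free_scalar (Poly_Mapping.lookup u w) * f w) + (\<Sum>w\<in>?K. free_scalar (Poly_Mapping.lookup v w) * f w)"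
    by (simp add: lookup_add free_scalar_simps distrib_right sum.distrib)
  also have "\<dots> = lin_ext f u + lin_ext f v"
    by (simp add: lin_ext_superset[of ?K])
  finally show ?thesis .
qed

lemma lin_ext_single: "lin_ext f (Poly_Mapping.single w c) = free_scalar c * f w"
  by (simp add: lin_ext_superset[of "{w}"])

lemma lin_ext_scalar: "lin_ext f (free_scalar c * v) = free_scalar c * lin_ext f v"
  by (induction v rule: free_induct)
    (auto simp: free_scalar_single lin_ext_single free_scalar_simps distrib_left lin_ext_add mult.assoc)

text \<open>The carrier is restricted to linear maps because composition distributes over sums, and
  scalars are central, only for these.\<close>

definition linear_endos :: "(('n, 'k::field) free \<Rightarrow> ('n, 'k) free) ring" where
  "linear_endos = \<lparr>carrier = {f. (\<forall>u v. f (u + v) = f u + f v) \<and>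
      (\<forall>c v. f (free_scalar c * v) = free_scalar c * f v)},
    monoid.mult = (\<circ>), one = id, ring.zero = (\<lambda>_. 0), add = (\<lambda>f g v. f v + g v)\<rparr>"

lemma linear_endos_simps:
  "f \<in> carrier linear_endos \<longleftrightarrow> (\<forall>u v. f (u + v) = f u + f v) \<and>
      (\<forall>c v. f (free_scalar c * v) = free_scalar c * f v)"
  "(f \<otimes>\<^bsub>linear_endos\<^esub> g) v = f (g v)" "\<one>\<^bsub>linear_endos\<^esub> v = v" "\<zero>\<^bsub>linear_endos\<^esub> v = 0"
  "(f \<oplus>\<^bsub>linear_endos\<^esub> g) v = f v + g v"
  by (simp_all add: linear_endos_def)

lemma linear_endos_0: "f \<in> carrier linear_endos \<Longrightarrow> f 0 = 0"
  by (metis add_cancel_right_right linear_endos_simps(1))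

lemma linear_endos_ext:
  assumes "f \<in> carrier linear_endos" "g \<in> carrier linear_endos"
    and "\<And>w. f (Poly_Mapping.single w 1) = g (Poly_Mapping.single w 1)"
  shows "f = g"
proof
  fix v show "f v = g v"
  proof (induction v rule: free_induct)
    case (single w c)
    have "Poly_Mapping.single w c = free_scalar c * Poly_Mapping.single w 1" by (simp add: free_scalar_single)
    then show ?case using assms by (simp add: linear_endos_simps)
  qed (use assms in \<open>simp add: linear_endos_simps\<close>)
qed

lemma ring_linear_endos: "ring (linear_endos :: (('n, 'k::field) free \<Rightarrow> _) ring)"
proof (rule ringI)
  have add: "f \<oplus>\<^bsub>linear_endos\<^esub> g \<in> carrier linear_endos"
    if "f \<in> carrier linear_endos" "g \<in> carrier linear_endos" for f g :: "('n, 'k) free \<Rightarrow> ('n, 'k) free"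
    using that by (simp add: linear_endos_simps distrib_left add_ac)
  show "abelian_group (linear_endos :: (('n, 'k) free \<Rightarrow> _) ring)"
  proof (rule abelian_groupI)
    fix x :: "('n, 'k) free \<Rightarrow> ('n, 'k) free" assume x: "x \<in> carrier linear_endos"
    show "\<exists>y\<in>carrier linear_endos. y \<oplus>\<^bsub>linear_endos\<^esub> x = \<zero>\<^bsub>linear_endos\<^esub>"
    proof
      show "(\<lambda>v. - x v) \<in> carrier linear_endos" using x by (simp add: linear_endos_simps)
    qed (simp add: linear_endos_def)
  qed (use add in \<open>auto simp: linear_endos_def add_ac\<close>)
  show "monoid (linear_endos :: (('n, 'k) free \<Rightarrow> _) ring)"
    by (rule monoidI) (auto simp: linear_endos_def)
qed (auto simp: linear_endos_def)

definition scalar_op :: "'k::field \<Rightarrow> ('n, 'k) free \<Rightarrow> ('n, 'k) free" where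
  "scalar_op c v = free_scalar c * v"

lemma free_scalar_left_commute: "free_scalar c * (u * v) = u * (free_scalar c * v)"
  by (metis free_scalar_commute mult.assoc)

lemma free_scalar_free_scalar: "free_scalar a * (free_scalar b * v) = free_scalar (b * a) * v"
  by (subst mult.commute[of b a]) (simp only: free_scalar_simps(4) mult.assoc)

lemma scalar_op_closed: "scalar_op a \<in> carrier linear_endos"
  by (simp add: linear_endos_simps scalar_op_def distrib_left free_scalar_free_scalar mult.commute)

lemma kalg_linear_endos: "kalg linear_endos (scalar_op :: 'k::field \<Rightarrow> ('n, 'k) free \<Rightarrow> _)"
proof -
  interpret ring "linear_endos :: (('n, 'k) free \<Rightarrow> _) ring" by (rule ring_linear_endos)
  have mult: "(scalar_op (a * b) :: ('n, 'k) free \<Rightarrow> _) = scalar_op a \<otimes>\<^bsub>linear_endos\<^esub> scalar_op b" for a b :: 'k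
    by (rule ext) (simp add: linear_endos_simps(2) scalar_op_def free_scalar_simps(4) mult.assoc)
  have add: "(scalar_op (a + b) :: ('n, 'k) free \<Rightarrow> _) = scalar_op a \<oplus>\<^bsub>linear_endos\<^esub> scalar_op b" for a b :: 'k
    by (rule ext) (simp add: linear_endos_simps(5) scalar_op_def free_scalar_simps(3) distrib_right)
  have one: "(scalar_op 1 :: ('n, 'k) free \<Rightarrow> _) = \<one>\<^bsub>linear_endos\<^esub>"
    by (rule ext) (simp add: linear_endos_simps(3) scalar_op_def free_scalar_simps(2))
  show ?thesis
  proof unfold_locales
    show "(scalar_op :: 'k \<Rightarrow> ('n, 'k) free \<Rightarrow> _) \<in> ring_hom type_ring linear_endos"
      by (rule ring_hom_memI) (simp_all add: scalar_op_closed mult add one)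
    show "x \<in> carrier linear_endos \<Longrightarrow> scalar_op a \<otimes>\<^bsub>linear_endos\<^esub> x = x \<otimes>\<^bsub>linear_endos\<^esub> scalar_op a"
      for x :: "('n, 'k) free \<Rightarrow> _" and a :: 'k
      by (rule ext) (simp add: linear_endos_simps(1,2) scalar_op_def)
  qed
qed

lemma finsum_linear_endos:
  assumes "finite K" "\<And>i. i \<in> K \<Longrightarrow> f i \<in> carrier linear_endos"
  shows "(\<Oplus>\<^bsub>linear_endos\<^esub>i\<in>K. f i) v = (\<Sum>i\<in>K. f i v)"
  using assms
proof (induction K rule: finite_induct)
  interpret ring linear_endos by (rule ring_linear_endos)
  case empty then show ?case by (simp add: linear_endos_simps)
next
  interpret ring linear_endos by (rule ring_linear_endos)
  case (insert x F)
  then show ?case by (subst finsum_insert) (auto simp: linear_endos_simps(5))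
qed

lemma kalg_free: "kalg (free_algebra :: ('n, 'k::field) free ring) free_scalar"
proof -
  interpret ring "free_algebra :: ('n, 'k) free ring" by (rule ring_type_ring)
  show ?thesis
    by unfold_locales (auto intro!: ring_hom_memI free_scalar_commute simp: free_scalar_simps)
qed

section \<open>The action of the free algebra by braided derivatives\<close>

text \<open>The two identities for \<Psi> do different work: the second shows that the recursion
  defining D' solves the third relation (existence), the first recovers single products of entries
  from that relation (uniqueness).\<close>

locale weyl =
  fixes R \<Psi> :: "'k::field ^ ('n::finite \<times> 'n) ^ ('n \<times> 'n)" and h :: 'k
  assumes inv: "involutive_symmetry R" and h: "h \<noteq> 0"
    and \<Psi>: "Tr2 (on12 R ** on23 \<Psi>) = flip_mat" "Tr2 (on12 \<Psi> ** on23 R) = flip_mat"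
begin

abbreviation sc :: "'k \<Rightarrow> ('n, 'k) free" where "sc \<equiv> free_scalar"
abbreviation gN :: "'n \<Rightarrow> 'n \<Rightarrow> ('n, 'k) free" where "gN i j \<equiv> free_gen (Gen_N i j)"
abbreviation gD :: "'n \<Rightarrow> 'n \<Rightarrow> ('n, 'k) free" where "gD i j \<equiv> free_gen (Gen_D i j)"

text \<open>The entries of \<open>R N\<^sub>1 R G\<^sub>1 R + \<hbar> G\<^sub>1\<close>.\<close>

definition moved :: "('n \<Rightarrow> 'n \<Rightarrow> ('n, 'k) free) \<Rightarrow> 'n \<Rightarrow> 'n \<Rightarrow> 'n \<Rightarrow> 'n \<Rightarrow> ('n, 'k) free" where
  "moved g a b d e =
    (\<Sum>i\<in>UNIV. \<Sum>j\<in>UNIV. sc (R $ (a, b) $ (i, j)) * (\<Sum>l\<in>UNIV. gN i l *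
      (\<Sum>s\<in>UNIV. \<Sum>t\<in>UNIV. sc (R $ (l, j) $ (s, t)) * (\<Sum>u\<in>UNIV. sc (R $ (u, t) $ (d, e)) * g s u)))) +
    (if b = e then sc h * g a d else 0)"

text \<open>
  \<open>deriv_word w a x\<close> is the action of the shifted derivative on a word in the \<open>N\<close>s, obtained by solving
  \<open>D'\<^sub>1 R N\<^sub>1 = R N\<^sub>1 R D'\<^sub>1 R + \<hbar> D'\<^sub>1\<close> with the skew inverse \<open>\<Psi>\<close>; the value on words that contain
  generators \<open>Gen_D\<close> is junk.
\<close>

primrec deriv_word :: "'n gen list \<Rightarrow> 'n \<Rightarrow> 'n \<Rightarrow> ('n, 'k) free" where
  "deriv_word [] a x = sc (if a = x then inverse h else 0)"
| "deriv_word (g # w) a x = (case g of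
     Gen_N y d \<Rightarrow> (\<Sum>b\<in>UNIV. \<Sum>e\<in>UNIV. sc (\<Psi> $ (e, y) $ (b, x)) * moved (deriv_word w) a b d e)
   | Gen_D _ _ \<Rightarrow> 0)"

definition D'_op :: "'n \<Rightarrow> 'n \<Rightarrow> ('n, 'k) free \<Rightarrow> ('n, 'k) free" where
  "D'_op a x = lin_ext (\<lambda>w. deriv_word w a x)"

definition N_op :: "'n \<Rightarrow> 'n \<Rightarrow> ('n, 'k) free \<Rightarrow> ('n, 'k) free" where
  "N_op i j v = gN i j * v"

definition D_op :: "'n \<Rightarrow> 'n \<Rightarrow> ('n, 'k) free \<Rightarrow> ('n, 'k) free" where
  "D_op i j v = D'_op i j v - sc (if i = j then inverse h else 0) * v"

lemma D'_op_closed: "D'_op a x \<in> carrier linear_endos"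
  by (simp add: D'_op_def linear_endos_simps lin_ext_add lin_ext_scalar)

lemma N_op_closed: "N_op i j \<in> carrier linear_endos"
  by (simp add: N_op_def linear_endos_simps distrib_left free_scalar_left_commute)

lemma D_op_closed: "D_op i j \<in> carrier linear_endos"
  using D'_op_closed
  by (simp add: D_op_def linear_endos_simps distrib_left free_scalar_free_scalar right_diff_distrib mult.commute)

sublocale E: kalg "linear_endos :: (('n, 'k) free \<Rightarrow> _) ring" scalar_op
  by (rule kalg_linear_endos)

sublocale E: braided_data "linear_endos :: (('n, 'k) free \<Rightarrow> _) ring" scalar_op R h N_op D_op
  by unfold_locales (auto simp: inv h N_op_closed D_op_closed)

lemma E_D': "E.D' = D'_op"
  by (auto simp: fun_eq_iff E.D'_def linear_endos_simps scalar_op_def D_op_def)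

text \<open>Contracting the recursive definition with R undoes the contraction with \<Psi>, by the
  second skew-inverse identity.\<close>

lemma D'_op_Gen_N:
  "(\<Sum>x\<in>UNIV. \<Sum>y\<in>UNIV. sc (R $ (x, b) $ (y, e)) * deriv_word (Gen_N y d # w) a x) = moved (deriv_word w) a b d e"
proof -
  let ?m = "\<lambda>b e. moved (deriv_word w) a b d e"
  have "(\<Sum>x\<in>UNIV. \<Sum>y\<in>UNIV. sc (R $ (x, b) $ (y, e)) * deriv_word (Gen_N y d # w) a x)
    = (\<Sum>x\<in>UNIV. \<Sum>y\<in>UNIV. \<Sum>b'\<in>UNIV. \<Sum>e'\<in>UNIV. sc (\<Psi> $ (e', y) $ (b', x) * R $ (x, b) $ (y, e)) * ?m b' e')"
    by (simp add: sum_distrib_left free_scalar_free_scalar)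
  also have "\<dots> = (\<Sum>x\<in>UNIV. \<Sum>b'\<in>UNIV. \<Sum>y\<in>UNIV. \<Sum>e'\<in>UNIV. sc (\<Psi> $ (e', y) $ (b', x) * R $ (x, b) $ (y, e)) * ?m b' e')"
    by (intro sum.cong refl sum.swap)
  also have "\<dots> = (\<Sum>b'\<in>UNIV. \<Sum>x\<in>UNIV. \<Sum>y\<in>UNIV. \<Sum>e'\<in>UNIV. sc (\<Psi> $ (e', y) $ (b', x) * R $ (x, b) $ (y, e)) * ?m b' e')"
    by (rule sum.swap)
  also have "\<dots> = (\<Sum>b'\<in>UNIV. \<Sum>x\<in>UNIV. \<Sum>e'\<in>UNIV. \<Sum>y\<in>UNIV. sc (\<Psi> $ (e', y) $ (b', x) * R $ (x, b) $ (y, e)) * ?m b' e')"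
    by (intro sum.cong refl sum.swap)
  also have "\<dots> = (\<Sum>b'\<in>UNIV. \<Sum>e'\<in>UNIV. \<Sum>x\<in>UNIV. \<Sum>y\<in>UNIV. sc (\<Psi> $ (e', y) $ (b', x) * R $ (x, b) $ (y, e)) * ?m b' e')"
    by (intro sum.cong refl sum.swap)
  also have "\<dots> = (\<Sum>b'\<in>UNIV. \<Sum>e'\<in>UNIV. if e' = e then (if b' = b then ?m b' e' else 0) else 0)"
  proof (intro sum.cong refl)
    fix b' e'
    have "(\<Sum>x\<in>UNIV. \<Sum>y\<in>UNIV. sc (\<Psi> $ (e', y) $ (b', x) * R $ (x, b) $ (y, e)) * ?m b' e')
      = sc (\<Sum>y\<in>UNIV. \<Sum>x\<in>UNIV. \<Psi> $ (e', y) $ (b', x) * R $ (x, b) $ (y, e)) * ?m b' e'"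
      by (subst sum.swap) (simp add: free_scalar_sum sum_distrib_right)
    then show "(\<Sum>x\<in>UNIV. \<Sum>y\<in>UNIV. sc (\<Psi> $ (e', y) $ (b', x) * R $ (x, b) $ (y, e)) * ?m b' e')
      = (if e' = e then (if b' = b then ?m b' e' else 0) else 0)"
      by (auto simp: Tr2_flip_entry[OF \<Psi>(2)] free_scalar_simps)
  qed
  also have "\<dots> = ?m b e" by simp
  finally show ?thesis .
qed

end

context kalg
begin

lemma first_entry_2:
  fixes X :: "'n::finite \<Rightarrow> 'n \<Rightarrow> 's"
  assumes "\<And>i j. X i j \<in> carrier S" "B \<in> carrier (M 2)" "J \<in> multi_index 2"
  shows "(in_first S 2 X \<otimes>\<^bsub>M 2\<^esub> B) ([a, b], J) = (\<Oplus>x\<in>UNIV. X a x \<otimes> B ([x, b], J))"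
  using first_entry[of X B 1 "[b]" J a] assms by (simp add: numeral_2_eq_2[symmetric] multi_index_def)

lemma factors_entry_2:
  fixes A :: "'k ^ ('n::finite \<times> 'n) ^ ('n \<times> 'n)"
  assumes "B \<in> carrier (M 2)" "J \<in> multi_index 2"
  shows "(in_factors S \<iota> 2 A 1 \<otimes>\<^bsub>M 2\<^esub> B) ([a, b], J)
    = (\<Oplus>x\<in>UNIV. \<Oplus>y\<in>UNIV. \<iota> (A $ (a, b) $ (x, y)) \<otimes> B ([x, y], J))"
  using factors_entry[of 1 2 B "[a, b]" J A] assms by (simp add: multi_index_def)

end

context weyl
begin

abbreviation "LE \<equiv> (linear_endos :: (('n, 'k) free \<Rightarrow> ('n, 'k) free) ring)"

lemma finsum_op:
  fixes f :: "'i::finite \<Rightarrow> ('n, 'k) free \<Rightarrow> ('n, 'k) free"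
  shows "(\<And>i. f i \<in> carrier LE) \<Longrightarrow> (\<Oplus>\<^bsub>LE\<^esub>i\<in>UNIV. f i) v = (\<Sum>i\<in>UNIV. f i v)"
  by (rule finsum_linear_endos) auto

lemma D'_op_scalar: "D'_op s u (sc c * v) = sc c * D'_op s u v"
  using D'_op_closed by (auto simp: linear_endos_simps(1))

text \<open>The recursion on words had to be written in coordinates. Here its right side is
  recognised as a matrix expression over the operator algebra, so that the matrix calculus applies
  from now on.\<close>

lemma moved_entry:
  "(E.r 2 1 \<otimes>\<^bsub>E.M 2\<^esub> (E.N\<^sub>1 2 \<otimes>\<^bsub>E.M 2\<^esub> (E.r 2 1 \<otimes>\<^bsub>E.M 2\<^esub> (E.D'\<^sub>1 2 \<otimes>\<^bsub>E.M 2\<^esub> E.r 2 1))) \<oplus>\<^bsub>E.M 2\<^esub>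
    scale_mat LE scalar_op 2 h (E.D'\<^sub>1 2)) ([a, b], [d, e]) v = moved (\<lambda>s u. D'_op s u v) a b d e"
proof -
  let ?C = "E.D'\<^sub>1 2 \<otimes>\<^bsub>E.M 2\<^esub> E.r 2 1"
  let ?B = "E.r 2 1 \<otimes>\<^bsub>E.M 2\<^esub> ?C"
  let ?A = "E.N\<^sub>1 2 \<otimes>\<^bsub>E.M 2\<^esub> ?B"
  have cl: "E.r 2 1 \<in> carrier (E.M 2)" "?C \<in> carrier (E.M 2)" "?B \<in> carrier (E.M 2)" "?A \<in> carrier (E.M 2)"
    "E.D'\<^sub>1 2 \<in> carrier (E.M 2)"
    by (auto intro!: E.mult_closed E.in_factors_closed E.in_first_closed)
  have m: "[x, y] \<in> multi_index 2" for x y :: 'n by (simp add: multi_index_def)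
  have ec: "X ([x, y], [d, e]) \<in> carrier LE" if "X \<in> carrier (E.M 2)" for X and x y :: 'n
    using that m by (rule E.entry_closed) (rule m)
  have N: "E.N\<^sub>1 2 = in_first LE 2 N_op" "E.D'\<^sub>1 2 = in_first LE 2 D'_op" by (simp_all add: E_D')
  have r: "E.r 2 1 ([u, t], [d, e]) = scalar_op (R $ (u, t) $ (d, e))" for u t
    by (auto simp: in_factors_def multi_index_def less_2_cases_iff)
  have C: "?C ([s, t], [d, e]) w = (\<Sum>u\<in>UNIV. sc (R $ (u, t) $ (d, e)) * D'_op s u w)" for s t w
    by (subst E.first_entry_2) (use m cl D'_op_closed in \<open>auto simp: E_D' r[simplified] finsum_op scalar_op_closed linear_endos_simps(2) scalar_op_def D'_op_scalar\<close>)
  have B: "?B ([l, j], [d, e]) w = (\<Sum>s\<in>UNIV. \<Sum>t\<in>UNIV. sc (R $ (l, j) $ (s, t)) * ?C ([s, t], [d, e]) w)" for l j w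
    by (subst E.factors_entry_2) (use m cl ec[OF cl(2)] in \<open>auto simp: finsum_op linear_endos_simps(2) scalar_op_def intro!: E.finsum_closed\<close>)
  have A: "?A ([i, j], [d, e]) w = (\<Sum>l\<in>UNIV. gN i l * ?B ([l, j], [d, e]) w)" for i j w
    by (subst E.first_entry_2) (use m cl ec[OF cl(3)] N_op_closed in \<open>auto simp: finsum_op linear_endos_simps(2) N_op_def[abs_def]\<close>)
  have r': "(E.r 2 1 \<otimes>\<^bsub>E.M 2\<^esub> ?A) ([a, b], [d, e]) w = (\<Sum>i\<in>UNIV. \<Sum>j\<in>UNIV. sc (R $ (a, b) $ (i, j)) * ?A ([i, j], [d, e]) w)" for w
    by (subst E.factors_entry_2) (use m cl ec[OF cl(4)] in \<open>auto simp: finsum_op linear_endos_simps(2) scalar_op_def intro!: E.finsum_closed\<close>)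
  have D: "scale_mat LE scalar_op 2 h (E.D'\<^sub>1 2) ([a, b], [d, e]) v = (if b = e then sc h * D'_op a d v else 0)"
    using m by (auto simp: scale_mat_def in_first_def E_D' linear_endos_simps(2,4) scalar_op_def)
  show ?thesis
    by (simp only: E.add_entry[OF m m] linear_endos_simps(5) r' A B C D moved_def)
qed

lemma D'_op_single: "D'_op a x (Poly_Mapping.single w 1) = deriv_word w a x"
  by (simp add: D'_op_def lin_ext_single free_scalar_simps)

text \<open>Both sides are linear, so it suffices to compare them on words \<open>w\<close>, where
  the identity is the recursion for the words \<open>Gen_N y d # w\<close>. The tail is arbitrary,
  so this holds on the whole free algebra, words with D-letters included.\<close>

lemma derivation_relation:
  "E.D'\<^sub>1 2 \<otimes>\<^bsub>E.M 2\<^esub> (E.r 2 1 \<otimes>\<^bsub>E.M 2\<^esub> E.N\<^sub>1 2)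
   = E.r 2 1 \<otimes>\<^bsub>E.M 2\<^esub> (E.N\<^sub>1 2 \<otimes>\<^bsub>E.M 2\<^esub> (E.r 2 1 \<otimes>\<^bsub>E.M 2\<^esub> (E.D'\<^sub>1 2 \<otimes>\<^bsub>E.M 2\<^esub> E.r 2 1))) \<oplus>\<^bsub>E.M 2\<^esub>
    scale_mat LE scalar_op 2 h (E.D'\<^sub>1 2)" (is "?L = ?R")
proof (rule E.mat_eqI)
  show c: "?L \<in> carrier (E.M 2)" "?R \<in> carrier (E.M 2)"
    by (auto intro!: E.mult_closed E.in_factors_closed E.in_first_closed E.add_closed E.scale_closed)
  fix I J :: "'n list" assume "I \<in> multi_index 2" "J \<in> multi_index 2"
  then obtain a b d e where IJ: "I = [a, b]" "J = [d, e]" by (auto simp: E.multi_index_2)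
  show "?L (I, J) = ?R (I, J)"
  proof (rule linear_endos_ext)
    show "?L (I, J) \<in> carrier LE" "?R (I, J) \<in> carrier LE"
      using E.entry_closed[OF c(1)] E.entry_closed[OF c(2)] by (auto simp: IJ multi_index_def)
    fix w
    let ?w = "Poly_Mapping.single w 1 :: ('n, 'k) free"
    have "?L (I, J) ?w = (\<Sum>x\<in>UNIV. \<Sum>y\<in>UNIV. sc (R $ (x, b) $ (y, e)) * D'_op a x (N_op y d ?w))"
      unfolding IJ
      by (subst E.first_factors_first_entry)
        (auto simp: E_D' D'_op_closed N_op_closed finsum_op linear_endos_simps(2) scalar_op_def intro!: E.finsum_closed)
    also have "\<dots> = (\<Sum>x\<in>UNIV. \<Sum>y\<in>UNIV. sc (R $ (x, b) $ (y, e)) * deriv_word (Gen_N y d # w) a x)"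
      by (simp only: N_op_def free_single_Cons[symmetric] D'_op_single)
    also have "\<dots> = moved (deriv_word w) a b d e" by (rule D'_op_Gen_N)
    also have "\<dots> = ?R (I, J) ?w"
      unfolding IJ moved_entry by (simp only: D'_op_single)
    finally show "?L (I, J) ?w = ?R (I, J) ?w" .
  qed
qed

sublocale E: braided_system LE scalar_op R h N_op D_op
proof unfold_locales
  interpret M: ring "E.M 2 :: ('n list \<times> 'n list \<Rightarrow> _) ring" by (rule E.ring_End_tensor)
  define r n d where "r = E.r 2 1" and "n = E.N\<^sub>1 2" and "d = E.D'\<^sub>1 2"
  have cl [simp]: "r \<in> carrier (E.M 2)" "n \<in> carrier (E.M 2)" "d \<in> carrier (E.M 2)"
    by (auto simp: r_def n_def d_def intro!: E.in_factors_closed E.in_first_closed)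
  have rr: "r \<otimes>\<^bsub>E.M 2\<^esub> r = \<one>\<^bsub>E.M 2\<^esub>"
    unfolding r_def by (rule E.in_factors_invol) (auto simp: E.RR)
  have s: "scale_mat LE scalar_op 2 h x = E.scal 2 h \<otimes>\<^bsub>E.M 2\<^esub> x" if "x \<in> carrier (E.M 2)" for x :: "'n list \<times> 'n list \<Rightarrow> _"
    using that by (rule E.scale_scal(1))
  have hc: "(E.scal 2 h :: 'n list \<times> 'n list \<Rightarrow> _) \<in> carrier (E.M 2)"
    by (intro E.scale_closed E.one_closed')
  have "d \<otimes>\<^bsub>E.M 2\<^esub> (r \<otimes>\<^bsub>E.M 2\<^esub> n \<otimes>\<^bsub>E.M 2\<^esub> r) = (d \<otimes>\<^bsub>E.M 2\<^esub> (r \<otimes>\<^bsub>E.M 2\<^esub> n)) \<otimes>\<^bsub>E.M 2\<^esub> r"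
    by (simp add: M.m_assoc)
  also have "\<dots> = (r \<otimes>\<^bsub>E.M 2\<^esub> (n \<otimes>\<^bsub>E.M 2\<^esub> (r \<otimes>\<^bsub>E.M 2\<^esub> (d \<otimes>\<^bsub>E.M 2\<^esub> r))) \<oplus>\<^bsub>E.M 2\<^esub> E.scal 2 h \<otimes>\<^bsub>E.M 2\<^esub> d) \<otimes>\<^bsub>E.M 2\<^esub> r"
    using derivation_relation by (simp only: s[OF cl(3), unfolded d_def] r_def n_def d_def)
  also have "\<dots> = (r \<otimes>\<^bsub>E.M 2\<^esub> n \<otimes>\<^bsub>E.M 2\<^esub> r) \<otimes>\<^bsub>E.M 2\<^esub> d \<oplus>\<^bsub>E.M 2\<^esub> E.scal 2 h \<otimes>\<^bsub>E.M 2\<^esub> (d \<otimes>\<^bsub>E.M 2\<^esub> r)"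
    using hc by (simp add: M.l_distr M.m_assoc rr)
  also have "E.scal 2 h \<otimes>\<^bsub>E.M 2\<^esub> (d \<otimes>\<^bsub>E.M 2\<^esub> r) = scale_mat LE scalar_op 2 h (d \<otimes>\<^bsub>E.M 2\<^esub> r)"
    by (rule s[symmetric]) simp
  finally show "ND_relation LE scalar_op 2 R h N_op D_op = \<zero>\<^bsub>E.M 2\<^esub>"
    unfolding E.ND_relation_iff r_def n_def d_def .
qed

definition gen_op :: "'n gen \<Rightarrow> ('n, 'k) free \<Rightarrow> ('n, 'k) free" where
  "gen_op g = (case g of Gen_N i j \<Rightarrow> N_op i j | Gen_D i j \<Rightarrow> D_op i j)"

text \<open>The free algebra plays two roles: \<open>f\<close> is an element of the algebra that
  acts, \<open>v\<close> is a vector of the module. The vectors of interest are combinations of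
  words in the Ns.\<close>

definition rho :: "('n, 'k) free \<Rightarrow> ('n, 'k) free \<Rightarrow> ('n, 'k) free" where
  "rho f v = lin_ext (\<lambda>w. foldr gen_op w v) f"

lemma gen_op_closed: "gen_op g \<in> carrier LE"
  by (auto simp: gen_op_def N_op_closed D_op_closed split: gen.split)

lemma foldr_gen_op:
  "foldr gen_op w (u + v) = foldr gen_op w u + foldr gen_op w v"
  "foldr gen_op w (sc c * v) = sc c * foldr gen_op w v"
  using gen_op_closed by (induction w) (auto simp: linear_endos_simps(1))

lemma rho_single: "rho (Poly_Mapping.single w c) v = sc c * foldr gen_op w v"
  by (simp add: rho_def lin_ext_single)

lemma rho_add: "rho (f + g) v = rho f v + rho g v"
  by (simp add: rho_def lin_ext_add)

lemma rho_closed: "rho f \<in> carrier LE"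
proof (induction f rule: free_induct)
  case (single w c)
  show ?case
    by (simp add: linear_endos_simps(1) rho_single foldr_gen_op distrib_left free_scalar_free_scalar mult.commute)
next
  case (add u v)
  then show ?case by (simp add: linear_endos_simps(1) rho_add distrib_left)
qed

lemma rho_mult: "rho (f * g) v = rho f (rho g v)"
proof (induction f rule: free_induct)
  case (single w c)
  show ?case
  proof (induction g rule: free_induct)
    case (single w' c')
    show ?case
      by (simp add: mult_single plus_list_def rho_single foldr_gen_op free_scalar_free_scalar mult.commute)
  next
    case (add f g)
    then show ?case using rho_closed by (simp add: distrib_left rho_add linear_endos_simps(1))
  qed
next
  case (add f f')
  then show ?case by (simp add: distrib_right rho_add)
qed

lemma rho_scalar: "rho (sc c) = scalar_op c"
  by (rule ext) (simp add: free_scalar_def[of c] rho_single scalar_op_def)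

lemma rho_gen: "rho (free_gen g) = gen_op g"
  by (rule ext) (simp add: free_gen_def rho_single free_scalar_simps)

lemma rho_N: "rho (gN i j) = N_op i j" and rho_D: "rho (gD i j) = D_op i j"
  by (simp_all add: rho_gen gen_op_def)

sublocale Fr: kalg "free_algebra :: ('n, 'k) free ring" free_scalar
  by (rule kalg_free)

sublocale rho: kalg_hom "free_algebra :: ('n, 'k) free ring" free_scalar LE scalar_op rho
proof unfold_locales
  show "rho \<in> ring_hom free_algebra LE"
  proof (rule ring_hom_memI)
    have "rho 1 = scalar_op 1" using rho_scalar[of 1] by (simp add: free_scalar_simps)
    then show "rho \<one>\<^bsub>free_algebra\<^esub> = \<one>\<^bsub>LE\<^esub>" by simp
  qed (auto simp: rho_closed rho_mult rho_add fun_eq_iff linear_endos_simps(2,5))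
qed (simp add: rho_scalar)

end

lemma type_ring_uminus [simp]: "\<ominus>\<^bsub>type_ring\<^esub> x = - x"
proof -
  interpret ring "type_ring :: 'a ring" by (rule ring_type_ring)
  show ?thesis using minus_equality[of "- x" x] by simp
qed

lemma additive_subgroup_type_ring:
  assumes "0 \<in> A" "\<And>x y. x \<in> A \<Longrightarrow> y \<in> A \<Longrightarrow> x + y \<in> A" "\<And>x. x \<in> A \<Longrightarrow> - x \<in> A"
  shows "additive_subgroup A (type_ring :: 'a::ring_1 ring)"
proof -
  interpret ring "type_ring :: 'a ring" by (rule ring_type_ring)
  show ?thesis
    by (rule additive_subgroup.intro, rule add.subgroupI) (use assms in auto)
qed

section \<open>Sets that contain the entries of the relations\<close>

context kalg
begin

text \<open>Every term of the relation has a factor N, so its entries lie in any \<open>A\<close>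
  that contains the entries of N and absorbs multiplication by \<open>C\<close>. Applied to the
  elements acting by left multiplication and to those without constant term.\<close>

lemma entries_in_N_relation:
  assumes p: "2 \<le> p" and A: "additive_subgroup A S" "A \<subseteq> C" "C \<subseteq> carrier S"
    and AC: "\<And>a c. a \<in> A \<Longrightarrow> c \<in> C \<Longrightarrow> a \<otimes> c \<in> A" "\<And>a c. a \<in> A \<Longrightarrow> c \<in> C \<Longrightarrow> c \<otimes> a \<in> A"
    and X: "\<And>i j. X i j \<in> A" and \<iota>C: "\<And>c. \<iota> c \<in> C"
  shows "entries_in p A (N_relation S \<iota> p R h X)"
proof -
  define r where "r = in_factors S \<iota> p R 1"
  define N where "N = in_first S p X"
  have AS: "A \<subseteq> carrier S" using A by auto
  have r: "entries_in p C r"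
    unfolding r_def using p \<iota>C by (intro entries_in_factors) auto
  have N: "entries_in p A N"
    unfolding N_def using additive_subgroup.zero_closed[OF A(1)] AS X by (intro entries_in_first) auto
  have NC: "entries_in p C N" using N A(2) by (auto simp: entries_in_def)
  have mr: "entries_in p A (Y \<otimes>\<^bsub>M p\<^esub> Z)" if "entries_in p A Y" "entries_in p C Z" for Y Z
    using that AC A(1) by (intro entries_in_mult[of p A _ C]) auto
  have ml: "entries_in p A (Y \<otimes>\<^bsub>M p\<^esub> Z)" if "entries_in p C Y" "entries_in p A Z" for Y Z
    using that AC A(1) by (intro entries_in_mult[of p C _ A]) auto
  show ?thesis
    unfolding N_relation_def Let_def r_def[symmetric] N_def[symmetric]
    by (intro entries_in_minus A(1) entries_in_scale AC(2) \<iota>C mr[OF _ r] ml[OF r] mr[OF _ NC] N)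
qed

lemma scalars_subgroup: "additive_subgroup (range \<iota>) S"
proof (rule additive_subgroup.intro, rule add.subgroupI)
  show "\<ominus> a \<in> range \<iota>" if a: "a \<in> range \<iota>" for a
  proof -
    obtain c where c: "a = \<iota> c" using a by auto
    have "\<iota> (- c) \<oplus> \<iota> c = \<zero>"
      using \<iota>_add[of "- c" c] by simp
    then have "\<ominus> a = \<iota> (- c)"
      unfolding c by (intro minus_equality) auto
    then show ?thesis by simp
  qed
qed (auto simp flip: \<iota>_add)

text \<open>Every term ends in D or in D followed by R, so a left ideal that is stable under right
  multiplication by scalars is enough.\<close>

lemma entries_in_D_relation:
  assumes p: "2 \<le> p" and A: "additive_subgroup A S" "A \<subseteq> carrier S"
    and AC: "\<And>a c. a \<in> A \<Longrightarrow> c \<in> carrier S \<Longrightarrow> c \<otimes> a \<in> A" "\<And>a c. a \<in> A \<Longrightarrow> a \<otimes> \<iota> c \<in> A"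
    and X: "\<And>i j. X i j \<in> A"
  shows "entries_in p A (D_relation S \<iota> p R X)"
proof -
  define r where "r = in_factors S \<iota> p R 1"
  define D where "D = in_first S p X"
  have r: "entries_in p (range \<iota>) r"
    unfolding r_def using p by (intro entries_in_factors) auto
  have D: "entries_in p A D"
    unfolding D_def using additive_subgroup.zero_closed[OF A(1)] A(2) X by (intro entries_in_first) auto
  have c: "r \<in> carrier (M p)" "D \<in> carrier (M p)"
    using r D by (auto simp: entries_in_def)
  have mr: "entries_in p A (Y \<otimes>\<^bsub>M p\<^esub> r)" if "entries_in p A Y" for Y
    using that r AC A(1) by (intro entries_in_mult[of p A _ "range \<iota>"]) auto
  have ml: "entries_in p A (Y \<otimes>\<^bsub>M p\<^esub> Z)" if "Y \<in> carrier (M p)" "entries_in p A Z" for Y Z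
    using that AC A(1) by (intro entries_in_mult[of p "carrier S" _ A]) (auto intro: entries_in_carrier)
  show ?thesis
    unfolding D_relation_def Let_def r_def[symmetric] D_def[symmetric]
    by (intro entries_in_minus A(1) mr ml mult_closed c D)
qed

end

context weyl
begin

definition submodule :: "('n, 'k) free set \<Rightarrow> bool" where
  "submodule V \<longleftrightarrow> 0 \<in> V \<and> (\<forall>u\<in>V. \<forall>v\<in>V. u + v \<in> V) \<and> (\<forall>c. \<forall>v\<in>V. sc c * v \<in> V)"

text \<open>\<open>U\<close> is any set, not necessarily a submodule: it is a single vector in
  arguments about one vector at a time, and everything when the operators are to have all their
  values in \<open>V\<close>.\<close>

definition ops :: "('n, 'k) free set \<Rightarrow> ('n, 'k) free set \<Rightarrow> (('n, 'k) free \<Rightarrow> ('n, 'k) free) set" where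
  "ops U V = {f \<in> carrier LE. \<forall>v\<in>U. f v \<in> V}"

lemma LE_uminus: "f \<in> carrier LE \<Longrightarrow> (\<ominus>\<^bsub>LE\<^esub> f) v = - f v"
  using E.l_neg[of f] by (metis add_eq_0_iff2 linear_endos_simps(4,5))

lemma submodule_uminus: "submodule V \<Longrightarrow> v \<in> V \<Longrightarrow> - v \<in> V"
proof -
  assume "submodule V" "v \<in> V"
  then have "sc (- 1) * v \<in> V" by (simp add: submodule_def)
  moreover have "sc (- 1) = - 1" using free_scalar_simps(3)[of "-1" 1] by (simp add: free_scalar_simps eq_neg_iff_add_eq_0)
  ultimately show ?thesis by simp
qed

lemma ops_subgroup: "submodule V \<Longrightarrow> additive_subgroup (ops U V) LE"
proof -
  assume V: "submodule V"
  have "\<zero>\<^bsub>LE\<^esub> \<in> ops U V" using V by (simp add: ops_def linear_endos_simps(4) submodule_def)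
  then show ?thesis
    using V submodule_uminus[OF V]
    by (intro additive_subgroup.intro E.add.subgroupI) (auto simp: ops_def linear_endos_simps(5) LE_uminus submodule_def)
qed

lemma ops_mult: "f \<in> ops V V' \<Longrightarrow> g \<in> ops U V \<Longrightarrow> f \<otimes>\<^bsub>LE\<^esub> g \<in> ops U V'"
  by (auto simp: ops_def linear_endos_simps(2))

lemma ops_scalar: "submodule V \<Longrightarrow> scalar_op c \<in> ops V V"
  by (auto simp: ops_def scalar_op_closed scalar_op_def submodule_def)

lemma ops_left_scalar: "submodule V \<Longrightarrow> f \<in> ops U V \<Longrightarrow> scalar_op c \<otimes>\<^bsub>LE\<^esub> f \<in> ops U V"
  by (rule ops_mult[OF ops_scalar])

lemma ops_right_scalar: "submodule V \<Longrightarrow> f \<in> ops U V \<Longrightarrow> f \<otimes>\<^bsub>LE\<^esub> scalar_op c \<in> ops U V"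
  using ops_left_scalar[of V f U c] E.\<iota>_central[of f c] by (simp add: ops_def)

lemma ops_left_zero: "g \<in> carrier LE \<Longrightarrow> f \<in> ops U {0} \<Longrightarrow> g \<otimes>\<^bsub>LE\<^esub> f \<in> ops U {0}"
  by (rule ops_mult[of _ "{0}"]) (auto simp: ops_def linear_endos_0)

lemma submodule_zero: "submodule {0}"
  by (simp add: submodule_def)

lemma skew_ops: "submodule V \<Longrightarrow> skew_kalg LE scalar_op R \<Psi> (ops U V)"
  by (intro skew_kalg.intro skew_kalg_axioms.intro E.kalg_axioms \<Psi>(1) ops_subgroup ops_left_scalar)

section \<open>The relation among the derivatives acts by zero\<close>

lemma single_Nil_1: "Poly_Mapping.single [] 1 = (1 :: ('n, 'k) free)"
  by (simp flip: zero_list_def)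

lemma D_op_1: "D_op i j 1 = 0"
  using D'_op_single[of i j "[]"] by (simp add: D_op_def single_Nil_1)

lemma D_relation_left_ideal:
  assumes "\<And>i j. X i j \<in> ops U {0}"
  shows "E.entries_in 2 (ops U {0}) (D_relation LE scalar_op 2 R X)"
proof (rule E.entries_in_D_relation)
  show "ops U {0} \<subseteq> carrier LE" by (auto simp: ops_def)
qed (use assms in \<open>auto intro: ops_subgroup submodule_zero ops_left_zero ops_right_scalar\<close>)

text \<open>Induction on the word that the relation is applied to. For a leading N the relation is
  moved past it by \<open>d_relation_commutes\<close>, and the entries of the product are isolated
  by \<open>skew_block_first\<close>.\<close>

lemma D_relation_op:
  "E.entries_in 2 (ops {Poly_Mapping.single w 1} {0}) (D_relation LE scalar_op 2 R D'_op)"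
proof (induction w)
  case Nil
  \<comment> \<open>D' does not kill 1 but D does, and the relation is the same for both.\<close>
  have "E.entries_in 2 (ops {1} {0}) (D_relation LE scalar_op 2 R D_op)"
    by (rule D_relation_left_ideal) (simp add: ops_def D_op_1 D_op_closed)
  then show ?case using E.D_relation_shift[of 2] by (simp add: E_D' single_Nil_1)
next
  case (Cons g w)
  show ?case
  proof (cases g)
    case (Gen_D i j)
    have "D'_op a x (Poly_Mapping.single (g # w) 1) = 0" for a x by (simp add: D'_op_single Gen_D)
    then show ?thesis
      by (intro D_relation_left_ideal) (simp add: ops_def D'_op_closed)
  next
    case (Gen_N i j)
    let ?A = "ops {Poly_Mapping.single w 1} {0}"
    interpret M: ring "E.M 3 :: ('n list \<times> 'n list \<Rightarrow> _) ring" by (rule E.ring_End_tensor)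
    interpret B: braided_ring "E.M 3" 3 "E.r 3" "E.N\<^sub>1 3" "E.D'\<^sub>1 3" "E.scal 3 h"
      by (rule E.braided_ring) simp
    interpret s: skew_kalg LE scalar_op R \<Psi> ?A by (rule skew_ops[OF submodule_zero])
    define z where "z = D_relation LE scalar_op 2 R D'_op"
    have zA: "E.entries_in 2 ?A z" using Cons by (simp add: z_def)
    then have zc: "z \<in> carrier (E.M 2)" by (simp add: E.entries_in_def)
    have z3: "E.emb 3 z = D_relation LE scalar_op 3 R D'_op"
      unfolding z_def by (rule E.emb_D_relation) (auto simp: D'_op_closed)
    have A0: "\<zero>\<^bsub>LE\<^esub> \<in> ?A"
      using additive_subgroup.zero_closed[OF ops_subgroup[OF submodule_zero]] by blast
    have z3A: "E.entries_in 3 ?A (E.emb 3 z)"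
      using zA A0 zc by (auto simp: E.entries_in_def E.emb_closed) (auto simp: E.emb_def local_mat_def multi_index_def)
    \<comment> \<open>On the right each term is \<open>z\<close> with arbitrary operators before it
      and scalar matrices after it, so by the induction hypothesis its entries kill the word
      \<open>w\<close>.\<close>
    have eq: "E.emb 3 z \<otimes>\<^bsub>E.M 3\<^esub> (E.r 3 2 \<otimes>\<^bsub>E.M 3\<^esub> (E.r 3 1 \<otimes>\<^bsub>E.M 3\<^esub> E.N\<^sub>1 3))
      = (B.nb 3 \<otimes>\<^bsub>E.M 3\<^esub> E.emb 3 z \<oplus>\<^bsub>E.M 3\<^esub> E.scal 3 h \<otimes>\<^bsub>E.M 3\<^esub> (E.emb 3 z \<otimes>\<^bsub>E.M 3\<^esub> (E.r 3 2 \<oplus>\<^bsub>E.M 3\<^esub> B.rp 1 3)))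
        \<otimes>\<^bsub>E.M 3\<^esub> (E.r 3 2 \<otimes>\<^bsub>E.M 3\<^esub> E.r 3 1)"
      using B.d_relation_commutes[OF order_refl] unfolding z3 D_relation_def Let_def E_D' .
    have sub: "additive_subgroup (range scalar_op) LE" by (rule E.scalars_subgroup)
    have r: "E.entries_in 3 (range scalar_op) (E.r 3 1)" "E.entries_in 3 (range scalar_op) (E.r 3 2)"
      by (intro E.entries_in_factors; simp)+
    have ss: "E.entries_in 3 (range scalar_op) (X \<otimes>\<^bsub>E.M 3\<^esub> Y)"
      if "E.entries_in 3 (range scalar_op) X" "E.entries_in 3 (range scalar_op) Y" for X Y :: "'n list \<times> 'n list \<Rightarrow> _"
      using that sub by (intro E.entries_in_mult[where B = "range scalar_op" and C = "range scalar_op"])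
        (auto simp flip: E.\<iota>_mult)
    have rp: "E.entries_in 3 (range scalar_op) (B.rp 1 3)"
      unfolding B.d_nb_3(3)[OF order_refl] by (intro ss r)
    have As: "E.entries_in 3 ?A (X \<otimes>\<^bsub>E.M 3\<^esub> Y)"
      if "E.entries_in 3 ?A X" "E.entries_in 3 (range scalar_op) Y" for X Y :: "'n list \<times> 'n list \<Rightarrow> _"
      using that ops_right_scalar[OF submodule_zero] ops_subgroup[OF submodule_zero]
      by (intro E.entries_in_mult[where B = ?A and C = "range scalar_op"]) auto
    have cA: "E.entries_in 3 ?A (X \<otimes>\<^bsub>E.M 3\<^esub> Y)"
      if "X \<in> carrier (E.M 3)" "E.entries_in 3 ?A Y" for X Y :: "'n list \<times> 'n list \<Rightarrow> _"
      using that ops_left_zero ops_subgroup[OF submodule_zero]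
      by (intro E.entries_in_mult[where B = "carrier LE" and C = ?A]) (auto intro: E.entries_in_carrier)
    have "E.entries_in 3 ?A (E.emb 3 z \<otimes>\<^bsub>E.M 3\<^esub> (E.r 3 2 \<otimes>\<^bsub>E.M 3\<^esub> (E.r 3 1 \<otimes>\<^bsub>E.M 3\<^esub> E.N\<^sub>1 3)))"
      unfolding eq
      by (intro As E.entries_in_add cA ss r rp E.entries_in_add[OF sub] z3A ops_subgroup submodule_zero B.nb_closed B.c_closed) auto
    then have "z ([a, b], [x, y]) \<otimes>\<^bsub>LE\<^esub> N_op u d \<in> ?A" for a b x y u d
      by (intro s.skew_block_first N_op_closed zc)
    then have "z ([a, b], [x, y]) (Poly_Mapping.single (g # w) 1) = 0" for a b x y
      by (auto simp: ops_def linear_endos_simps(2) N_op_def Gen_N free_single_Cons)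
    then show ?thesis
      using zc E.entry_closed[OF zc]
      by (auto simp: E.entries_in_def ops_def E.multi_index_2 z_def)
  qed
qed

lemma D_relation_zero: "D_relation LE scalar_op 2 R D_op = \<zero>\<^bsub>E.M 2\<^esub>"
proof (rule E.entries_in_zero)
  have z: "E.entries_in 2 (ops {Poly_Mapping.single w 1} {0}) (D_relation LE scalar_op 2 R D_op)" for w
    using D_relation_op[of w] E.D_relation_shift[of 2] by (simp add: E_D')
  then have c: "D_relation LE scalar_op 2 R D_op \<in> carrier (E.M 2)" by (simp add: E.entries_in_def)
  have "D_relation LE scalar_op 2 R D_op (I, J) = \<zero>\<^bsub>LE\<^esub>" if "I \<in> multi_index 2" "J \<in> multi_index 2" for I J
    by (rule linear_endos_ext) (use z c that in \<open>auto simp: E.entries_in_def ops_def linear_endos_simps(4)\<close>)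
  then show "E.entries_in 2 {\<zero>\<^bsub>LE\<^esub>} (D_relation LE scalar_op 2 R D_op)"
    using c by (simp add: E.entries_in_def)
qed

section \<open>The ideal of relations among the \<open>N\<close>s is stable\<close>

definition N_rel :: "('n list \<times> 'n list \<Rightarrow> ('n, 'k) free)" where
  "N_rel = N_relation free_algebra free_scalar 2 R h gN"

text \<open>The arbitrary right factor is built into the generators and left factors are restricted
  to Ns. With this shape stability under D' needs two arguments only: one for the relation itself
  and one for passing a single N. Left multiplication by a D-letter is not included; D acts through
  \<open>D_op\<close> instead.\<close>

inductive_set N_ideal :: "('n, 'k) free set" where
  rel: "I \<in> multi_index 2 \<Longrightarrow> J \<in> multi_index 2 \<Longrightarrow> N_rel (I, J) * v \<in> N_ideal"
| add: "u \<in> N_ideal \<Longrightarrow> v \<in> N_ideal \<Longrightarrow> u + v \<in> N_ideal"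
| scalar: "v \<in> N_ideal \<Longrightarrow> sc c * v \<in> N_ideal"
| gen: "v \<in> N_ideal \<Longrightarrow> gN i j * v \<in> N_ideal"

lemma submodule_N_ideal: "submodule N_ideal"
proof -
  have "N_rel ([undefined, undefined], [undefined, undefined]) * 0 \<in> N_ideal"
    by (rule N_ideal.rel) (auto simp: multi_index_def)
  then show ?thesis by (auto simp: submodule_def intro: N_ideal.add N_ideal.scalar)
qed

text \<open>Only the inclusion of the subalgebra generated by the \<open>N\<close>s in this subalgebra is needed.\<close>

definition N_words :: "('n, 'k) free set" where
  "N_words = {f. \<forall>v. rho f v = f * v}"

lemma gN_N_words: "gN i j \<in> N_words"
  by (simp add: N_words_def rho_N N_op_def)

lemma scalar_N_words: "sc c \<in> N_words"
  by (simp add: N_words_def rho_scalar scalar_op_def)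

lemma N_words_mult: "f \<in> N_words \<Longrightarrow> g \<in> N_words \<Longrightarrow> f * g \<in> N_words"
  by (simp add: N_words_def rho_mult mult.assoc)

lemma N_words_add: "f \<in> N_words \<Longrightarrow> g \<in> N_words \<Longrightarrow> f + g \<in> N_words"
  by (simp add: N_words_def rho_add distrib_right)

lemma sc_minus_1: "sc (- 1) = - 1"
  using free_scalar_simps(3)[of "-1" 1] by (simp add: free_scalar_simps eq_neg_iff_add_eq_0)

lemma N_words_uminus: "f \<in> N_words \<Longrightarrow> - f \<in> N_words"
  using N_words_mult[OF scalar_N_words[of "- 1"]] by (simp add: sc_minus_1)

lemma N_words_subgroup: "additive_subgroup N_words (free_algebra :: ('n, 'k) free ring)"
  using scalar_N_words[of 0] by (intro additive_subgroup_type_ring N_words_add N_words_uminus) (simp_all add: free_scalar_simps)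

lemma N_rel_N_words: "I \<in> multi_index 2 \<Longrightarrow> J \<in> multi_index 2 \<Longrightarrow> N_rel (I, J) \<in> N_words"
proof -
  have "Fr.entries_in 2 N_words N_rel"
    unfolding N_rel_def
    by (rule Fr.entries_in_N_relation[where C = N_words])
      (auto intro: N_words_subgroup N_words_mult gN_N_words scalar_N_words)
  then show "I \<in> multi_index 2 \<Longrightarrow> J \<in> multi_index 2 \<Longrightarrow> N_rel (I, J) \<in> N_words"
    by (rule Fr.entries_inD)
qed

lemma N_rel_lookup: "I \<in> multi_index 2 \<Longrightarrow> J \<in> multi_index 2 \<Longrightarrow> Poly_Mapping.lookup (N_rel (I, J)) [] = 0"
proof -
  let ?A = "{f :: ('n, 'k) free. Poly_Mapping.lookup f [] = 0}"
  have "Fr.entries_in 2 ?A N_rel"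
    unfolding N_rel_def
  proof (rule Fr.entries_in_N_relation[where C = UNIV])
    show "additive_subgroup ?A free_algebra"
      by (rule additive_subgroup_type_ring) (auto simp: lookup_add)
    show "gN i j \<in> ?A" for i j by (simp add: free_gen_def lookup_single)
  qed (auto simp: lookup_mult_Nil)
  then show "I \<in> multi_index 2 \<Longrightarrow> J \<in> multi_index 2 \<Longrightarrow> Poly_Mapping.lookup (N_rel (I, J)) [] = 0"
    using Fr.entries_inD by blast
qed

lemma N_ideal_lookup: "v \<in> N_ideal \<Longrightarrow> Poly_Mapping.lookup v [] = 0"
  by (induction rule: N_ideal.induct) (auto simp: lookup_mult_Nil N_rel_lookup lookup_add)

lemma N_rel_op:
  "N_relation LE scalar_op 2 R h N_op = map_mat 2 rho N_rel"
  unfolding N_rel_def using rho.map_relations(1)[of 2 gN gN R h] by (simp add: rho_N)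

lemma N_rel_ops: "E.entries_in 2 (ops UNIV N_ideal) (N_relation LE scalar_op 2 R h N_op)"
proof -
  have "N_relation LE scalar_op 2 R h N_op \<in> carrier (E.M 2)"
    by (rule E.relations_closed) (auto simp: N_op_closed)
  moreover have "map_mat 2 rho N_rel (I, J) \<in> ops UNIV N_ideal" if "I \<in> multi_index 2" "J \<in> multi_index 2" for I J
    using that N_rel_N_words[OF that] rho_closed
    by (simp add: map_mat_entry ops_def N_words_def N_ideal.rel)
  ultimately show ?thesis by (simp add: E.entries_in_def N_rel_op)
qed

lemma D'_op_N_rel:
  assumes IJ: "I \<in> multi_index 2" "J \<in> multi_index 2"
  shows "D'_op a x (N_rel (I, J) * v) \<in> N_ideal"
proof -
  let ?A = "ops UNIV N_ideal"
  interpret M: ring "E.M 3 :: ('n list \<times> 'n list \<Rightarrow> _) ring" by (rule E.ring_End_tensor)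
  interpret B: braided_ring "E.M 3" 3 "E.r 3" "E.N\<^sub>1 3" "E.D'\<^sub>1 3" "E.scal 3 h"
    by (rule E.braided_ring) simp
  interpret s: skew_kalg LE scalar_op R \<Psi> ?A by (rule skew_ops[OF submodule_N_ideal])
  define q where "q = N_relation LE scalar_op 2 R h N_op"
  have qA: "E.entries_in 2 ?A q" unfolding q_def by (rule N_rel_ops)
  then have qc: "q \<in> carrier (E.M 2)" by (simp add: E.entries_in_def)
  have q3: "E.emb 3 q = N_relation LE scalar_op 3 R h N_op"
    unfolding q_def by (rule E.emb_N_relation) (auto simp: N_op_closed)
  have A0: "\<zero>\<^bsub>LE\<^esub> \<in> ?A"
    using additive_subgroup.zero_closed[OF ops_subgroup[OF submodule_N_ideal]] by blast
  have q3A: "E.entries_in 3 ?A (E.emb 3 q)"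
    using qA A0 qc by (auto simp: E.entries_in_def E.emb_closed) (auto simp: E.emb_def local_mat_def multi_index_def)
  have rc: "E.r 3 1 \<in> carrier (E.M 3)" "E.r 3 2 \<in> carrier (E.M 3)"
    by (auto intro!: B.r_closed)
  have sc: "scale_mat LE scalar_op 3 h (E.r 3 1 \<otimes>\<^bsub>E.M 3\<^esub> E.N\<^sub>1 3 \<ominus>\<^bsub>E.M 3\<^esub> E.N\<^sub>1 3 \<otimes>\<^bsub>E.M 3\<^esub> E.r 3 1)
    = E.scal 3 h \<otimes>\<^bsub>E.M 3\<^esub> (E.r 3 1 \<otimes>\<^bsub>E.M 3\<^esub> E.N\<^sub>1 3 \<ominus>\<^bsub>E.M 3\<^esub> E.N\<^sub>1 3 \<otimes>\<^bsub>E.M 3\<^esub> E.r 3 1)"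
    by (rule E.scale_scal(1)) (use rc in auto)
  \<comment> \<open>On the right \<open>q\<close>, whose values all lie in \<open>N_ideal\<close>,
    is preceded by scalar matrices only; what follows it may be any operator, since
    \<open>ops UNIV\<close> allows any argument.\<close>
  have eq: "E.D'\<^sub>1 3 \<otimes>\<^bsub>E.M 3\<^esub> (E.r 3 1 \<otimes>\<^bsub>E.M 3\<^esub> (E.r 3 2 \<otimes>\<^bsub>E.M 3\<^esub> E.emb 3 q))
    = (E.r 3 1 \<otimes>\<^bsub>E.M 3\<^esub> (E.r 3 2 \<otimes>\<^bsub>E.M 3\<^esub> (E.emb 3 q \<otimes>\<^bsub>E.M 3\<^esub> (E.r 3 2 \<otimes>\<^bsub>E.M 3\<^esub> (E.r 3 1 \<otimes>\<^bsub>E.M 3\<^esub> E.D'\<^sub>1 3)))))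
      \<otimes>\<^bsub>E.M 3\<^esub> (E.r 3 1 \<otimes>\<^bsub>E.M 3\<^esub> E.r 3 2)"
    using B.d_commutes_with_relation[OF order_refl] unfolding q3 N_relation_def Let_def sc .
  have r: "E.entries_in 3 (range scalar_op) (E.r 3 1)" "E.entries_in 3 (range scalar_op) (E.r 3 2)"
    by (intro E.entries_in_factors; simp)+
  have sA: "E.entries_in 3 ?A (X \<otimes>\<^bsub>E.M 3\<^esub> Y)"
    if "E.entries_in 3 (range scalar_op) X" "E.entries_in 3 ?A Y" for X Y :: "'n list \<times> 'n list \<Rightarrow> _"
    using that ops_left_scalar[OF submodule_N_ideal] ops_subgroup[OF submodule_N_ideal]
    by (intro E.entries_in_mult[where B = "range scalar_op" and C = ?A]) auto
  have Ac: "E.entries_in 3 ?A (X \<otimes>\<^bsub>E.M 3\<^esub> Y)"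
    if "E.entries_in 3 ?A X" "Y \<in> carrier (E.M 3)" for X Y :: "'n list \<times> 'n list \<Rightarrow> _"
  proof (rule E.entries_in_mult[where B = ?A and C = "carrier LE"])
    show "b \<otimes>\<^bsub>LE\<^esub> c \<in> ?A" if "b \<in> ?A" "c \<in> carrier LE" for b c
      using that by (intro ops_mult[of _ UNIV]) (auto simp: ops_def)
  qed (use that ops_subgroup[OF submodule_N_ideal] in \<open>auto intro: E.entries_in_carrier\<close>)
  have "E.entries_in 3 ?A (E.D'\<^sub>1 3 \<otimes>\<^bsub>E.M 3\<^esub> (E.r 3 1 \<otimes>\<^bsub>E.M 3\<^esub> (E.r 3 2 \<otimes>\<^bsub>E.M 3\<^esub> E.emb 3 q)))"
    unfolding eq by (intro Ac sA r q3A M.m_closed rc B.d_closed)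
  then have "D'_op a w \<otimes>\<^bsub>LE\<^esub> q ([x, u], [d, e]) \<in> ?A" for a w x u d e
    unfolding E_D' by (intro s.skew_first_block D'_op_closed qc)
  then have "D'_op a x (q (I, J) v) \<in> N_ideal"
    using IJ by (auto simp: ops_def linear_endos_simps(2) E.multi_index_2)
  moreover have "q (I, J) v = N_rel (I, J) * v"
    using N_rel_N_words[OF IJ] IJ by (simp add: q_def N_rel_op map_mat_entry N_words_def)
  ultimately show ?thesis by simp
qed

lemma D'_op_N_ideal: "v \<in> N_ideal \<Longrightarrow> D'_op a x v \<in> N_ideal"
proof (induction arbitrary: a x rule: N_ideal.induct)
  case (rel I J v) then show ?case by (rule D'_op_N_rel)
next
  case (add u v) then show ?case using D'_op_closed by (auto simp: linear_endos_simps(1) intro: N_ideal.add)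
next
  case (scalar v c) then show ?case by (simp add: D'_op_scalar N_ideal.scalar)
next
  \<comment> \<open>The right side of \<open>derivation_relation\<close> sends \<open>v\<close> into
    \<open>N_ideal\<close>: each term applies D' first, up to scalars, which is the induction
    hypothesis, and then at most one N. Skew-invertibility passes from D' R N to the single products
    D' N.\<close>
  case (gen v i j)
  let ?A = "ops {v} N_ideal"
  interpret s: skew_kalg LE scalar_op R \<Psi> ?A by (rule skew_ops[OF submodule_N_ideal])
  have r: "E.entries_in 2 (range scalar_op) (E.r 2 1)"
    by (intro E.entries_in_factors) auto
  have D: "E.entries_in 2 ?A (E.D'\<^sub>1 2)"
    unfolding E_D' using gen.IH additive_subgroup.zero_closed[OF ops_subgroup[OF submodule_N_ideal]]
    by (intro E.entries_in_first) (auto simp: ops_def D'_op_closed)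
  have N: "E.entries_in 2 (ops N_ideal N_ideal) (E.N\<^sub>1 2)"
    using additive_subgroup.zero_closed[OF ops_subgroup[OF submodule_N_ideal]]
    by (intro E.entries_in_first) (auto simp: ops_def N_op_closed N_op_def N_ideal.gen)
  have As: "E.entries_in 2 ?A (X \<otimes>\<^bsub>E.M 2\<^esub> E.r 2 1)" if "E.entries_in 2 ?A X" for X
    using that r ops_right_scalar[OF submodule_N_ideal] ops_subgroup[OF submodule_N_ideal]
    by (intro E.entries_in_mult[where B = ?A and C = "range scalar_op"]) auto
  have sA: "E.entries_in 2 ?A (E.r 2 1 \<otimes>\<^bsub>E.M 2\<^esub> X)" if "E.entries_in 2 ?A X" for X
    using that r ops_left_scalar[OF submodule_N_ideal] ops_subgroup[OF submodule_N_ideal]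
    by (intro E.entries_in_mult[where C = ?A and B = "range scalar_op"]) auto
  have NA: "E.entries_in 2 ?A (E.N\<^sub>1 2 \<otimes>\<^bsub>E.M 2\<^esub> X)" if "E.entries_in 2 ?A X" for X
    using that N ops_mult ops_subgroup[OF submodule_N_ideal]
    by (intro E.entries_in_mult[where C = ?A and B = "ops N_ideal N_ideal"]) auto
  have "E.entries_in 2 ?A (E.D'\<^sub>1 2 \<otimes>\<^bsub>E.M 2\<^esub> (E.r 2 1 \<otimes>\<^bsub>E.M 2\<^esub> E.N\<^sub>1 2))"
    unfolding derivation_relation
    by (intro E.entries_in_add E.entries_in_scale As sA NA D ops_left_scalar submodule_N_ideal ops_subgroup)
  then have "D'_op a x \<otimes>\<^bsub>LE\<^esub> N_op i j \<in> ?A"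
    unfolding E_D' by (intro s.skew_first_first N_op_closed D'_op_closed)
  then show ?case by (simp add: ops_def linear_endos_simps(2) N_op_def)
qed

lemma rho_N_ideal: "v \<in> N_ideal \<Longrightarrow> rho f v \<in> N_ideal"
proof (induction f rule: free_induct)
  case (single w c)
  have g: "gen_op g u \<in> N_ideal" if "u \<in> N_ideal" for g u
  proof (cases g)
    case (Gen_N i j) then show ?thesis using that by (simp add: gen_op_def N_op_def N_ideal.gen)
  next
    case (Gen_D i j)
    have "D'_op i j u + - (sc (if i = j then inverse h else 0) * u) \<in> N_ideal"
      using that by (intro N_ideal.add D'_op_N_ideal submodule_uminus submodule_N_ideal N_ideal.scalar)
    then show ?thesis by (simp add: Gen_D gen_op_def D_op_def)
  qed
  have "foldr gen_op w v \<in> N_ideal" using single g by (induction w) auto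
  then show ?case by (simp add: rho_single N_ideal.scalar)
next
  case (add f g) then show ?case by (simp add: rho_add N_ideal.add)
qed

text \<open>The elements acting with values in \<open>N_ideal\<close> form a two-sided ideal: closed
  on the right because the argument \<open>v\<close> is arbitrary, on the left by
  \<open>rho_N_ideal\<close>. So it is enough to test the defining relations, two of which even act
  by zero.\<close>

lemma weyl_ideal_acts: "f \<in> weyl_ideal R h \<Longrightarrow> rho f v \<in> N_ideal"
proof -
  let ?K = "{f. \<forall>v. rho f v \<in> N_ideal}"
  have neg: "rho (- f) v = - rho f v" for f v
  proof -
    have "rho (sc (- 1) * f) v = sc (- 1) * rho f v" by (simp only: rho_mult rho_scalar scalar_op_def)
    then show ?thesis by (simp add: sc_minus_1)
  qed
  have K: "additive_subgroup ?K (free_algebra :: ('n, 'k) free ring)"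
    using submodule_N_ideal submodule_uminus[OF submodule_N_ideal]
    by (intro additive_subgroup_type_ring) (auto simp: rho_add neg N_ideal.add submodule_def rho_def[of 0] lin_ext_def)
  have "ideal ?K (free_algebra :: ('n, 'k) free ring)"
    by (rule idealI[OF ring_type_ring additive_subgroup.a_subgroup[OF K]]) (auto simp: rho_mult rho_N_ideal)
  moreover have "weyl_relations R h \<subseteq> ?K"
  proof -
    have 1: "rho (N_rel (I, J)) v \<in> N_ideal" if "I \<in> multi_index 2" "J \<in> multi_index 2" for I J v
      using N_rel_N_words[OF that] that by (simp add: N_words_def N_ideal.rel)
    have 0: "0 \<in> N_ideal" using submodule_N_ideal by (simp add: submodule_def)
    have 2: "rho (D_relation free_algebra free_scalar 2 R gD (I, J)) v = 0"
      if "I \<in> multi_index 2" "J \<in> multi_index 2" for I J v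
    proof -
      have "map_mat 2 rho (D_relation free_algebra free_scalar 2 R gD) = D_relation LE scalar_op 2 R D_op"
        using rho.map_relations(2)[of 2 gD gD R] by (simp add: rho_D)
      then have "rho (D_relation free_algebra free_scalar 2 R gD (I, J)) = \<zero>\<^bsub>LE\<^esub>"
        using map_mat_entry[OF that, of rho] E.zero_entry[OF that] by (metis D_relation_zero)
      then show ?thesis by (simp add: linear_endos_simps(4))
    qed
    have 3: "rho (ND_relation free_algebra free_scalar 2 R h gN gD (I, J)) v = 0"
      if "I \<in> multi_index 2" "J \<in> multi_index 2" for I J v
    proof -
      have "map_mat 2 rho (ND_relation free_algebra free_scalar 2 R h gN gD) = ND_relation LE scalar_op 2 R h N_op D_op"
        using rho.map_relations(3)[of 2 gN gD R h] by (simp add: rho_D rho_N)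
      then have "rho (ND_relation free_algebra free_scalar 2 R h gN gD (I, J)) = \<zero>\<^bsub>LE\<^esub>"
        using map_mat_entry[OF that, of rho] E.zero_entry[OF that] by (metis E.ND)
      then show ?thesis by (simp add: linear_endos_simps(4))
    qed
    show ?thesis
      using 0 1 unfolding weyl_relations_eq[OF E.RR] by (auto simp: 2 3 N_rel_def)
  qed
  ultimately have "weyl_ideal R h \<subseteq> ?K"
    unfolding weyl_ideal_def by (rule Fr.genideal_minimal)
  then show "f \<in> weyl_ideal R h \<Longrightarrow> rho f v \<in> N_ideal" by auto
qed

end

section \<open>The Weyl algebra\<close>

context ring
begin

text \<open>An inductive description makes closure properties provable by induction;
  \<open>product_span_sum\<close> translates it into the indexed sums of
  \<open>normal_ordered_value\<close>.\<close>

inductive_set product_span :: "'a set \<Rightarrow> 'a set \<Rightarrow> 'a set" for X Y where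
  zero: "\<zero> \<in> product_span X Y"
| step: "x \<in> X \<Longrightarrow> y \<in> Y \<Longrightarrow> w \<in> product_span X Y \<Longrightarrow> x \<otimes> y \<oplus> w \<in> product_span X Y"

lemma product_span_closed:
  assumes "X \<subseteq> carrier R" "Y \<subseteq> carrier R"
  shows "w \<in> product_span X Y \<Longrightarrow> w \<in> carrier R"
  by (induction rule: product_span.induct) (use assms in auto)

lemma product_span_prod:
  assumes "X \<subseteq> carrier R" "Y \<subseteq> carrier R" "x \<in> X" "y \<in> Y"
  shows "x \<otimes> y \<in> product_span X Y"
proof -
  have "x \<in> carrier R" "y \<in> carrier R" using assms by auto
  then show ?thesis using product_span.step[OF assms(3,4) product_span.zero] by simp
qed

lemma product_span_subgroup:
  assumes X: "additive_subgroup X R" and Y: "Y \<subseteq> carrier R"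
  shows "additive_subgroup (product_span X Y) R"
proof -
  interpret X: additive_subgroup X R by fact
  have XR: "X \<subseteq> carrier R" by (rule X.a_subset)
  note cl = product_span_closed[OF XR Y]
  show ?thesis
  proof (rule additive_subgroup.intro, rule add.subgroupI)
    show "\<ominus> a \<in> product_span X Y" if "a \<in> product_span X Y" for a
      using that
    proof (induction rule: product_span.induct)
      case (step x y w)
      have "x \<in> carrier R" "y \<in> carrier R" "w \<in> carrier R" using step XR Y cl by auto
      then have "\<ominus> (x \<otimes> y \<oplus> w) = (\<ominus> x) \<otimes> y \<oplus> \<ominus> w"
        by (simp add: minus_add l_minus)
      then show ?case using step by (auto intro: product_span.step X.a_inv_closed)
    qed (simp add: product_span.zero)
    show "a \<oplus> b \<in> product_span X Y" if "a \<in> product_span X Y" "b \<in> product_span X Y" for a b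
      using that(1)
    proof (induction rule: product_span.induct)
      case (step x y w)
      have "x \<otimes> y \<oplus> w \<oplus> b = x \<otimes> y \<oplus> (w \<oplus> b)"
        using step XR Y cl that by (intro a_assoc) auto
      then show ?case using step by (auto intro: product_span.step)
    qed (use that cl in simp)
  qed (use cl product_span.zero in auto)
qed

lemma product_span_left:
  assumes "X \<subseteq> carrier R" "Y \<subseteq> carrier R" "a \<in> carrier R" "\<And>x. x \<in> X \<Longrightarrow> a \<otimes> x \<in> X"
    and "w \<in> product_span X Y"
  shows "a \<otimes> w \<in> product_span X Y"
  using assms(5)
proof (induction rule: product_span.induct)
  case (step x y w)
  have "x \<in> carrier R" "y \<in> carrier R" "w \<in> carrier R"
    using step assms product_span_closed[OF assms(1,2)] by auto
  then have "a \<otimes> (x \<otimes> y \<oplus> w) = (a \<otimes> x) \<otimes> y \<oplus> a \<otimes> w"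
    using assms(3) by (simp add: r_distr m_assoc)
  then show ?case using step assms by (auto intro: product_span.step)
qed (use assms product_span.zero in auto)

lemma product_span_mono: "w \<in> product_span X Y \<Longrightarrow> Y \<subseteq> Y' \<Longrightarrow> w \<in> product_span X Y'"
  by (induction rule: product_span.induct) (auto intro: product_span.zero product_span.step dest: subsetD)

lemma product_span_sum:
  assumes "X \<subseteq> carrier R" "Y \<subseteq> carrier R" "w \<in> product_span X Y"
  shows "\<exists>(l::nat) x y. (\<forall>t<l. x t \<in> X \<and> y t \<in> Y) \<and> w = (\<Oplus>t\<in>{..<l}. x t \<otimes> y t)"
  using assms(3)
proof (induction rule: product_span.induct)
  case zero
  show ?case by (rule exI[of _ 0]) simp
next
  case (step a b w)
  then obtain l x y where xy: "\<forall>t<l::nat. x t \<in> X \<and> y t \<in> Y" and w: "w = (\<Oplus>t\<in>{..<l}. x t \<otimes> y t)"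
    by blast
  let ?x = "x(l := a)" and ?y = "y(l := b)"
  have cl: "a \<in> carrier R" "b \<in> carrier R" "\<And>t. t < l \<Longrightarrow> x t \<in> carrier R \<and> y t \<in> carrier R"
    using xy step assms(1,2) by auto
  have "(\<Oplus>t\<in>{..<Suc l}. ?x t \<otimes> ?y t) = a \<otimes> b \<oplus> (\<Oplus>t\<in>{..<l}. ?x t \<otimes> ?y t)"
    unfolding lessThan_Suc using cl by (subst finsum_insert) auto
  also have "(\<Oplus>t\<in>{..<l}. ?x t \<otimes> ?y t) = w"
    unfolding w using cl by (intro finsum_cong') auto
  finally have "a \<otimes> b \<oplus> w = (\<Oplus>t\<in>{..<Suc l}. ?x t \<otimes> ?y t)" by simp
  moreover have "\<forall>t<Suc l. ?x t \<in> X \<and> ?y t \<in> Y" using xy step by (auto simp: less_Suc_eq)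
  ultimately show ?case by blast
qed

end

context weyl
begin

abbreviation W where "W \<equiv> weyl_algebra R h"
abbreviation \<iota> where "\<iota> \<equiv> weyl_scalar R h"
abbreviation cls where "cls f \<equiv> weyl_ideal R h +>\<^bsub>free_algebra\<^esub> f"

lemma weyl_ideal_ideal: "ideal (weyl_ideal R h) (free_algebra :: ('n, 'k) free ring)"
  unfolding weyl_ideal_def by (rule Fr.genideal_ideal) simp

lemma cls_hom: "(\<lambda>f. cls f) \<in> ring_hom free_algebra W"
  unfolding weyl_algebra_def using ideal.rcos_ring_hom[OF weyl_ideal_ideal] by simp

lemma carrier_W: "carrier W = range (\<lambda>f. cls f)"
  by (auto simp: weyl_algebra_def FactRing_def A_RCOSETS_defs a_r_coset_def)

lemma ring_W: "ring W"
  unfolding weyl_algebra_def by (rule ideal.quotient_is_ring[OF weyl_ideal_ideal])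

lemma cls_eq_iff: "cls f = cls g \<longleftrightarrow> f - g \<in> weyl_ideal R h"
  using Fr.quotient_eq_iff_same_a_r_cos[OF weyl_ideal_ideal, of f g] by (simp add: a_minus_def)

lemma kalg_W: "kalg W \<iota>"
proof -
  interpret W: ring W by (rule ring_W)
  have cm: "cls (f * g) = cls f \<otimes>\<^bsub>W\<^esub> cls g" for f g :: "('n, 'k) free"
    using ring_hom_mult[OF cls_hom, of f g] by simp
  show ?thesis
  proof unfold_locales
    show "\<iota> \<in> ring_hom type_ring W"
      using ring_hom_trans[OF Fr.\<iota>_hom cls_hom] by (simp add: weyl_scalar_def[abs_def] comp_def)
    show "\<iota> a \<otimes>\<^bsub>W\<^esub> x = x \<otimes>\<^bsub>W\<^esub> \<iota> a" if x: "x \<in> carrier W" for a x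
    proof -
      obtain f where "x = cls f" using x by (auto simp: carrier_W)
      then show ?thesis by (simp add: weyl_scalar_def free_scalar_commute[of a f] flip: cm)
    qed
  qed
qed

sublocale W: kalg W \<iota> by (rule kalg_W)

sublocale cl: kalg_hom "free_algebra :: ('n, 'k) free ring" free_scalar W \<iota> "\<lambda>f. cls f"
  by unfold_locales (auto simp: cls_hom weyl_scalar_def)

lemma weyl_relation_zero: "f \<in> weyl_relations R h \<Longrightarrow> cls f = \<zero>\<^bsub>W\<^esub>"
proof -
  assume "f \<in> weyl_relations R h"
  then have "f - 0 \<in> weyl_ideal R h"
    using Fr.genideal_self[of "weyl_relations R h"] by (auto simp: weyl_ideal_def)
  then have "cls f = cls 0" by (simp only: cls_eq_iff)
  then show ?thesis using cl.f.hom_zero by simp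
qed

sublocale W: braided_system W \<iota> R h "weyl_N R h" "weyl_D R h"
proof unfold_locales
  show "weyl_N R h i j \<in> carrier W" "weyl_D R h i j \<in> carrier W" for i j
    by (auto simp: weyl_N_def weyl_D_def carrier_W)
  have eq: "ND_relation W \<iota> 2 R h (weyl_N R h) (weyl_D R h)
      = map_mat 2 (\<lambda>f. cls f) (ND_relation free_algebra free_scalar 2 R h gN gD)"
    using cl.map_relations(3)[of 2 gN gD R h] by (simp add: weyl_N_def[abs_def] weyl_D_def[abs_def])
  show "ND_relation W \<iota> 2 R h (weyl_N R h) (weyl_D R h) = \<zero>\<^bsub>W.M 2\<^esub>"
    unfolding eq
    by (rule W.mat_eqI[where p = 2])
      (auto simp: map_mat_def W.zero_closed' End_tensor_def weyl_relations_eq[OF E.RR] intro!: weyl_relation_zero)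
qed (auto simp: inv h)

lemma W_D': "W.D' = weyl_D_shifted R h"
  by (simp add: fun_eq_iff W.D'_def weyl_D_shifted_def)

lemma N_ideal_weyl_ideal: "v \<in> N_ideal \<Longrightarrow> v \<in> weyl_ideal R h"
proof -
  interpret I: ideal "weyl_ideal R h" "free_algebra :: ('n, 'k) free ring" by (rule weyl_ideal_ideal)
  show "v \<in> N_ideal \<Longrightarrow> v \<in> weyl_ideal R h"
  proof (induction rule: N_ideal.induct)
    case (rel I J v)
    then have "N_rel (I, J) \<in> weyl_ideal R h"
      using Fr.genideal_self[of "weyl_relations R h"]
      by (auto simp: weyl_ideal_def weyl_relations_eq[OF E.RR] N_rel_def)
    then show ?case using I.I_r_closed[of _ v] by simp
  next
    case (add u v) then show ?case using I.a_closed[of u v] by simp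
  next
    case (scalar v c) then show ?case using I.I_l_closed[of v "sc c"] by simp
  next
    case (gen v i j) then show ?case using I.I_l_closed[of v "gN i j"] by simp
  qed
qed

text \<open>
  The left ideal of elements that send \<open>1\<close> into \<open>N_ideal\<close>. It meets the subalgebra of the \<open>N\<close>s only
  in zero, so \<open>act R h a n\<close> is the unique element of that subalgebra congruent to \<open>a n\<close> modulo \<open>annih\<close>.
\<close>

definition annih :: "('n, 'k) free set set" where
  "annih = {cls f | f. rho f 1 \<in> N_ideal}"

text \<open>Independent of the representative, because the whole ideal of relations sends 1 into
  \<open>N_ideal\<close>.\<close>

lemma cls_annih: "cls f \<in> annih \<longleftrightarrow> rho f 1 \<in> N_ideal"
proof
  assume "cls f \<in> annih"
  then obtain g where g: "cls f = cls g" "rho g 1 \<in> N_ideal" by (auto simp: annih_def)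
  then have "rho (f - g) 1 \<in> N_ideal" using weyl_ideal_acts cls_eq_iff by blast
  then have "rho (f - g) 1 + rho g 1 \<in> N_ideal" using g by (intro N_ideal.add)
  then show "rho f 1 \<in> N_ideal" by (simp flip: rho_add)
qed (auto simp: annih_def)

lemma annih_subset: "annih \<subseteq> carrier W"
  by (auto simp: annih_def carrier_W)

lemma annih_left: "a \<in> annih \<Longrightarrow> x \<in> carrier W \<Longrightarrow> x \<otimes>\<^bsub>W\<^esub> a \<in> annih"
proof -
  assume "a \<in> annih" "x \<in> carrier W"
  then obtain f g where "a = cls f" "rho f 1 \<in> N_ideal" "x = cls g" by (auto simp: annih_def carrier_W)
  then show ?thesis
    using cl.f.hom_mult[of g f] cls_annih[of "g * f"] by (simp add: rho_mult rho_N_ideal)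
qed

lemma annih_subgroup: "additive_subgroup annih W"
proof (rule additive_subgroup.intro, rule W.add.subgroupI)
  have "cls 0 \<in> annih" unfolding cls_annih using submodule_N_ideal by (simp add: rho_def lin_ext_def submodule_def)
  then show "annih \<noteq> {}" by auto
  show "a \<oplus>\<^bsub>W\<^esub> b \<in> annih" if ab: "a \<in> annih" "b \<in> annih" for a b
  proof -
    obtain f g where "a = cls f" "rho f 1 \<in> N_ideal" "b = cls g" "rho g 1 \<in> N_ideal"
      using ab by (auto simp: annih_def)
    then show ?thesis using cl.f.hom_add[of f g] cls_annih[of "f + g"] by (simp add: rho_add N_ideal.add)
  qed
  show "\<ominus>\<^bsub>W\<^esub> a \<in> annih" if a: "a \<in> annih" for a
  proof -
    have "(\<ominus>\<^bsub>W\<^esub> \<one>\<^bsub>W\<^esub>) \<otimes>\<^bsub>W\<^esub> a \<in> annih" using a by (intro annih_left) auto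
    then show ?thesis using a annih_subset by (simp add: W.l_minus subset_iff)
  qed
qed (use annih_subset in auto)

lemma annih_right_scalar: "a \<in> annih \<Longrightarrow> a \<otimes>\<^bsub>W\<^esub> \<iota> c \<in> annih"
  using annih_left[of a "\<iota> c"] W.\<iota>_central[of a c] annih_subset by (simp add: subset_iff)

lemma weyl_D_annih: "weyl_D R h i j \<in> annih"
  unfolding weyl_D_def cls_annih using submodule_N_ideal by (simp add: rho_D D_op_1 submodule_def)

lemma generators_N: "range \<iota> \<union> {weyl_N R h i j | i j. True} \<subseteq> carrier W"
  by auto

lemma generators_D: "range \<iota> \<union> {weyl_D R h i j | i j. True} \<subseteq> carrier W"
  by auto

lemma subalg_N_words: "x \<in> subalg_N R h \<Longrightarrow> \<exists>f\<in>N_words. x = cls f"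
  unfolding subalg_N_def
proof (induction rule: generate_ring.induct)
  case one
  show ?case using scalar_N_words[of 1] cl.f.hom_one by (auto simp: free_scalar_simps intro!: bexI[of _ 1])
next
  case (incl x)
  then show ?case using scalar_N_words gN_N_words by (auto simp: weyl_scalar_def weyl_N_def)
next
  case (a_inv x)
  then obtain f where "f \<in> N_words" "x = cls f" by auto
  then show ?case using N_words_uminus[of f] cl.f.hom_a_inv[of f] by auto
next
  case (eng_add x y)
  then obtain f g where "f \<in> N_words" "x = cls f" "g \<in> N_words" "y = cls g" by auto
  then show ?case using N_words_add[of f g] cl.f.hom_add[of f g] by auto
next
  case (eng_mult x y)
  then obtain f g where "f \<in> N_words" "x = cls f" "g \<in> N_words" "y = cls g" by auto
  then show ?case using N_words_mult[of f g] cl.f.hom_mult[of f g] by auto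
qed

text \<open>A representative \<open>f\<close> in \<open>N_words\<close> acts by left multiplication,
  so \<open>f\<close> itself is its value on 1. If this lies in \<open>N_ideal\<close>, it lies in
  the ideal of relations.\<close>

lemma subalg_N_annih: "x \<in> subalg_N R h \<Longrightarrow> x \<in> annih \<Longrightarrow> x = \<zero>\<^bsub>W\<^esub>"
proof -
  assume x: "x \<in> subalg_N R h" "x \<in> annih"
  then obtain f where f: "f \<in> N_words" "x = cls f" using subalg_N_words by blast
  then have "f \<in> N_ideal" using x(2) cls_annih[of f] by (simp add: N_words_def)
  then have "cls f = cls 0" unfolding cls_eq_iff using N_ideal_weyl_ideal by simp
  then show ?thesis using f cl.f.hom_zero by simp
qed

text \<open>Elements of \<open>N_ideal\<close> have no constant term. This is what makes the counit
  single-valued.\<close>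

lemma scalar_annih: "\<iota> c \<in> annih \<Longrightarrow> c = 0"
proof -
  assume "\<iota> c \<in> annih"
  then have "sc c * 1 \<in> N_ideal" by (simp add: weyl_scalar_def cls_annih rho_scalar scalar_op_def)
  then have "Poly_Mapping.lookup (sc c) [] = 0" using N_ideal_lookup by fastforce
  then show "c = 0" by (simp add: free_scalar_def)
qed

lemma subring_N: "subring (subalg_N R h) W"
  unfolding subalg_N_def by (rule W.generate_ring_is_subring[OF generators_N])

lemma subring_D: "subring (subalg_D R h) W"
  unfolding subalg_D_def by (rule W.generate_ring_is_subring[OF generators_D])

lemma scalar_subalg: "\<iota> c \<in> subalg_N R h" "\<iota> c \<in> subalg_D R h"
  unfolding subalg_N_def subalg_D_def by (auto intro: generate_ring.incl)

lemma gen_subalg: "weyl_N R h i j \<in> subalg_N R h" "weyl_D R h i j \<in> subalg_D R h"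
  unfolding subalg_N_def subalg_D_def by (auto intro: generate_ring.incl)

lemma subalg_N_subset: "subalg_N R h \<subseteq> carrier W" and subalg_D_subset: "subalg_D R h \<subseteq> carrier W"
  using subringE(1)[OF subring_N] subringE(1)[OF subring_D] by auto

lemma subgroup_of_subring: "subring K W \<Longrightarrow> additive_subgroup K W"
  by (rule additive_subgroup.intro) (rule subring.axioms(1))

section \<open>Existence and uniqueness of the action\<close>

lemma annih_add: "a \<in> annih \<Longrightarrow> b \<in> annih \<Longrightarrow> a \<oplus>\<^bsub>W\<^esub> b \<in> annih"
  and annih_uminus: "a \<in> annih \<Longrightarrow> \<ominus>\<^bsub>W\<^esub> a \<in> annih"
  and annih_minus: "a \<in> annih \<Longrightarrow> b \<in> annih \<Longrightarrow> a \<ominus>\<^bsub>W\<^esub> b \<in> annih"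
  and annih_zero: "\<zero>\<^bsub>W\<^esub> \<in> annih"
  using annih_subgroup
  by (auto intro: additive_subgroup.a_closed additive_subgroup.a_inv_closed additive_subgroup.zero_closed simp: a_minus_def)

lemma annih_closed: "a \<in> annih \<Longrightarrow> a \<in> carrier W"
  using annih_subset by auto

lemma minus_self_annih: "x \<in> carrier W \<Longrightarrow> x \<ominus>\<^bsub>W\<^esub> x \<in> annih"
  by (simp add: a_minus_def W.r_neg annih_zero)

text \<open>Modulo \<open>annih\<close> the generators d are 0, so by induction every polynomial in
  them is a scalar.\<close>

lemma subalg_D_scalar: "y \<in> subalg_D R h \<Longrightarrow> \<exists>c. y \<ominus>\<^bsub>W\<^esub> \<iota> c \<in> annih"
  unfolding subalg_D_def
proof (induction rule: generate_ring.induct)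
  case one
  have "\<one>\<^bsub>W\<^esub> \<ominus>\<^bsub>W\<^esub> \<iota> 1 \<in> annih" by (simp add: minus_self_annih)
  then show ?case by blast
next
  case (incl y)
  then consider c where "y = \<iota> c" | i j where "y = weyl_D R h i j" by auto
  then show ?case
  proof cases
    case 1
    have "y \<ominus>\<^bsub>W\<^esub> \<iota> c \<in> annih" by (simp add: 1 minus_self_annih)
    then show ?thesis by blast
  next
    case 2
    have "y \<ominus>\<^bsub>W\<^esub> \<iota> 0 \<in> annih" using weyl_D_annih[of i j] by (simp add: 2 a_minus_def)
    then show ?thesis by blast
  qed
next
  case (a_inv y)
  then obtain c where c: "y \<ominus>\<^bsub>W\<^esub> \<iota> c \<in> annih" by blast
  have y: "y \<in> carrier W" using a_inv(1) subalg_D_subset by (auto simp: subalg_D_def)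
  have "\<iota> (- c) = \<ominus>\<^bsub>W\<^esub> \<iota> c"
    using W.\<iota>_add[of "- c" c] by (metis W.\<iota>_0 W.\<iota>_closed W.minus_equality ab_left_minus)
  then have "\<ominus>\<^bsub>W\<^esub> y \<ominus>\<^bsub>W\<^esub> \<iota> (- c) = \<ominus>\<^bsub>W\<^esub> (y \<ominus>\<^bsub>W\<^esub> \<iota> c)"
    using y by (simp add: a_minus_def W.minus_add)
  then show ?case using annih_uminus[OF c] by metis
next
  case (eng_add y z)
  then obtain c e where ce: "y \<ominus>\<^bsub>W\<^esub> \<iota> c \<in> annih" "z \<ominus>\<^bsub>W\<^esub> \<iota> e \<in> annih" by blast
  have y: "y \<in> carrier W" "z \<in> carrier W" using eng_add(1,2) subalg_D_subset by (auto simp: subalg_D_def)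
  then have "(y \<oplus>\<^bsub>W\<^esub> z) \<ominus>\<^bsub>W\<^esub> \<iota> (c + e) = (y \<ominus>\<^bsub>W\<^esub> \<iota> c) \<oplus>\<^bsub>W\<^esub> (z \<ominus>\<^bsub>W\<^esub> \<iota> e)"
    by (simp add: a_minus_def W.\<iota>_add W.minus_add W.a_ac)
  then show ?case using annih_add[OF ce] by metis
next
  case (eng_mult y z)
  then obtain c e where ce: "y \<ominus>\<^bsub>W\<^esub> \<iota> c \<in> annih" "z \<ominus>\<^bsub>W\<^esub> \<iota> e \<in> annih" by blast
  have y: "y \<in> carrier W" "z \<in> carrier W" using eng_mult(1,2) subalg_D_subset by (auto simp: subalg_D_def)
  \<comment> \<open>The splitting respects that \<open>annih\<close> is only a left ideal: the first
    summand has its \<open>annih\<close> factor on the right, and the second is multiplied on the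
    right by a scalar only.\<close>
  have "y \<otimes>\<^bsub>W\<^esub> z \<ominus>\<^bsub>W\<^esub> \<iota> (c * e) = y \<otimes>\<^bsub>W\<^esub> (z \<ominus>\<^bsub>W\<^esub> \<iota> e) \<oplus>\<^bsub>W\<^esub> (y \<ominus>\<^bsub>W\<^esub> \<iota> c) \<otimes>\<^bsub>W\<^esub> \<iota> e"
    using y by (simp add: a_minus_def W.\<iota>_mult W.r_distr W.l_distr W.r_minus W.l_minus W.a_assoc W.r_neg1)
  then show ?case using annih_add[OF annih_left[OF ce(2) y(1)] annih_right_scalar[OF ce(1), of e]] by metis
qed

lemma subalg_D_scalar_unique:
  assumes "y \<in> carrier W" "y \<ominus>\<^bsub>W\<^esub> \<iota> c \<in> annih" "y \<ominus>\<^bsub>W\<^esub> \<iota> e \<in> annih"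
  shows "c = e"
proof -
  have "\<iota> (e - c) \<oplus>\<^bsub>W\<^esub> \<iota> c = \<iota> e" by (simp flip: W.\<iota>_add)
  then have "\<iota> (e - c) = (y \<ominus>\<^bsub>W\<^esub> \<iota> c) \<ominus>\<^bsub>W\<^esub> (y \<ominus>\<^bsub>W\<^esub> \<iota> e)"
    using assms(1)
    by (simp add: a_minus_def W.minus_add W.minus_minus W.a_ac W.r_neg1 W.r_neg2)
      (metis W.\<iota>_closed W.a_assoc W.a_comm W.a_inv_closed W.r_neg W.r_zero)
  then have "\<iota> (e - c) \<in> annih" using annih_minus[OF assms(2,3)] by simp
  then show ?thesis using scalar_annih[of "e - c"] by simp
qed

text \<open>The counit realised as the scalar by which an element acts on the vector 1 of the model.
  The restriction to the subalgebra matches the extensionality demanded in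
  \<open>counit\<close>.\<close>

definition eps :: "('n, 'k) free set \<Rightarrow> 'k" where
  "eps = (\<lambda>y\<in>subalg_D R h. THE c. y \<ominus>\<^bsub>W\<^esub> \<iota> c \<in> annih)"

lemma eps_eqI: "y \<in> subalg_D R h \<Longrightarrow> y \<ominus>\<^bsub>W\<^esub> \<iota> c \<in> annih \<Longrightarrow> eps y = c"
  unfolding eps_def using subalg_D_scalar_unique[of y] subalg_D_subset by (auto intro!: the_equality)

lemma eps_annih: "y \<in> subalg_D R h \<Longrightarrow> y \<ominus>\<^bsub>W\<^esub> \<iota> (eps y) \<in> annih"
  using subalg_D_scalar[of y] eps_eqI by blast

text \<open>Existence of the character comes from the model; uniqueness holds because a character is
  determined on the generators of the subalgebra.\<close>

lemma counit_eps: "counit R h = eps"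
  unfolding counit_def
proof (rule the_equality)
  have scal: "eps (\<iota> c) = c" for c
    by (rule eps_eqI[OF scalar_subalg(2)]) (simp add: minus_self_annih)
  have D: "eps (weyl_D R h i j) = 0" for i j
    using weyl_D_annih[of i j] by (intro eps_eqI gen_subalg) (simp add: a_minus_def)
  have cl: "y \<in> subalg_D R h \<Longrightarrow> y \<in> carrier W" for y using subalg_D_subset by auto
  have add: "eps (y \<oplus>\<^bsub>W\<^esub> z) = eps y + eps z" if yz: "y \<in> subalg_D R h" "z \<in> subalg_D R h" for y z
  proof (rule eps_eqI)
    show "y \<oplus>\<^bsub>W\<^esub> z \<in> subalg_D R h" using yz subringE(7)[OF subring_D] by auto
    have "(y \<oplus>\<^bsub>W\<^esub> z) \<ominus>\<^bsub>W\<^esub> \<iota> (eps y + eps z) = (y \<ominus>\<^bsub>W\<^esub> \<iota> (eps y)) \<oplus>\<^bsub>W\<^esub> (z \<ominus>\<^bsub>W\<^esub> \<iota> (eps z))"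
      using yz[THEN cl] by (simp add: a_minus_def W.\<iota>_add W.minus_add W.a_ac)
    then show "(y \<oplus>\<^bsub>W\<^esub> z) \<ominus>\<^bsub>W\<^esub> \<iota> (eps y + eps z) \<in> annih"
      using annih_add eps_annih yz by metis
  qed
  have mult: "eps (y \<otimes>\<^bsub>W\<^esub> z) = eps y * eps z" if yz: "y \<in> subalg_D R h" "z \<in> subalg_D R h" for y z
  proof (rule eps_eqI)
    show "y \<otimes>\<^bsub>W\<^esub> z \<in> subalg_D R h" using yz subringE(6)[OF subring_D] by auto
    have "y \<otimes>\<^bsub>W\<^esub> z \<ominus>\<^bsub>W\<^esub> \<iota> (eps y * eps z)
      = y \<otimes>\<^bsub>W\<^esub> (z \<ominus>\<^bsub>W\<^esub> \<iota> (eps z)) \<oplus>\<^bsub>W\<^esub> (y \<ominus>\<^bsub>W\<^esub> \<iota> (eps y)) \<otimes>\<^bsub>W\<^esub> \<iota> (eps z)"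
      using yz[THEN cl] by (simp add: a_minus_def W.\<iota>_mult W.r_distr W.l_distr W.r_minus W.l_minus W.a_assoc W.r_neg1)
    then show "y \<otimes>\<^bsub>W\<^esub> z \<ominus>\<^bsub>W\<^esub> \<iota> (eps y * eps z) \<in> annih"
      using annih_add annih_left annih_right_scalar eps_annih yz cl by metis
  qed
  show "eps \<in> extensional (subalg_D R h) \<and>
     eps \<in> ring_hom (W\<lparr>carrier := subalg_D R h\<rparr>) type_ring \<and>
     (\<forall>c. eps (\<iota> c) = c) \<and> (\<forall>i j. eps (weyl_D R h i j) = 0)"
  proof (intro conjI allI scal D)
    show "eps \<in> extensional (subalg_D R h)" by (simp add: eps_def)
    show "eps \<in> ring_hom (W\<lparr>carrier := subalg_D R h\<rparr>) type_ring"
      using scal[of 1] by (intro ring_hom_memI) (auto simp: mult add)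
  qed
  fix e assume e: "e \<in> extensional (subalg_D R h) \<and>
     e \<in> ring_hom (W\<lparr>carrier := subalg_D R h\<rparr>) type_ring \<and>
     (\<forall>c. e (\<iota> c) = c) \<and> (\<forall>i j. e (weyl_D R h i j) = 0)"
  have ea: "e (y \<oplus>\<^bsub>W\<^esub> z) = e y + e z" "e (y \<otimes>\<^bsub>W\<^esub> z) = e y * e z"
    if "y \<in> subalg_D R h" "z \<in> subalg_D R h" for y z
    using e ring_hom_add[of e "W\<lparr>carrier := subalg_D R h\<rparr>" type_ring y z]
      ring_hom_mult[of e "W\<lparr>carrier := subalg_D R h\<rparr>" type_ring y z] that by auto
  have "e y = eps y" if "y \<in> subalg_D R h" for y
  proof -
    have "y \<in> generate_ring W (range \<iota> \<union> {weyl_D R h i j | i j. True})" using that by (simp add: subalg_D_def)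
    then show ?thesis
    proof (induction rule: generate_ring.induct)
      case one
      have "e (\<iota> 1) = eps (\<iota> 1)" using e scal by metis
      then show ?case by (simp only: W.\<iota>_1)
    next
      case (incl y) then show ?case using e scal D by auto
    next
      case (a_inv y)
      then have y: "y \<in> subalg_D R h" "\<ominus>\<^bsub>W\<^esub> y \<in> subalg_D R h"
        using subringE(5)[OF subring_D] by (auto simp: subalg_D_def)
      have z: "\<ominus>\<^bsub>W\<^esub> y \<oplus>\<^bsub>W\<^esub> y = \<iota> 0" using cl[OF y(1)] by (simp add: W.l_neg)
      have "e (\<ominus>\<^bsub>W\<^esub> y) + e y = 0" "eps (\<ominus>\<^bsub>W\<^esub> y) + eps y = 0"
        using ea(1)[OF y(2,1)] add[OF y(2,1)] e scal unfolding z by metis+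
      then show ?case using a_inv.IH by (metis add_right_cancel)
    next
      case (eng_add y z) then show ?case using ea(1) add by (simp add: subalg_D_def)
    next
      case (eng_mult y z) then show ?case using ea(2) mult by (simp add: subalg_D_def)
    qed
  qed
  then show "e = eps" using e by (intro extensionalityI[of _ "subalg_D R h"]) (auto simp: eps_def)
qed

lemma subgroup_N: "additive_subgroup (subalg_N R h) W"
  by (rule subgroup_of_subring[OF subring_N])

text \<open>Replacing each right factor by its counit changes it by an element of
  \<open>annih\<close>, and multiplication from the left keeps it there. Hence every normal ordering
  gives the same class modulo \<open>annih\<close>.\<close>

lemma normal_ordered_value_annih:
  assumes "normal_ordered_value R h a n m"
  shows "m \<in> subalg_N R h" "a \<otimes>\<^bsub>W\<^esub> n \<ominus>\<^bsub>W\<^esub> m \<in> annih"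
proof -
  obtain l x y where xy: "\<forall>t<l::nat. x t \<in> subalg_N R h \<and> y t \<in> subalg_D R h"
    and an: "a \<otimes>\<^bsub>W\<^esub> n = (\<Oplus>\<^bsub>W\<^esub>t\<in>{..<l}. x t \<otimes>\<^bsub>W\<^esub> y t)"
    and m: "m = (\<Oplus>\<^bsub>W\<^esub>t\<in>{..<l}. x t \<otimes>\<^bsub>W\<^esub> \<iota> (eps (y t)))"
    using assms by (auto simp: normal_ordered_value_def Let_def counit_eps)
  have cl: "x t \<in> carrier W" "y t \<in> carrier W" if "t < l" for t
    using xy that subalg_N_subset subalg_D_subset by auto
  show "m \<in> subalg_N R h"
    unfolding m by (rule W.sum_in_subgroup[OF subgroup_N])
      (use xy scalar_subalg subringE(6)[OF subring_N] in auto)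
  have "a \<otimes>\<^bsub>W\<^esub> n = (\<Oplus>\<^bsub>W\<^esub>t\<in>{..<l}. x t \<otimes>\<^bsub>W\<^esub> (y t \<ominus>\<^bsub>W\<^esub> \<iota> (eps (y t))) \<oplus>\<^bsub>W\<^esub> x t \<otimes>\<^bsub>W\<^esub> \<iota> (eps (y t)))"
    unfolding an by (rule W.finsum_cong')
      (use cl in \<open>auto simp: a_minus_def W.r_distr W.r_minus W.a_assoc W.l_neg\<close>)
  also have "\<dots> = (\<Oplus>\<^bsub>W\<^esub>t\<in>{..<l}. x t \<otimes>\<^bsub>W\<^esub> (y t \<ominus>\<^bsub>W\<^esub> \<iota> (eps (y t)))) \<oplus>\<^bsub>W\<^esub> m"
    unfolding m by (rule W.finsum_addf) (use cl in auto)
  finally have "a \<otimes>\<^bsub>W\<^esub> n = \<dots>" .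
  moreover have A: "(\<Oplus>\<^bsub>W\<^esub>t\<in>{..<l}. x t \<otimes>\<^bsub>W\<^esub> (y t \<ominus>\<^bsub>W\<^esub> \<iota> (eps (y t)))) \<in> annih"
    by (rule W.sum_in_subgroup[OF annih_subgroup]) (use xy cl in \<open>auto intro: annih_left eps_annih\<close>)
  moreover have "m \<in> carrier W" unfolding m using cl by (auto intro!: W.finsum_closed)
  ultimately show "a \<otimes>\<^bsub>W\<^esub> n \<ominus>\<^bsub>W\<^esub> m \<in> annih"
    using annih_closed[OF A] by (simp add: a_minus_def W.a_assoc W.r_neg)
qed

lemma annih_unique:
  assumes "m \<in> subalg_N R h" "m' \<in> subalg_N R h" "w \<in> carrier W" "w \<ominus>\<^bsub>W\<^esub> m \<in> annih" "w \<ominus>\<^bsub>W\<^esub> m' \<in> annih"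
  shows "m = m'"
proof -
  have c: "m \<in> carrier W" "m' \<in> carrier W" using assms subalg_N_subset by auto
  have "m' \<ominus>\<^bsub>W\<^esub> m = (w \<ominus>\<^bsub>W\<^esub> m) \<ominus>\<^bsub>W\<^esub> (w \<ominus>\<^bsub>W\<^esub> m')"
  proof -
    have "(w \<ominus>\<^bsub>W\<^esub> m) \<ominus>\<^bsub>W\<^esub> (w \<ominus>\<^bsub>W\<^esub> m') = (w \<oplus>\<^bsub>W\<^esub> \<ominus>\<^bsub>W\<^esub> w) \<oplus>\<^bsub>W\<^esub> (m' \<oplus>\<^bsub>W\<^esub> \<ominus>\<^bsub>W\<^esub> m)"
      using c assms(3) by (simp add: a_minus_def W.minus_add W.minus_minus W.a_ac)
    then show ?thesis using c assms(3) by (simp add: W.r_neg a_minus_def)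
  qed
  then have "m' \<ominus>\<^bsub>W\<^esub> m \<in> annih" using annih_minus[OF assms(4,5)] by simp
  moreover have "m' \<ominus>\<^bsub>W\<^esub> m \<in> subalg_N R h"
    using assms subringE(5,7)[OF subring_N] by (auto simp: a_minus_def)
  ultimately have "m' \<ominus>\<^bsub>W\<^esub> m = \<zero>\<^bsub>W\<^esub>" by (intro subalg_N_annih)
  then show ?thesis using c by (simp add: W.r_right_minus_eq)
qed

lemma act_eqI:
  assumes "a \<in> carrier W" "n \<in> carrier W" "normal_ordered_value R h a n m"
  shows "act R h a n = m"
  unfolding act_def
proof (rule the_equality)
  show "normal_ordered_value R h a n m" by (rule assms(3))
  fix m' assume m': "normal_ordered_value R h a n m'"
  show "m' = m"
    by (rule annih_unique[OF normal_ordered_value_annih(1)[OF m'] normal_ordered_value_annih(1)[OF assms(3)] _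
        normal_ordered_value_annih(2)[OF m'] normal_ordered_value_annih(2)[OF assms(3)]])
      (use assms in auto)
qed

lemma product_span_normal_ordered:
  assumes "a \<otimes>\<^bsub>W\<^esub> n \<in> W.product_span (subalg_N R h) (subalg_D R h)"
  shows "\<exists>m. normal_ordered_value R h a n m"
  using W.product_span_sum[OF subalg_N_subset subalg_D_subset assms]
  unfolding normal_ordered_value_def Let_def by blast

text \<open>Only expressions of degree one in D' occur here. The relation for D' is homogeneous, so
  this span is not left when D' is moved past any element of the algebra of the Ns.\<close>

definition shifted_span :: "('n, 'k) free set set" where
  "shifted_span = W.product_span (subalg_N R h) (range (case_prod W.D'))"

lemma shifted_span_subgroup: "additive_subgroup shifted_span W"
  unfolding shifted_span_def by (rule W.product_span_subgroup[OF subgroup_N]) auto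

lemma shifted_range: "range (case_prod W.D') \<subseteq> carrier W"
  by auto

lemma shifted_span_closed: "w \<in> shifted_span \<Longrightarrow> w \<in> carrier W"
  unfolding shifted_span_def using W.product_span_closed[OF subalg_N_subset shifted_range] by auto

lemma shifted_span_left: "x \<in> subalg_N R h \<Longrightarrow> w \<in> shifted_span \<Longrightarrow> x \<otimes>\<^bsub>W\<^esub> w \<in> shifted_span"
  unfolding shifted_span_def using subalg_N_subset subringE(6)[OF subring_N]
  by (intro W.product_span_left[OF subalg_N_subset shifted_range]) auto

lemma D'_shifted_span: "W.D' a b \<in> shifted_span"
proof -
  have "\<iota> 1 \<otimes>\<^bsub>W\<^esub> W.D' a b \<in> shifted_span"
    unfolding shifted_span_def
    by (rule W.product_span_prod[OF subalg_N_subset shifted_range scalar_subalg(1)]) auto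
  then show ?thesis by simp
qed

lemma skew_shifted_span: "skew_kalg W \<iota> R \<Psi> shifted_span"
  by (intro skew_kalg.intro skew_kalg_axioms.intro W.kalg_axioms \<Psi>(1) shifted_span_subgroup
      shifted_span_left scalar_subalg)

text \<open>The third relation puts the entries of D' R N into the span; skew-invertibility, applied
  in the Weyl algebra itself, then gives the single products D' N.\<close>

lemma D'_N_shifted_span: "W.D' a b \<otimes>\<^bsub>W\<^esub> weyl_N R h i j \<in> shifted_span"
proof -
  interpret s: skew_kalg W \<iota> R \<Psi> shifted_span by (rule skew_shifted_span)
  interpret M: ring "W.M 2 :: ('n list \<times> 'n list \<Rightarrow> _) ring" by (rule W.ring_End_tensor)
  define r n d where "r = W.r 2 1" and "n = W.N\<^sub>1 2" and "d = W.D'\<^sub>1 2"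
  have cl [simp]: "r \<in> carrier (W.M 2)" "n \<in> carrier (W.M 2)" "d \<in> carrier (W.M 2)"
    by (auto simp: r_def n_def d_def intro!: W.in_factors_closed W.in_first_closed)
  have sc [simp]: "(W.scal 2 h :: 'n list \<times> 'n list \<Rightarrow> _) \<in> carrier (W.M 2)"
    by (intro W.scale_closed W.one_closed')
  have rr: "r \<otimes>\<^bsub>W.M 2\<^esub> r = \<one>\<^bsub>W.M 2\<^esub>"
    unfolding r_def by (rule W.in_factors_invol) (auto simp: W.RR)
  have rel: "d \<otimes>\<^bsub>W.M 2\<^esub> (r \<otimes>\<^bsub>W.M 2\<^esub> n \<otimes>\<^bsub>W.M 2\<^esub> r) = (r \<otimes>\<^bsub>W.M 2\<^esub> n \<otimes>\<^bsub>W.M 2\<^esub> r) \<otimes>\<^bsub>W.M 2\<^esub> d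
      \<oplus>\<^bsub>W.M 2\<^esub> W.scal 2 h \<otimes>\<^bsub>W.M 2\<^esub> (d \<otimes>\<^bsub>W.M 2\<^esub> r)"
    unfolding r_def n_def d_def by (rule W.shifted_relation) simp
  have "d \<otimes>\<^bsub>W.M 2\<^esub> (r \<otimes>\<^bsub>W.M 2\<^esub> n) = (d \<otimes>\<^bsub>W.M 2\<^esub> (r \<otimes>\<^bsub>W.M 2\<^esub> n \<otimes>\<^bsub>W.M 2\<^esub> r)) \<otimes>\<^bsub>W.M 2\<^esub> r"
    by (simp add: M.m_assoc rr)
  also have "\<dots> = r \<otimes>\<^bsub>W.M 2\<^esub> (n \<otimes>\<^bsub>W.M 2\<^esub> (r \<otimes>\<^bsub>W.M 2\<^esub> (d \<otimes>\<^bsub>W.M 2\<^esub> r))) \<oplus>\<^bsub>W.M 2\<^esub> W.scal 2 h \<otimes>\<^bsub>W.M 2\<^esub> d"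
    unfolding rel by (simp add: M.l_distr M.m_assoc rr)
  also have "W.scal 2 h \<otimes>\<^bsub>W.M 2\<^esub> d = scale_mat W \<iota> 2 h d"
    by (rule W.scale_scal(1)[symmetric]) simp
  finally have eq: "d \<otimes>\<^bsub>W.M 2\<^esub> (r \<otimes>\<^bsub>W.M 2\<^esub> n)
    = r \<otimes>\<^bsub>W.M 2\<^esub> (n \<otimes>\<^bsub>W.M 2\<^esub> (r \<otimes>\<^bsub>W.M 2\<^esub> (d \<otimes>\<^bsub>W.M 2\<^esub> r))) \<oplus>\<^bsub>W.M 2\<^esub> scale_mat W \<iota> 2 h d" .
  have r: "W.entries_in 2 (subalg_N R h) r"
    unfolding r_def by (intro W.entries_in_factors scalar_subalg) auto
  have n: "W.entries_in 2 (subalg_N R h) n"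
    unfolding n_def using subringE(2)[OF subring_N] by (intro W.entries_in_first gen_subalg subalg_N_subset)
  have d: "W.entries_in 2 shifted_span d"
    unfolding d_def using additive_subgroup.zero_closed[OF shifted_span_subgroup] shifted_span_closed
    by (intro W.entries_in_first D'_shifted_span) auto
  have l: "W.entries_in 2 shifted_span (X \<otimes>\<^bsub>W.M 2\<^esub> Y)"
    if "W.entries_in 2 (subalg_N R h) X" "W.entries_in 2 shifted_span Y" for X Y :: "'n list \<times> 'n list \<Rightarrow> _"
    using that shifted_span_left shifted_span_subgroup
    by (intro W.entries_in_mult[where B = "subalg_N R h" and C = shifted_span]) auto
  have dr: "W.entries_in 2 shifted_span (d \<otimes>\<^bsub>W.M 2\<^esub> r)"
  proof (rule W.entries_in_mult[OF d _ _ shifted_span_subgroup])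
    show "W.entries_in 2 (range \<iota>) r" unfolding r_def by (intro W.entries_in_factors) auto
    show "b \<otimes>\<^bsub>W\<^esub> c \<in> shifted_span" if "b \<in> shifted_span" "c \<in> range \<iota>" for b c
    proof -
      obtain x where "c = \<iota> x" using \<open>c \<in> range \<iota>\<close> by auto
      then show ?thesis
        using shifted_span_left[OF scalar_subalg(1) \<open>b \<in> shifted_span\<close>, of x]
          W.\<iota>_central[OF shifted_span_closed[OF \<open>b \<in> shifted_span\<close>], of x] by simp
    qed
  qed
  have "W.entries_in 2 shifted_span (d \<otimes>\<^bsub>W.M 2\<^esub> (r \<otimes>\<^bsub>W.M 2\<^esub> n))"
    unfolding eq
    by (intro W.entries_in_add W.entries_in_scale shifted_span_subgroup shifted_span_left scalar_subalg l dr d r n)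
  then show ?thesis
    unfolding r_def n_def d_def by (intro s.skew_first_first) auto
qed

lemma shifted_span_right:
  assumes n: "n \<in> carrier W" "\<And>a b. W.D' a b \<otimes>\<^bsub>W\<^esub> n \<in> shifted_span" and w: "w \<in> shifted_span"
  shows "w \<otimes>\<^bsub>W\<^esub> n \<in> shifted_span"
  using w unfolding shifted_span_def
proof (induction rule: W.product_span.induct)
  case zero then show ?case using n W.product_span.zero by simp
next
  case (step x y w)
  then obtain a b where y: "y = W.D' a b" by auto
  have c: "x \<in> carrier W" "w \<in> carrier W"
    using step subalg_N_subset W.product_span_closed[OF subalg_N_subset shifted_range] by auto
  have "(x \<otimes>\<^bsub>W\<^esub> y \<oplus>\<^bsub>W\<^esub> w) \<otimes>\<^bsub>W\<^esub> n = x \<otimes>\<^bsub>W\<^esub> (y \<otimes>\<^bsub>W\<^esub> n) \<oplus>\<^bsub>W\<^esub> w \<otimes>\<^bsub>W\<^esub> n"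
    using c n by (simp add: y W.l_distr W.m_assoc)
  moreover have "x \<otimes>\<^bsub>W\<^esub> (y \<otimes>\<^bsub>W\<^esub> n) \<in> shifted_span"
    unfolding y by (intro shifted_span_left n step)
  ultimately show ?case
    using step.IH additive_subgroup.a_closed[OF shifted_span_subgroup] by (simp add: shifted_span_def)
qed

lemma D'_subalg_N: "n \<in> subalg_N R h \<Longrightarrow> W.D' a b \<otimes>\<^bsub>W\<^esub> n \<in> shifted_span"
proof -
  assume "n \<in> subalg_N R h"
  then have "n \<in> generate_ring W (range \<iota> \<union> {weyl_N R h i j | i j. True})" by (simp add: subalg_N_def)
  then show "W.D' a b \<otimes>\<^bsub>W\<^esub> n \<in> shifted_span"
  proof (induction arbitrary: a b rule: generate_ring.induct)
    case one then show ?case by (simp add: D'_shifted_span)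
  next
    case (incl n)
    then consider c where "n = \<iota> c" | i j where "n = weyl_N R h i j" by auto
    then show ?case
    proof cases
      case 1 then show ?thesis using shifted_span_left[OF scalar_subalg(1) D'_shifted_span, of c a b]
        by (simp add: W.\<iota>_central)
    qed (simp add: D'_N_shifted_span)
  next
    case (a_inv n)
    have "n \<in> carrier W" using a_inv(1) subalg_N_subset by (auto simp: subalg_N_def)
    then show ?case using a_inv.IH additive_subgroup.a_inv_closed[OF shifted_span_subgroup] by (simp add: W.r_minus)
  next
    case (eng_add n n')
    have "n \<in> carrier W" "n' \<in> carrier W" using eng_add(1,2) subalg_N_subset by (auto simp: subalg_N_def)
    then show ?case using eng_add.IH additive_subgroup.a_closed[OF shifted_span_subgroup] by (simp add: W.r_distr)
  next
    case (eng_mult n n')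
    have c: "n \<in> carrier W" "n' \<in> carrier W" using eng_mult(1,2) subalg_N_subset by (auto simp: subalg_N_def)
    have "(W.D' a b \<otimes>\<^bsub>W\<^esub> n) \<otimes>\<^bsub>W\<^esub> n' \<in> shifted_span"
      by (rule shifted_span_right[OF c(2) eng_mult.IH(2) eng_mult.IH(1)])
    then show ?case using c by (simp add: W.m_assoc)
  qed
qed

text \<open>\<open>mat_act\<close> adds up values of \<open>act\<close> at single entries, each
  defined by its own \<open>THE\<close>. The matrix identity orders only the sum, so a normal
  ordering must be shown to exist for every single product d n.\<close>

lemma act_D:
  assumes n: "n \<in> subalg_N R h"
  shows "act R h (weyl_D R h i j) n \<in> subalg_N R h"
    "weyl_D R h i j \<otimes>\<^bsub>W\<^esub> n \<ominus>\<^bsub>W\<^esub> act R h (weyl_D R h i j) n \<in> annih"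
proof -
  let ?S = "W.product_span (subalg_N R h) (subalg_D R h)"
  have nc: "n \<in> carrier W" using n subalg_N_subset by auto
  have sub: "additive_subgroup ?S W" by (rule W.product_span_subgroup[OF subgroup_N subalg_D_subset])
  have "range (case_prod W.D') \<subseteq> subalg_D R h"
    using scalar_subalg(2) gen_subalg(2) subringE(7)[OF subring_D] by (auto simp: W.D'_def)
  then have 1: "W.D' i j \<otimes>\<^bsub>W\<^esub> n \<in> ?S"
    using D'_subalg_N[OF n, of i j] W.product_span_mono unfolding shifted_span_def by blast
  let ?c = "if i = j then inverse h else 0"
  have "(\<iota> ?c \<otimes>\<^bsub>W\<^esub> n) \<otimes>\<^bsub>W\<^esub> \<iota> 1 \<in> ?S"
    using n scalar_subalg subringE(6)[OF subring_N] subringE(3)[OF subring_D]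
    by (intro W.product_span_prod subalg_N_subset subalg_D_subset) auto
  then have 2: "\<iota> ?c \<otimes>\<^bsub>W\<^esub> n \<in> ?S" using nc by (simp del: if_split)
  have "weyl_D R h i j \<otimes>\<^bsub>W\<^esub> n = W.D' i j \<otimes>\<^bsub>W\<^esub> n \<oplus>\<^bsub>W\<^esub> \<ominus>\<^bsub>W\<^esub> (\<iota> ?c \<otimes>\<^bsub>W\<^esub> n)"
  proof -
    define X Y where "X = \<iota> ?c \<otimes>\<^bsub>W\<^esub> n" and "Y = weyl_D R h i j \<otimes>\<^bsub>W\<^esub> n"
    have "X \<in> carrier W" "Y \<in> carrier W" using nc by (auto simp: X_def Y_def)
    moreover have "W.D' i j \<otimes>\<^bsub>W\<^esub> n = X \<oplus>\<^bsub>W\<^esub> Y" unfolding X_def Y_def W.D'_def using nc by (intro W.l_distr) auto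
    ultimately show ?thesis unfolding X_def[symmetric] Y_def[symmetric]
      by (metis W.a_comm W.a_inv_closed W.add.m_closed W.r_neg1)
  qed
  then have "weyl_D R h i j \<otimes>\<^bsub>W\<^esub> n \<in> ?S"
    using 1 2 additive_subgroup.a_closed[OF sub] additive_subgroup.a_inv_closed[OF sub] by metis
  then obtain m where m: "normal_ordered_value R h (weyl_D R h i j) n m"
    using product_span_normal_ordered by blast
  then have "act R h (weyl_D R h i j) n = m" using nc by (intro act_eqI) auto
  then show "act R h (weyl_D R h i j) n \<in> subalg_N R h"
    "weyl_D R h i j \<otimes>\<^bsub>W\<^esub> n \<ominus>\<^bsub>W\<^esub> act R h (weyl_D R h i j) n \<in> annih"
    using normal_ordered_value_annih[OF m] by auto
qed

text \<open>D_1 has zero entries off the first factor, and \<open>mat_act\<close> applies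
  \<open>act\<close> to these too. The empty sum is a normal ordering of 0.\<close>

lemma act_zero: "n \<in> carrier W \<Longrightarrow> act R h \<zero>\<^bsub>W\<^esub> n = \<zero>\<^bsub>W\<^esub>"
proof (rule act_eqI)
  show "n \<in> carrier W \<Longrightarrow> normal_ordered_value R h \<zero>\<^bsub>W\<^esub> n \<zero>\<^bsub>W\<^esub>"
    unfolding normal_ordered_value_def Let_def by (intro exI[of _ 0]) simp
qed auto

section \<open>The action on the product of the \<open>N\<close>s\<close>

lemma entries_in_list_prod:
  assumes K: "subring K W" and X: "\<And>X. X \<in> set Xs \<Longrightarrow> W.entries_in p K X"
  shows "W.entries_in p K (list_prod (W.M p) Xs)"
  using X
proof (induction Xs)
  interpret M: ring "W.M p" by (rule W.ring_End_tensor)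
  case Nil
  then show ?case
    using subringE(2,3)[OF K] by (auto simp: W.entries_in_def W.one_closed' W.one_entry)
next
  interpret M: ring "W.M p" by (rule W.ring_End_tensor)
  case (Cons X Xs)
  then show ?case
    using subringE(6)[OF K] subgroup_of_subring[OF K] by (auto intro!: W.entries_in_mult)
qed

lemma entries_in_finsum:
  assumes A: "additive_subgroup A W" and "finite K" "\<And>k. k \<in> K \<Longrightarrow> W.entries_in p A (f k)"
  shows "W.entries_in p A (\<Oplus>\<^bsub>W.M p\<^esub>k\<in>K. f k)"
  using assms(2,3)
proof (induction K rule: finite_induct)
  interpret M: ring "W.M p" by (rule W.ring_End_tensor)
  case empty
  then show ?case using additive_subgroup.zero_closed[OF A] by (auto simp: W.entries_in_def W.zero_entry W.zero_closed')
next
  interpret M: ring "W.M p" by (rule W.ring_End_tensor)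
  case (insert x F)
  then have "f x \<in> carrier (W.M p)" "\<And>k. k \<in> F \<Longrightarrow> f k \<in> carrier (W.M p)"
    by (auto simp: W.entries_in_def)
  then show ?case using insert A by (subst M.finsum_insert) (auto intro!: W.entries_in_add)
qed

lemma scalars_subring: "subring (range \<iota>) W"
  by (rule W.subringI) (auto simp flip: W.\<iota>_mult W.\<iota>_add W.\<iota>_1 intro!: additive_subgroup.a_inv_closed[OF W.scalars_subgroup])

lemma bar_entries: "1 \<le> k \<Longrightarrow> k \<le> p \<Longrightarrow> W.entries_in p (subalg_N R h) (bar W \<iota> p R (weyl_N R h) k)"
  unfolding bar_def matrix_inv_involution[OF W.RR] using subringE(2)[OF subring_N]
  by (intro entries_in_list_prod subring_N)
    (auto intro!: W.entries_in_factors W.entries_in_first scalar_subalg gen_subalg subalg_N_subset)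

lemma bar_prod_entries: "W.entries_in p (subalg_N R h) (bar_prod W \<iota> p R (weyl_N R h) ks)"
  unfolding bar_prod_def by (intro entries_in_list_prod subring_N) (auto intro!: bar_entries)

lemma R_cycle_entries:
  assumes "ks \<in> index_chains p s"
  shows "W.entries_in p (range \<iota>) (R_cycle W \<iota> p R ks)"
proof -
  have "W.entries_in p (range \<iota>) (R_pair W \<iota> p R k l)" if "1 \<le> k" "l \<le> p" for k l
    unfolding R_pair_def using that by (intro entries_in_list_prod scalars_subring) (auto intro!: W.entries_in_factors)
  moreover have "1 \<le> k \<and> l \<le> p" if "(k, l) \<in> set (zip (1 # ks) ks)" for k l
  proof -
    have "k \<in> set (1 # ks)" "l \<in> set ks" using that by (auto dest: set_zip_leftD set_zip_rightD)
    then show ?thesis using assms by (auto simp: index_chains_def)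
  qed
  ultimately show ?thesis
    unfolding R_cycle_def by (intro entries_in_list_prod scalars_subring) auto
qed

lemma weyl_identities:
  assumes p: "2 \<le> p"
  defines "M \<equiv> W.M p" and "Ns \<equiv> bar_prod W \<iota> p R (weyl_N R h)" and "Rc \<equiv> R_cycle W \<iota> p R"
  shows "in_first W p (weyl_D_shifted R h) \<otimes>\<^bsub>M\<^esub> Ns [] =
         Ns [] \<otimes>\<^bsub>M\<^esub> in_first W p (weyl_D_shifted R h) \<oplus>\<^bsub>M\<^esub>
         (\<Oplus>\<^bsub>M\<^esub>s\<in>{1..p - 1}. scale_mat W \<iota> p (h ^ s)
            (\<Oplus>\<^bsub>M\<^esub>ks\<in>index_chains p s. Ns ks \<otimes>\<^bsub>M\<^esub> in_first W p (weyl_D_shifted R h) \<otimes>\<^bsub>M\<^esub> Rc ks))" (is ?A)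
    and "mat_act R h p (in_first W p (weyl_D R h)) (Ns []) =
         (\<Oplus>\<^bsub>M\<^esub>s\<in>{1..p - 1}. scale_mat W \<iota> p (h ^ (s - 1))
            (\<Oplus>\<^bsub>M\<^esub>ks\<in>index_chains p s. Ns ks \<otimes>\<^bsub>M\<^esub> Rc ks))" (is ?B)
proof -
  interpret B: braided_ring M p "W.r p" "W.N\<^sub>1 p" "W.D'\<^sub>1 p" "W.scal p h"
    unfolding M_def by (rule W.braided_ring) (use p in simp)
  have p1: "1 \<le> p" using p by simp
  have Ns: "Ns ks = B.ns p ks" for ks
    unfolding Ns_def M_def by (rule W.bar_prod_ns[OF p1])
  have Rc: "Rc ks = B.rc 1 ks" if "ks \<in> index_chains p s" for ks s
    unfolding Rc_def M_def by (rule W.R_cycle_rc[OF p1 that])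
  have cN [simp]: "Ns ks \<in> carrier M" for ks using B.ns_closed[of p ks] by (simp add: Ns)
  have cR: "Rc ks \<in> carrier M" if "ks \<in> index_chains p s" for ks s
    using R_cycle_entries[OF that] by (simp add: Rc_def M_def W.entries_in_def)
  have cD [simp]: "W.D\<^sub>1 p \<in> carrier M" unfolding M_def by (rule W.in_first_closed) simp
  have fin: "finite (index_chains p s)" for s
    using B.finite_chains[of p] by (simp add: B.index_chains_chains)
  have sc: "scale_mat W \<iota> p (h ^ l) X = W.scal p h [^]\<^bsub>M\<^esub> l \<otimes>\<^bsub>M\<^esub> X" if "X \<in> carrier M" for X and l :: nat
    using W.scale_scal(1)[of X p "h ^ l"] that by (simp add: M_def W.scal_pow)
  have sum_eq: "(\<Oplus>\<^bsub>M\<^esub>s\<in>{1..p - 1}. scale_mat W \<iota> p (h ^ e s) (\<Oplus>\<^bsub>M\<^esub>ks\<in>index_chains p s. Ns ks \<otimes>\<^bsub>M\<^esub> d \<otimes>\<^bsub>M\<^esub> Rc ks))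
    = (\<Oplus>\<^bsub>M\<^esub>s\<in>{1..p - 1}. W.scal p h [^]\<^bsub>M\<^esub> e s \<otimes>\<^bsub>M\<^esub> (\<Oplus>\<^bsub>M\<^esub>ks\<in>index_chains p s. B.ns p ks \<otimes>\<^bsub>M\<^esub> d \<otimes>\<^bsub>M\<^esub> B.rc 1 ks))"
    if d: "d \<in> carrier M" for d and e :: "nat \<Rightarrow> nat"
  proof (intro B.finsum_cong' refl)
    fix s
    have cl: "(\<Oplus>\<^bsub>M\<^esub>ks\<in>index_chains p s. Ns ks \<otimes>\<^bsub>M\<^esub> d \<otimes>\<^bsub>M\<^esub> Rc ks) \<in> carrier M"
      using d cR by (intro B.finsum_closed) auto
    have eq: "(\<Oplus>\<^bsub>M\<^esub>ks\<in>index_chains p s. B.ns p ks \<otimes>\<^bsub>M\<^esub> d \<otimes>\<^bsub>M\<^esub> B.rc 1 ks)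
        = (\<Oplus>\<^bsub>M\<^esub>ks\<in>index_chains p s. Ns ks \<otimes>\<^bsub>M\<^esub> d \<otimes>\<^bsub>M\<^esub> Rc ks)"
      using d cR by (intro B.finsum_cong' refl) (auto simp: Rc[symmetric] Ns[symmetric] simp del: One_nat_def)
    show "scale_mat W \<iota> p (h ^ e s) (\<Oplus>\<^bsub>M\<^esub>ks\<in>index_chains p s. Ns ks \<otimes>\<^bsub>M\<^esub> d \<otimes>\<^bsub>M\<^esub> Rc ks)
      = W.scal p h [^]\<^bsub>M\<^esub> e s \<otimes>\<^bsub>M\<^esub> (\<Oplus>\<^bsub>M\<^esub>ks\<in>index_chains p s. B.ns p ks \<otimes>\<^bsub>M\<^esub> d \<otimes>\<^bsub>M\<^esub> B.rc 1 ks)"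
      unfolding eq by (rule sc[OF cl])
    show "(\<lambda>s. W.scal p h [^]\<^bsub>M\<^esub> e s \<otimes>\<^bsub>M\<^esub> (\<Oplus>\<^bsub>M\<^esub>ks\<in>index_chains p s. B.ns p ks \<otimes>\<^bsub>M\<^esub> d \<otimes>\<^bsub>M\<^esub> B.rc 1 ks)) \<in> {1..p - 1} \<rightarrow> carrier M"
      using d cR by (auto simp: Rc[symmetric] Ns[symmetric] simp del: One_nat_def intro!: B.finsum_closed)
  qed
  show ?A
    using B.d_ns[OF p] by (simp only: W_D'[symmetric] sum_eq[OF B.d_closed, of "\<lambda>s. s"] Ns[of "[]"])
  let ?rhs = "\<Oplus>\<^bsub>M\<^esub>s\<in>{1..p - 1}. scale_mat W \<iota> p (h ^ (s - 1)) (\<Oplus>\<^bsub>M\<^esub>ks\<in>index_chains p s. Ns ks \<otimes>\<^bsub>M\<^esub> Rc ks)"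
  have rcM: "B.rc 1 ks \<in> carrier M" if "ks \<in> index_chains p s" for ks s
    using cR[OF that] Rc[OF that] by simp
  have rhs_eq: "?rhs = (\<Oplus>\<^bsub>M\<^esub>s\<in>{1..p - 1}. W.scal p h [^]\<^bsub>M\<^esub> (s - 1) \<otimes>\<^bsub>M\<^esub> (\<Oplus>\<^bsub>M\<^esub>ks\<in>index_chains p s. B.ns p ks \<otimes>\<^bsub>M\<^esub> B.rc 1 ks))"
  proof (intro B.finsum_cong' refl)
    fix s
    have cl: "(\<Oplus>\<^bsub>M\<^esub>ks\<in>index_chains p s. Ns ks \<otimes>\<^bsub>M\<^esub> Rc ks) \<in> carrier M"
      using cR by (intro B.finsum_closed) auto
    have eq: "(\<Oplus>\<^bsub>M\<^esub>ks\<in>index_chains p s. B.ns p ks \<otimes>\<^bsub>M\<^esub> B.rc 1 ks) = (\<Oplus>\<^bsub>M\<^esub>ks\<in>index_chains p s. Ns ks \<otimes>\<^bsub>M\<^esub> Rc ks)"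
      using cR by (intro B.finsum_cong' refl) (auto simp: Rc[symmetric] Ns[symmetric] simp del: One_nat_def)
    show "scale_mat W \<iota> p (h ^ (s - 1)) (\<Oplus>\<^bsub>M\<^esub>ks\<in>index_chains p s. Ns ks \<otimes>\<^bsub>M\<^esub> Rc ks)
      = W.scal p h [^]\<^bsub>M\<^esub> (s - 1) \<otimes>\<^bsub>M\<^esub> (\<Oplus>\<^bsub>M\<^esub>ks\<in>index_chains p s. B.ns p ks \<otimes>\<^bsub>M\<^esub> B.rc 1 ks)"
      unfolding eq by (rule sc[OF cl])
    show "(\<lambda>s. W.scal p h [^]\<^bsub>M\<^esub> (s - 1) \<otimes>\<^bsub>M\<^esub> (\<Oplus>\<^bsub>M\<^esub>ks\<in>index_chains p s. B.ns p ks \<otimes>\<^bsub>M\<^esub> B.rc 1 ks)) \<in> {1..p - 1} \<rightarrow> carrier M"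
      using rcM by (auto simp: Ns[symmetric] simp del: One_nat_def intro!: B.finsum_closed)
  qed
  \<comment> \<open>All terms still containing D. In each of them D is followed by scalar matrices
    only, so the entries lie in \<open>annih\<close>.\<close>
  define rest where "rest = Ns [] \<otimes>\<^bsub>M\<^esub> W.D\<^sub>1 p \<oplus>\<^bsub>M\<^esub>
    (\<Oplus>\<^bsub>M\<^esub>s\<in>{1..p - 1}. scale_mat W \<iota> p (h ^ s) (\<Oplus>\<^bsub>M\<^esub>ks\<in>index_chains p s. Ns ks \<otimes>\<^bsub>M\<^esub> W.D\<^sub>1 p \<otimes>\<^bsub>M\<^esub> Rc ks))"
  have "W.D\<^sub>1 p \<otimes>\<^bsub>M\<^esub> B.ns p [] = ?rhs \<oplus>\<^bsub>M\<^esub> rest"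
    unfolding rhs_eq rest_def sum_eq[OF cD, of "\<lambda>s. s"] Ns[of "[]"]
  proof (rule B.shifted_d_ns[OF p, where u = "W.scal p (inverse h)"])
    show "W.scal p (inverse h) \<in> carrier M"
      unfolding M_def by (intro W.scale_closed W.one_closed')
    show "W.scal p h \<otimes>\<^bsub>M\<^esub> W.scal p (inverse h) = \<one>\<^bsub>M\<^esub>"
      unfolding M_def using h by (simp flip: W.scal_mult add: W.scal_1)
    show "W.scal p (inverse h) \<otimes>\<^bsub>M\<^esub> x = x \<otimes>\<^bsub>M\<^esub> W.scal p (inverse h)" if "x \<in> carrier M" for x
      using that unfolding M_def by (rule W.scale_scal(2))
    show "W.D'\<^sub>1 p = W.scal p (inverse h) \<oplus>\<^bsub>M\<^esub> W.D\<^sub>1 p"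
      unfolding M_def by (rule W.D'1_eq[OF p1])
  qed (rule cD)
  then have DN: "W.D\<^sub>1 p \<otimes>\<^bsub>M\<^esub> Ns [] = ?rhs \<oplus>\<^bsub>M\<^esub> rest" by (simp only: Ns)
  have eN: "W.entries_in p (subalg_N R h) (Ns ks)" for ks
    unfolding Ns_def by (rule bar_prod_entries)
  have eR: "W.entries_in p (range \<iota>) (Rc ks)" if "ks \<in> index_chains p s" for ks s
    unfolding Rc_def by (rule R_cycle_entries[OF that])
  have eD: "W.entries_in p annih (W.D\<^sub>1 p)"
    by (intro W.entries_in_first weyl_D_annih annih_zero annih_subset)
  have eNR: "W.entries_in p (subalg_N R h) (Ns ks \<otimes>\<^bsub>M\<^esub> Rc ks)" if "ks \<in> index_chains p s" for ks s
    unfolding M_def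
    by (rule W.entries_in_mult[OF eN eR[OF that] _ subgroup_N]) (auto intro: subringE(6)[OF subring_N] scalar_subalg)
  have rhs_N: "W.entries_in p (subalg_N R h) ?rhs"
    using eNR fin unfolding M_def
    by (intro entries_in_finsum subgroup_N W.entries_in_scale) (auto intro: subringE(6)[OF subring_N] scalar_subalg)
  have l: "W.entries_in p annih (X \<otimes>\<^bsub>M\<^esub> Y)" if "X \<in> carrier M" "W.entries_in p annih Y" for X Y
    unfolding M_def
    by (rule W.entries_in_mult[OF W.entries_in_carrier[OF that(1)[unfolded M_def]] that(2) _ annih_subgroup]) (rule annih_left)
  have rr: "W.entries_in p annih (X \<otimes>\<^bsub>M\<^esub> Rc ks)" if "W.entries_in p annih X" "ks \<in> index_chains p s" for X ks s
    unfolding M_def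
    by (rule W.entries_in_mult[OF that(1) eR[OF that(2)] _ annih_subgroup]) (auto intro: annih_right_scalar)
  have "W.entries_in p annih (scale_mat W \<iota> p (h ^ s) (\<Oplus>\<^bsub>M\<^esub>ks\<in>index_chains p s. Ns ks \<otimes>\<^bsub>M\<^esub> W.D\<^sub>1 p \<otimes>\<^bsub>M\<^esub> Rc ks))" for s
    using fin rr[OF l[OF cN eD]] annih_left unfolding M_def
    by (intro W.entries_in_scale entries_in_finsum annih_subgroup) auto
  then have rest_annih: "W.entries_in p annih rest"
    unfolding rest_def M_def
    by (intro W.entries_in_add annih_subgroup l[unfolded M_def] cN[unfolded M_def] eD entries_in_finsum) auto
  have rhsc: "?rhs \<in> carrier M" "rest \<in> carrier M"
    using rhs_N rest_annih by (auto simp: W.entries_in_def M_def)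
  have act: "act R h (W.D\<^sub>1 p (I, L)) n \<in> subalg_N R h"
      "W.D\<^sub>1 p (I, L) \<otimes>\<^bsub>W\<^esub> n \<ominus>\<^bsub>W\<^esub> act R h (W.D\<^sub>1 p (I, L)) n \<in> annih"
    if "I \<in> multi_index p" "L \<in> multi_index p" "n \<in> subalg_N R h" for I L :: "'n list" and n
  proof -
    have "n \<in> carrier W" using that subalg_N_subset by auto
    then show "act R h (W.D\<^sub>1 p (I, L)) n \<in> subalg_N R h"
      "W.D\<^sub>1 p (I, L) \<otimes>\<^bsub>W\<^esub> n \<ominus>\<^bsub>W\<^esub> act R h (W.D\<^sub>1 p (I, L)) n \<in> annih"
      using that act_D[OF that(3)] subringE(2)[OF subring_N]
      by (auto simp: in_first_def act_zero minus_self_annih)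
  qed
  \<comment> \<open>The single values of \<open>act\<close> are never computed. Their sum and the
    claimed right side both lie in the algebra of the Ns and are congruent modulo
    \<open>annih\<close> to the same entry of D_1 N_2 ... N_p, hence equal by
    \<open>annih_unique\<close>.\<close>
  have entry: "mat_act R h p (W.D\<^sub>1 p) (Ns []) (I, J) \<in> subalg_N R h \<and>
      mat_act R h p (W.D\<^sub>1 p) (Ns []) (I, J) = ?rhs (I, J)"
    if IJ: "I \<in> multi_index p" "J \<in> multi_index p" for I J :: "'n list"
  proof -
    define v where "v L = act R h (W.D\<^sub>1 p (I, L)) (Ns [] (L, J))" for L
    define w where "w L = W.D\<^sub>1 p (I, L) \<otimes>\<^bsub>W\<^esub> Ns [] (L, J) \<ominus>\<^bsub>W\<^esub> v L" for L
    have n: "Ns [] (L, J) \<in> subalg_N R h" if "L \<in> multi_index p" for L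
      using W.entries_inD[OF eN that IJ(2)] .
    have v: "v L \<in> subalg_N R h" and w: "w L \<in> annih" if "L \<in> multi_index p" for L
      using act[OF IJ(1) that n[OF that]] by (auto simp: v_def w_def)
    have vc: "v L \<in> carrier W" and wc: "w L \<in> carrier W" if "L \<in> multi_index p" for L
      using v[OF that] w[OF that] subalg_N_subset annih_subset by auto
    have ma: "mat_act R h p (W.D\<^sub>1 p) (Ns []) (I, J) = (\<Oplus>\<^bsub>W\<^esub>L\<in>multi_index p. v L)"
      using IJ by (simp add: mat_act_def v_def)
    have mN: "(\<Oplus>\<^bsub>W\<^esub>L\<in>multi_index p. v L) \<in> subalg_N R h"
      by (rule W.sum_in_subgroup[OF subgroup_N]) (auto intro: v)
    have wA: "(\<Oplus>\<^bsub>W\<^esub>L\<in>multi_index p. w L) \<in> annih"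
      by (rule W.sum_in_subgroup[OF annih_subgroup]) (auto intro: w)
    have "(W.D\<^sub>1 p \<otimes>\<^bsub>M\<^esub> Ns []) (I, J) = (\<Oplus>\<^bsub>W\<^esub>L\<in>multi_index p. w L \<oplus>\<^bsub>W\<^esub> v L)"
      unfolding M_def W.mult_entry[OF IJ]
    proof (rule W.finsum_cong')
      fix L assume L: "L \<in> (multi_index p :: 'n list set)"
      have "W.D\<^sub>1 p (I, L) \<otimes>\<^bsub>W\<^esub> Ns [] (L, J) \<in> carrier W"
        using W.entry_closed[OF cD[unfolded M_def] IJ(1) L] W.entry_closed[OF cN[unfolded M_def] L IJ(2)] by simp
      then show "W.D\<^sub>1 p (I, L) \<otimes>\<^bsub>W\<^esub> Ns [] (L, J) = w L \<oplus>\<^bsub>W\<^esub> v L"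
        using vc[OF L] by (simp add: w_def a_minus_def W.a_assoc W.l_neg)
    qed (auto intro: vc wc)
    also have "\<dots> = (\<Oplus>\<^bsub>W\<^esub>L\<in>multi_index p. w L) \<oplus>\<^bsub>W\<^esub> (\<Oplus>\<^bsub>W\<^esub>L\<in>multi_index p. v L)"
      by (rule W.finsum_addf) (auto intro: vc wc)
    finally have 1: "(W.D\<^sub>1 p \<otimes>\<^bsub>M\<^esub> Ns []) (I, J) = \<dots>" .
    have mc: "(\<Oplus>\<^bsub>W\<^esub>L\<in>multi_index p. v L) \<in> carrier W" using mN subalg_N_subset by auto
    have a1: "(W.D\<^sub>1 p \<otimes>\<^bsub>M\<^esub> Ns []) (I, J) \<ominus>\<^bsub>W\<^esub> (\<Oplus>\<^bsub>W\<^esub>L\<in>multi_index p. v L) \<in> annih"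
      using wA annih_closed[OF wA] mc by (simp add: 1 a_minus_def W.a_assoc W.r_neg)
    have rN: "?rhs (I, J) \<in> subalg_N R h" by (rule W.entries_inD[OF rhs_N IJ])
    have rA: "rest (I, J) \<in> annih" by (rule W.entries_inD[OF rest_annih IJ])
    have rc: "?rhs (I, J) \<in> carrier W" "rest (I, J) \<in> carrier W"
      using rN rA subalg_N_subset annih_closed by blast+
    have eq: "(W.D\<^sub>1 p \<otimes>\<^bsub>M\<^esub> Ns []) (I, J) = ?rhs (I, J) \<oplus>\<^bsub>W\<^esub> rest (I, J)"
      unfolding DN by (simp only: M_def W.add_entry[OF IJ])
    have xy: "(x \<oplus>\<^bsub>W\<^esub> y) \<ominus>\<^bsub>W\<^esub> x = y" if "x \<in> carrier W" "y \<in> carrier W" for x y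
      using that by (simp add: a_minus_def W.a_comm[of x y] W.a_assoc W.r_neg)
    have a2: "(W.D\<^sub>1 p \<otimes>\<^bsub>M\<^esub> Ns []) (I, J) \<ominus>\<^bsub>W\<^esub> ?rhs (I, J) \<in> annih"
      unfolding eq xy[OF rc] by (rule rA)
    have wcl: "(W.D\<^sub>1 p \<otimes>\<^bsub>M\<^esub> Ns []) (I, J) \<in> carrier W"
      unfolding 1 using mc annih_closed[OF wA] by simp
    show ?thesis
      unfolding ma by (intro conjI mN annih_unique[OF mN rN wcl a1 a2])
  qed
  show ?B
  proof (rule W.mat_eqI[where p = p])
    show "mat_act R h p (W.D\<^sub>1 p) (Ns []) \<in> carrier (W.M p)"
      unfolding mat_act_def
    proof (rule W.mat_closed, rule W.finsum_closed, rule Pi_I)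
      fix I J L :: "'n list" assume "I \<in> multi_index p" "J \<in> multi_index p" "L \<in> multi_index p"
      then show "act R h (W.D\<^sub>1 p (I, L)) (Ns [] (L, J)) \<in> carrier W"
        using act(1)[of I L] W.entries_inD[OF eN] subalg_N_subset by blast
    qed
    show "?rhs \<in> carrier (W.M p)" using rhsc by (simp add: M_def)
  qed (use entry in auto)
qed

end

theorem mainTheorem4:
  fixes R :: "'k::real_normed_field ^ ('n::finite \<times> 'n) ^ ('n \<times> 'n)"
    and h :: 'k and p :: nat
  assumes "involutive_symmetry R"
    and "skew_invertible R"
    and "h \<noteq> 0"
    and "p \<ge> 2"
  shows
    "let W = weyl_algebra R h;
         M = End_tensor W p;
         \<iota> = weyl_scalar R h;
         D\<^sub>1 = in_first W p (weyl_D R h);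
         D'\<^sub>1 = in_first W p (weyl_D_shifted R h);
         Ns = bar_prod W \<iota> p R (weyl_N R h);
         Rc = R_cycle W \<iota> p R
     in
       D'\<^sub>1 \<otimes>\<^bsub>M\<^esub> Ns [] =
         Ns [] \<otimes>\<^bsub>M\<^esub> D'\<^sub>1 \<oplus>\<^bsub>M\<^esub>
         (\<Oplus>\<^bsub>M\<^esub>s\<in>{1..p - 1}. scale_mat W \<iota> p (h ^ s)
            (\<Oplus>\<^bsub>M\<^esub>ks\<in>index_chains p s. Ns ks \<otimes>\<^bsub>M\<^esub> D'\<^sub>1 \<otimes>\<^bsub>M\<^esub> Rc ks))
       \<and>
       mat_act R h p D\<^sub>1 (Ns []) =
         (\<Oplus>\<^bsub>M\<^esub>s\<in>{1..p - 1}. scale_mat W \<iota> p (h ^ (s - 1))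
            (\<Oplus>\<^bsub>M\<^esub>ks\<in>index_chains p s. Ns ks \<otimes>\<^bsub>M\<^esub> Rc ks))"
proof -
  obtain \<Psi> where "Tr2 (on12 R ** on23 \<Psi>) = flip_mat" "flip_mat = Tr2 (on12 \<Psi> ** on23 R)"
    using assms(2) by (auto simp: skew_invertible_def)
  then interpret weyl R \<Psi> h
    by unfold_locales (use assms in auto)
  show ?thesis unfolding Let_def by (intro conjI weyl_identities assms(4))
qed

end
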